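(* Let $(M,\hat g)$ be a compact Hermitian manifold and let $g=g(t)$, $t\in[0,\tau)$ with $0<\tau\le\infty$, be a smooth curve of Hermitian metrics on $M$. Let $\Psi=\nabla-\hat\nabla$ and $S=|\hat\nabla g|_g^2=|\Psi|_g^2$. Assume that there is a constant $K>0$ such that, at every point of $M$ and for every $t$, $$K^{-1}\hat g\le g\le K\hat g,$$ $$|\dot g+\widetilde{\rm Ric}|_g\le K(1+S^{1/2}),$$ $$|\nabla(\dot g+\widetilde{\rm Ric})|_g\le K\left(|\nabla\Psi|_g+|\bar\nabla\Psi|_g+1+S\right),$$ $$|T|_g\le K.$$ Then there exists a constant $C$, depending only on $M$, $K$, $\hat g$ and $g(0)$, such that $|\hat\nabla g|_g^2\le C$ on $M$ for every $t$.
   Context: Local holomorphic coordinates and Einstein summation are used; commas denote partial derivatives; barred indices on a tensor denote complex conjugation (e.g. $\Psi_{\bar m\bar p}^{\bar q}=\overline{\Psi_{mp}^q}$). For a Hermitian metric $g=(g_{r\bar s})$ with inverse $g^{\bar s r}$, the Chern connection $\nabla$ has Christoffel symbols $\Gamma_{ij}^k=g^{\bar r k}g_{j\bar r,i}$; its torsion is $T_{ij}^k=\Gamma_{ij}^k-\Gamma_{ji}^k$; its curvature is $R_{k\bar l r\bar s}=-g_{r\bar s,k\bar l}+g^{\bar b a}g_{a\bar s,\bar l}\,g_{r\bar b,k}$. The second Chern-Ricci tensor $\widetilde{\rm Ric}$ has components $\tilde R_{r\bar s}=g^{\bar l k}R_{k\bar l r\bar s}$. Here $\nabla$, $T$, $\widetilde{\rm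 Ric}$ are those of $g(t)$, $\hat\nabla$ is the Chern connection of $\hat g$, and $\dot g=\partial_t g$. The tensor $\Psi=\nabla-\hat\nabla$ has components $\Psi_{ij}^k=\Gamma_{ij}^k-\hat\Gamma_{ij}^k$, equivalently $\hat\nabla_i g_{j\bar l}=\Psi_{ij}^kg_{k\bar l}$, and $S=g_{k\bar q}g^{\bar m i}g^{\bar p j}\Psi_{ij}^k\Psi_{\bar m\bar p}^{\bar q}$. In norms, $\nabla$ and $\bar\nabla$ denote the $(1,0)$ and $(0,1)$ parts of the covariant derivative (components $\nabla_a$ and $\nabla_{\bar a}$), and $|\cdot|_g$ is the norm induced by $g(t)$. *)

theory Defs
  imports "HOL-Analysis.Analysis"
begin

section \<open>Smoothness and complex partial derivatives\<close>

text \<open>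
  The derivatives are taken within \<open>S\<close>, so that sets such as
  \<open>[0,\<tau>) \<times> \<Omega>\<close> with \<open>\<Omega>\<close> open are allowed; there the derivative
  within the set is still unique. On open sets this is the usual notion.
\<close>

primrec cont_diff_on :: "nat \<Rightarrow> 'b::real_normed_vector set \<Rightarrow> ('b \<Rightarrow> 'c::real_normed_vector) \<Rightarrow> bool"
where
  "cont_diff_on 0 S f \<longleftrightarrow> continuous_on S f"
| "cont_diff_on (Suc k) S f \<longleftrightarrow>
     (\<exists>f'. (\<forall>x\<in>S. (f has_derivative f' x) (at x within S)) \<and>
           (\<forall>v. cont_diff_on k S (\<lambda>x. f' x v)))"

definition smooth_on :: "'b::real_normed_vector set \<Rightarrow> ('b \<Rightarrow> 'c::real_normed_vector) \<Rightarrow> bool" where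
  "smooth_on S f \<longleftrightarrow> (\<forall>k. cont_diff_on k S f)"

text \<open>The operators $\partial/\partial z^i$ and $\partial/\partial\bar z^i$.\<close>

definition d_hol :: "'n::finite \<Rightarrow> (complex^'n \<Rightarrow> complex) \<Rightarrow> complex^'n \<Rightarrow> complex" where
  "d_hol i f z =
     (frechet_derivative f (at z) (axis i 1) - \<i> * frechet_derivative f (at z) (axis i \<i>)) / 2"

definition d_bar :: "'n::finite \<Rightarrow> (complex^'n \<Rightarrow> complex) \<Rightarrow> complex^'n \<Rightarrow> complex" where
  "d_bar i f z =
     (frechet_derivative f (at z) (axis i 1) + \<i> * frechet_derivative f (at z) (axis i \<i>)) / 2"

definition holomorphic_map_on :: "(complex^'n::finite) set \<Rightarrow> (complex^'n \<Rightarrow> complex^'n) \<Rightarrow> bool" where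
  "holomorphic_map_on S F \<longleftrightarrow>
     smooth_on S F \<and> (\<forall>z\<in>S. \<forall>p i. d_bar i (\<lambda>w. F w $ p) z = 0)"


section \<open>Complex manifolds\<close>

text \<open>A chart is a pair of its domain and its coordinate map; the map is irrelevant outside the domain.\<close>

type_synonym ('a, 'n) chart = "'a set \<times> ('a \<Rightarrow> complex^'n)"

definition chart_img :: "('a, 'n::finite) chart \<Rightarrow> (complex^'n) set" where
  "chart_img c = snd c ` fst c"

definition chart_inv :: "('a, 'n::finite) chart \<Rightarrow> complex^'n \<Rightarrow> 'a" where
  "chart_inv c = inv_into (fst c) (snd c)"

definition transition :: "('a, 'n::finite) chart \<Rightarrow> ('a, 'n) chart \<Rightarrow> complex^'n \<Rightarrow> complex^'n" where
  "transition c d = snd d \<circ> chart_inv c"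

definition is_chart :: "'a::topological_space set \<Rightarrow> ('a, 'n::finite) chart \<Rightarrow> bool" where
  "is_chart M c \<longleftrightarrow> openin (top_of_set M) (fst c) \<and> open (chart_img c) \<and>
     homeomorphism (fst c) (chart_img c) (snd c) (chart_inv c)"

definition holomorphic_atlas :: "'a::topological_space set \<Rightarrow> ('a, 'n::finite) chart set \<Rightarrow> bool" where
  "holomorphic_atlas M \<A> \<longleftrightarrow>
     (\<forall>c\<in>\<A>. is_chart M c) \<and> (\<Union>c\<in>\<A>. fst c) = M \<and>
     (\<forall>c\<in>\<A>. \<forall>d\<in>\<A>. holomorphic_map_on (snd c ` (fst c \<inter> fst d)) (transition c d))"

text \<open>Second countability follows from compactness.\<close>

definition compact_complex_manifold :: "'a::t2_space set \<Rightarrow> ('a, 'n::finite) chart set \<Rightarrow> bool" where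
  "compact_complex_manifold M \<A> \<longleftrightarrow> compact M \<and> holomorphic_atlas M \<A>"


section \<open>Hermitian metrics\<close>

text \<open>
  In a chart a metric is a matrix-valued function \<open>G\<close> of the coordinates, where
  \<open>G z $ r $ s\<close> is $g_{r\bar s}$. A metric on the manifold is the family of these functions,
  indexed by the charts and transforming as a $(1,1)$-tensor; its values matter only for charts
  of the atlas and points of the chart images.
\<close>

type_synonym 'n local_metric = "complex^'n \<Rightarrow> complex^'n^'n"

type_synonym ('a, 'n) metric_field = "('a, 'n) chart \<Rightarrow> 'n local_metric"

definition herm_form :: "complex^'n^'n::finite \<Rightarrow> complex^'n \<Rightarrow> real" where
  "herm_form H v = Re (\<Sum>r\<in>UNIV. \<Sum>s\<in>UNIV. H $ r $ s * v $ r * cnj (v $ s))"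

definition hermitian_metric ::
  "('a, 'n::finite) chart set \<Rightarrow> ('a, 'n) metric_field \<Rightarrow> bool" where
  "hermitian_metric \<A> g \<longleftrightarrow>
     (\<forall>c\<in>\<A>. smooth_on (chart_img c) (g c) \<and>
        (\<forall>z\<in>chart_img c.
           (\<forall>r s. g c z $ s $ r = cnj (g c z $ r $ s)) \<and>
           (\<forall>v. v \<noteq> 0 \<longrightarrow> herm_form (g c z) v > 0))) \<and>
     (\<forall>c\<in>\<A>. \<forall>d\<in>\<A>. \<forall>z\<in>snd c ` (fst c \<inter> fst d). \<forall>r s.
        g c z $ r $ s =
          (\<Sum>p\<in>UNIV. \<Sum>q\<in>UNIV. g d (transition c d z) $ p $ q *
             d_hol r (\<lambda>w. transition c d w $ p) z *
             cnj (d_hol s (\<lambda>w. transition c d w $ q) z)))"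

text \<open>The time interval $[0,\tau)$, with $\tau=\infty$ allowed.\<close>

definition time_interval :: "ereal \<Rightarrow> real set" where
  "time_interval \<tau> = {t. 0 \<le> t \<and> ereal t < \<tau>}"

definition smooth_curve_of_metrics ::
  "('a, 'n::finite) chart set \<Rightarrow> ereal \<Rightarrow> (real \<Rightarrow> ('a, 'n) metric_field) \<Rightarrow> bool" where
  "smooth_curve_of_metrics \<A> \<tau> g \<longleftrightarrow>
     (\<forall>t\<in>time_interval \<tau>. hermitian_metric \<A> (g t)) \<and>
     (\<forall>c\<in>\<A>. smooth_on (time_interval \<tau> \<times> chart_img c) (\<lambda>(t, z). g t c z))"


section \<open>Chern connection, torsion and curvature in a chart\<close>

text \<open>\<open>ginv H $ s $ r\<close> is $g^{\bar s r}$, so that $g^{\bar s r}g_{k\bar s}=\delta_k^r$.\<close>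

abbreviation ginv :: "complex^'n^'n::finite \<Rightarrow> complex^'n^'n" where
  "ginv H \<equiv> matrix_inv H"

text \<open>Argument order: \<open>christoffel G i j k\<close> is $\Gamma_{ij}^k$, and similarly for the other
  tensors with two lower indices and one upper index.\<close>

definition christoffel ::
  "'n::finite local_metric \<Rightarrow> 'n \<Rightarrow> 'n \<Rightarrow> 'n \<Rightarrow> complex^'n \<Rightarrow> complex" where
  "christoffel G i j k z =
     (\<Sum>r\<in>UNIV. ginv (G z) $ r $ k * d_hol i (\<lambda>w. G w $ j $ r) z)"

definition torsion ::
  "'n::finite local_metric \<Rightarrow> 'n \<Rightarrow> 'n \<Rightarrow> 'n \<Rightarrow> complex^'n \<Rightarrow> complex" where
  "torsion G i j k z = christoffel G i j k z - christoffel G j i k z"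

definition curvature ::
  "'n::finite local_metric \<Rightarrow> 'n \<Rightarrow> 'n \<Rightarrow> 'n \<Rightarrow> 'n \<Rightarrow> complex^'n \<Rightarrow> complex" where
  "curvature G k l r s z =
     - d_bar l (d_hol k (\<lambda>w. G w $ r $ s)) z +
     (\<Sum>a\<in>UNIV. \<Sum>b\<in>UNIV. ginv (G z) $ b $ a *
        d_bar l (\<lambda>w. G w $ a $ s) z * d_hol k (\<lambda>w. G w $ r $ b) z)"

definition second_chern_ricci ::
  "'n::finite local_metric \<Rightarrow> 'n \<Rightarrow> 'n \<Rightarrow> complex^'n \<Rightarrow> complex" where
  "second_chern_ricci G r s z =
     (\<Sum>k\<in>UNIV. \<Sum>l\<in>UNIV. ginv (G z) $ l $ k * curvature G k l r s z)"

text \<open>The difference $\Psi=\nabla-\hat\nabla$ of the Chern connections of \<open>G\<close> and \<open>Gh\<close>.\<close>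

definition Psi ::
  "'n::finite local_metric \<Rightarrow> 'n local_metric \<Rightarrow> 'n \<Rightarrow> 'n \<Rightarrow> 'n \<Rightarrow> complex^'n \<Rightarrow> complex" where
  "Psi G Gh i j k z = christoffel G i j k z - christoffel Gh i j k z"


section \<open>Covariant derivatives\<close>

text \<open>$\nabla_a A_{r\bar s}$ for the Chern connection of \<open>G\<close>; barred indices get no
  correction term in a $(1,0)$ direction.\<close>

definition nabla_11 ::
  "'n::finite local_metric \<Rightarrow> ('n \<Rightarrow> 'n \<Rightarrow> complex^'n \<Rightarrow> complex) \<Rightarrow>
   'n \<Rightarrow> 'n \<Rightarrow> 'n \<Rightarrow> complex^'n \<Rightarrow> complex" where
  "nabla_11 G A a r s z =
     d_hol a (A r s) z - (\<Sum>p\<in>UNIV. christoffel G a r p z * A p s z)"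

text \<open>$\nabla_a B_{ij}^k$ and $\nabla_{\bar a} B_{ij}^k$; the latter has no correction term
  because no index is barred.\<close>

definition nabla_21 ::
  "'n::finite local_metric \<Rightarrow> ('n \<Rightarrow> 'n \<Rightarrow> 'n \<Rightarrow> complex^'n \<Rightarrow> complex) \<Rightarrow>
   'n \<Rightarrow> 'n \<Rightarrow> 'n \<Rightarrow> 'n \<Rightarrow> complex^'n \<Rightarrow> complex" where
  "nabla_21 G B a i j k z =
     d_hol a (B i j k) z
     - (\<Sum>p\<in>UNIV. christoffel G a i p z * B p j k z)
     - (\<Sum>p\<in>UNIV. christoffel G a j p z * B i p k z)
     + (\<Sum>p\<in>UNIV. christoffel G a p k z * B i j p z)"

definition nabla_bar_21 ::
  "('n::finite \<Rightarrow> 'n \<Rightarrow> 'n \<Rightarrow> complex^'n \<Rightarrow> complex) \<Rightarrow>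
   'n \<Rightarrow> 'n \<Rightarrow> 'n \<Rightarrow> 'n \<Rightarrow> complex^'n \<Rightarrow> complex" where
  "nabla_bar_21 B a i j k z = d_bar a (B i j k) z"


section \<open>Pointwise norms\<close>

text \<open>
  Hermitian inner products, with respect to the matrix \<open>H\<close> of $g$ at a point, of tensors
  $A_{r\bar s}$ and $B_{ij}^k$. All of the squared norms below are real for Hermitian positive
  definite \<open>H\<close>; taking \<open>Re\<close> only changes the type.
\<close>

definition inner_11 ::
  "complex^'n^'n::finite \<Rightarrow> ('n \<Rightarrow> 'n \<Rightarrow> complex) \<Rightarrow> ('n \<Rightarrow> 'n \<Rightarrow> complex) \<Rightarrow> complex" where
  "inner_11 H A B =
     (\<Sum>r\<in>UNIV. \<Sum>s\<in>UNIV. \<Sum>p\<in>UNIV. \<Sum>q\<in>UNIV.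
        ginv H $ p $ r * ginv H $ s $ q * A r s * cnj (B p q))"

definition inner_21 ::
  "complex^'n^'n::finite \<Rightarrow> ('n \<Rightarrow> 'n \<Rightarrow> 'n \<Rightarrow> complex) \<Rightarrow> ('n \<Rightarrow> 'n \<Rightarrow> 'n \<Rightarrow> complex) \<Rightarrow> complex"
where
  "inner_21 H A B =
     (\<Sum>i\<in>UNIV. \<Sum>j\<in>UNIV. \<Sum>k\<in>UNIV. \<Sum>m\<in>UNIV. \<Sum>p\<in>UNIV. \<Sum>q\<in>UNIV.
        H $ k $ q * ginv H $ m $ i * ginv H $ p $ j * A i j k * cnj (B m p q))"

definition norm_11 :: "complex^'n^'n::finite \<Rightarrow> ('n \<Rightarrow> 'n \<Rightarrow> complex) \<Rightarrow> real" where
  "norm_11 H A = sqrt (Re (inner_11 H A A))"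

definition norm_21 :: "complex^'n^'n::finite \<Rightarrow> ('n \<Rightarrow> 'n \<Rightarrow> 'n \<Rightarrow> complex) \<Rightarrow> real" where
  "norm_21 H B = sqrt (Re (inner_21 H B B))"

text \<open>Norms of the same kinds of tensors with one additional lower index, put first; that index
  is unbarred in \<open>norm_d_11\<close> and \<open>norm_d_21\<close> and barred in \<open>norm_dbar_21\<close>.\<close>

definition norm_d_11 :: "complex^'n^'n::finite \<Rightarrow> ('n \<Rightarrow> 'n \<Rightarrow> 'n \<Rightarrow> complex) \<Rightarrow> real" where
  "norm_d_11 H A = sqrt (Re (\<Sum>a\<in>UNIV. \<Sum>b\<in>UNIV. ginv H $ b $ a * inner_11 H (A a) (A b)))"

definition norm_d_21 :: "complex^'n^'n::finite \<Rightarrow> ('n \<Rightarrow> 'n \<Rightarrow> 'n \<Rightarrow> 'n \<Rightarrow> complex) \<Rightarrow> real" where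
  "norm_d_21 H B = sqrt (Re (\<Sum>a\<in>UNIV. \<Sum>b\<in>UNIV. ginv H $ b $ a * inner_21 H (B a) (B b)))"

definition norm_dbar_21 :: "complex^'n^'n::finite \<Rightarrow> ('n \<Rightarrow> 'n \<Rightarrow> 'n \<Rightarrow> 'n \<Rightarrow> complex) \<Rightarrow> real" where
  "norm_dbar_21 H B = sqrt (Re (\<Sum>a\<in>UNIV. \<Sum>b\<in>UNIV. ginv H $ a $ b * inner_21 H (B a) (B b)))"


section \<open>The quantities in the estimate\<close>

definition torsion_norm :: "'n::finite local_metric \<Rightarrow> complex^'n \<Rightarrow> real" where
  "torsion_norm G z = norm_21 (G z) (\<lambda>i j k. torsion G i j k z)"

text \<open>$S=|\Psi|_g^2$\<close>

definition S_quantity :: "'n::finite local_metric \<Rightarrow> 'n local_metric \<Rightarrow> complex^'n \<Rightarrow> real" where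
  "S_quantity G Gh z = (norm_21 (G z) (\<lambda>i j k. Psi G Gh i j k z))\<^sup>2"

text \<open>$|\hat\nabla g|_g$, $|\nabla\Psi|_g$ and $|\bar\nabla\Psi|_g$\<close>

definition nabla_hat_g_norm :: "'n::finite local_metric \<Rightarrow> 'n local_metric \<Rightarrow> complex^'n \<Rightarrow> real" where
  "nabla_hat_g_norm G Gh z =
     norm_d_11 (G z) (\<lambda>a r s. nabla_11 Gh (\<lambda>r s w. G w $ r $ s) a r s z)"

definition nabla_Psi_norm :: "'n::finite local_metric \<Rightarrow> 'n local_metric \<Rightarrow> complex^'n \<Rightarrow> real" where
  "nabla_Psi_norm G Gh z = norm_d_21 (G z) (\<lambda>a i j k. nabla_21 G (Psi G Gh) a i j k z)"

definition nabla_bar_Psi_norm :: "'n::finite local_metric \<Rightarrow> 'n local_metric \<Rightarrow> complex^'n \<Rightarrow> real" where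
  "nabla_bar_Psi_norm G Gh z = norm_dbar_21 (G z) (\<lambda>a i j k. nabla_bar_21 (Psi G Gh) a i j k z)"

text \<open>The tensor $\dot g+\widetilde{\rm Ric}$ at time \<open>t\<close> in the chart \<open>c\<close>; at \<open>t = 0\<close> the
  time derivative is one-sided.\<close>

definition gdot_plus_ric ::
  "ereal \<Rightarrow> (real \<Rightarrow> ('a, 'n::finite) metric_field) \<Rightarrow> real \<Rightarrow> ('a, 'n) chart \<Rightarrow>
   'n \<Rightarrow> 'n \<Rightarrow> complex^'n \<Rightarrow> complex" where
  "gdot_plus_ric \<tau> g t c r s z =
     vector_derivative (\<lambda>u. g u c z $ r $ s) (at t within time_interval \<tau>)
     + second_chern_ricci (g t c) r s z"

end

theory Submission
  imports Defs
begin

text \<open>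
  The function $S=|\Psi|_g^2$ satisfies
  $(\partial_t-\Delta)S\le C(1+S^{3/2})$ with $\Delta=g^{\bar l k}\partial_k\partial_{\bar l}$:
  the curvature terms cancel except for $\dot g+\widetilde{\rm Ric}$, the torsion and the fixed
  curvature of $\hat g$, and the terms containing derivatives of $\Psi$ are absorbed by
  $-|\nabla\Psi|^2-|\bar\nabla\Psi|^2$. The trace $u$ of $g$ with respect to $\hat g$ satisfies
  $(\partial_t-\Delta)u\le C(1+S^{1/2})-S/C$. For large $\Lambda$ the maximum principle applied to
  $(\Lambda+u)S$ therefore bounds $S$ at a maximum point.

  In a chart, with $g$ a matrix \<open>G\<close>, the connection is the family of matrices
  $\theta_a=(\partial_aG)G^{-1}$, which turns the tensor calculus into noncommutative matrix algebra.
\<close>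

section \<open>Calculus of smooth functions\<close>

text \<open>With s = |Psi| the inequality for S has a right-hand side of order s^3, so the maximum
  principle for S alone gives no bound valid for all times. Multiplied by S, the term -S/C of u
  becomes -s^4, which beats s^3. The mixed gradient term of u and S also has order s^4; at a
  critical point it equals 2 S |du|^2/(Lambda + u), and this is why Lambda must be large. Curvature
  of g is never bounded by itself: up to the fixed curvature of \<open>gh\<close> it is the (0,1)
  derivative of Psi, and it meets another factor Psi, so Young's inequality applies.

  The bound has to be chosen before tau and g. Every constant is therefore explicit in K, the
  dimension and one number B controlling \<open>gh\<close> up to third derivatives on finitely many
  compact coordinate sets; the initial metric enters through a bound for S at time 0. Entrywise
  estimates suffice because comparability with \<open>gh\<close> bounds orthonormal frames and their
  inverses.

  Time and space form one variable in an open set, so that all operators have constant coefficients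
  and commute; time 0 is left to the initial bound and to continuity.\<close>

lemma cont_diff_on_cong:
  assumes "\<And>x. x \<in> S \<Longrightarrow> f x = g x"
  shows "cont_diff_on k S f \<longleftrightarrow> cont_diff_on k S g"
proof (cases k)
  case 0
  then show ?thesis using assms by (simp cong: continuous_on_cong)
next
  case (Suc m)
  have "(f has_derivative f') (at x within S) \<longleftrightarrow> (g has_derivative f') (at x within S)"
    if "x \<in> S" for f' x
    using assms that by (metis has_derivative_transform)
  then show ?thesis using Suc by auto
qed

lemma cont_diff_on_SucI:
  assumes "\<And>x. x \<in> S \<Longrightarrow> (f has_derivative f' x) (at x within S)"
    and "\<And>v. cont_diff_on k S (\<lambda>x. f' x v)"
  shows "cont_diff_on (Suc k) S f"
  using assms by auto

lemma cont_diff_on_Suc_imp: "cont_diff_on (Suc k) S f \<Longrightarrow> cont_diff_on k S f"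
proof (induction k arbitrary: f)
  case 0
  then show ?case
    by (auto simp: continuous_on_eq_continuous_within intro: has_derivative_continuous)
next
  case (Suc k)
  then show ?case by (metis cont_diff_on.simps(2))
qed

lemma cont_diff_on_subset: "cont_diff_on k S f \<Longrightarrow> T \<subseteq> S \<Longrightarrow> cont_diff_on k T f"
proof (induction k arbitrary: f)
  case 0
  then show ?case by (auto intro: continuous_on_subset)
next
  case (Suc k)
  then obtain f' where "\<And>x. x\<in>S \<Longrightarrow> (f has_derivative f' x) (at x within S)"
    "\<And>v. cont_diff_on k S (\<lambda>x. f' x v)" by auto
  then show ?case using Suc.IH Suc.prems(2)
    by (intro cont_diff_on_SucI[of T f f' k]) (blast intro: has_derivative_subset)+
qed

lemma cont_diff_on_const: "cont_diff_on k S (\<lambda>x. c)"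
proof (induction k arbitrary: c)
  case (Suc k)
  show ?case by (auto intro!: exI[of _ "\<lambda>_ _. 0"] Suc)
qed auto

lemma cont_diff_on_add:
  "cont_diff_on k S f \<Longrightarrow> cont_diff_on k S g \<Longrightarrow> cont_diff_on k S (\<lambda>x. f x + g x)"
proof (induction k arbitrary: f g)
  case 0
  then show ?case by (auto intro: continuous_intros)
next
  case (Suc k)
  obtain f' where f: "\<And>x. x\<in>S \<Longrightarrow> (f has_derivative f' x) (at x within S)"
    "\<And>v. cont_diff_on k S (\<lambda>x. f' x v)" using Suc.prems by auto
  obtain g' where g: "\<And>x. x\<in>S \<Longrightarrow> (g has_derivative g' x) (at x within S)"
    "\<And>v. cont_diff_on k S (\<lambda>x. g' x v)" using Suc.prems by auto
  show ?case
    by (rule cont_diff_on_SucI[where f' = "\<lambda>x v. f' x v + g' x v"])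
      (use f g Suc.IH has_derivative_add in blast)+
qed

lemma cont_diff_on_bounded_linear:
  assumes "bounded_linear L"
  shows "cont_diff_on k S f \<Longrightarrow> cont_diff_on k S (\<lambda>x. L (f x))"
proof (induction k arbitrary: f)
  case 0
  then show ?case using assms by (auto intro: bounded_linear.continuous_on)
next
  case (Suc k)
  obtain f' where f: "\<And>x. x\<in>S \<Longrightarrow> (f has_derivative f' x) (at x within S)"
    "\<And>v. cont_diff_on k S (\<lambda>x. f' x v)" using Suc.prems by auto
  show ?case
    by (rule cont_diff_on_SucI[where f' = "\<lambda>x v. L (f' x v)"])
      (use f Suc.IH bounded_linear.has_derivative[OF assms] in blast)+
qed

lemma cont_diff_on_bilinear:
  assumes "bounded_bilinear B"
  shows "cont_diff_on k S f \<Longrightarrow> cont_diff_on k S g \<Longrightarrow> cont_diff_on k S (\<lambda>x. B (f x) (g x))"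
proof (induction k arbitrary: f g)
  case 0
  then show ?case using assms by (auto intro: bounded_bilinear.continuous_on)
next
  case (Suc k)
  obtain f' where f: "\<And>x. x\<in>S \<Longrightarrow> (f has_derivative f' x) (at x within S)"
    "\<And>v. cont_diff_on k S (\<lambda>x. f' x v)" using Suc.prems by auto
  obtain g' where g: "\<And>x. x\<in>S \<Longrightarrow> (g has_derivative g' x) (at x within S)"
    "\<And>v. cont_diff_on k S (\<lambda>x. g' x v)" using Suc.prems by auto
  have "cont_diff_on k S f" "cont_diff_on k S g"
    using Suc.prems cont_diff_on_Suc_imp by auto
  then have "cont_diff_on k S (\<lambda>x. B (f x) (g' x v) + B (f' x v) (g x))" for v
    using f(2)[of v] g(2)[of v] Suc.IH cont_diff_on_add by blast
  moreover have "((\<lambda>x. B (f x) (g x)) has_derivative (\<lambda>v. B (f x) (g' x v) + B (f' x v) (g x)))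
      (at x within S)" if "x \<in> S" for x
    using bounded_bilinear.FDERIV[OF assms f(1)[OF that] g(1)[OF that]] .
  ultimately show ?case by (rule cont_diff_on_SucI[rotated])
qed

text \<open>For linear L the derivative of f(L x) along v is that of f along the fixed vector L v,
  so the recursion over fixed directions closes. For a general inner map the direction would depend
  on x.\<close>

lemma cont_diff_on_compose_linear:
  assumes "bounded_linear L" "L ` T \<subseteq> S"
  shows "cont_diff_on k S f \<Longrightarrow> cont_diff_on k T (\<lambda>x. f (L x))"
proof (induction k arbitrary: f)
  case 0
  then show ?case
    using assms continuous_on_compose2[of S f T L] linear_continuous_on[of L T] by simp
next
  case (Suc k)
  obtain f' where f: "\<And>x. x\<in>S \<Longrightarrow> (f has_derivative f' x) (at x within S)"
    "\<And>v. cont_diff_on k S (\<lambda>x. f' x v)" using Suc.prems by auto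
  have "((\<lambda>x. f (L x)) has_derivative (\<lambda>v. f' (L x) (L v))) (at x within T)" if "x \<in> T" for x
  proof -
    have "L x \<in> S" using that assms by auto
    then have "(f has_derivative f' (L x)) (at (L x) within L ` T)"
      using f(1) assms(2) has_derivative_subset by blast
    then show ?thesis
      using has_derivative_in_compose[of L L x T f "f' (L x)"]
        bounded_linear_imp_has_derivative[OF assms(1)] by auto
  qed
  then show ?case
    using Suc.IH[OF f(2)] by (rule cont_diff_on_SucI)
qed

text \<open>The derivative of the inverse contains the inverse itself, but one order of
  differentiability lower; the induction on k supplies it. Together with Cramer's rule this makes
  inverse matrices smooth.\<close>

lemma cont_diff_on_inverse:
  fixes f :: "'b::real_normed_vector \<Rightarrow> complex"
  assumes "\<And>x. x \<in> S \<Longrightarrow> f x \<noteq> 0"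
  shows "cont_diff_on k S f \<Longrightarrow> cont_diff_on k S (\<lambda>x. inverse (f x))"
proof (induction k)
  case 0
  then show ?case using assms by (auto intro: continuous_intros)
next
  case (Suc k)
  obtain f' where f: "\<And>x. x\<in>S \<Longrightarrow> (f has_derivative f' x) (at x within S)"
    "\<And>v. cont_diff_on k S (\<lambda>x. f' x v)" using Suc.prems by auto
  have "cont_diff_on k S f"
    using Suc.prems cont_diff_on_Suc_imp by auto
  with Suc have i: "cont_diff_on k S (\<lambda>x. inverse (f x))" by simp
  have "cont_diff_on k S (\<lambda>x. - (inverse (f x) * f' x v * inverse (f x)))" for v
    using cont_diff_on_bounded_linear[OF bounded_linear_minus[OF bounded_linear_ident]
        cont_diff_on_bilinear[OF bounded_bilinear_mult
          cont_diff_on_bilinear[OF bounded_bilinear_mult i f(2)] i]] by simp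
  moreover have "((\<lambda>x. inverse (f x)) has_derivative
      (\<lambda>v. - (inverse (f x) * f' x v * inverse (f x)))) (at x within S)" if "x \<in> S" for x
    using Deriv.has_derivative_inverse[OF assms[OF that] f(1)[OF that]] .
  ultimately show ?case by (rule cont_diff_on_SucI[rotated])
qed

lemma smooth_on_cong: "(\<And>x. x \<in> S \<Longrightarrow> f x = g x) \<Longrightarrow> smooth_on S f \<longleftrightarrow> smooth_on S g"
  unfolding smooth_on_def using cont_diff_on_cong by metis

lemma smooth_on_subset: "smooth_on S f \<Longrightarrow> T \<subseteq> S \<Longrightarrow> smooth_on T f"
  unfolding smooth_on_def using cont_diff_on_subset by blast

lemma smooth_on_const [simp]: "smooth_on S (\<lambda>x. c)"
  unfolding smooth_on_def using cont_diff_on_const by blast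

lemma smooth_on_add: "smooth_on S f \<Longrightarrow> smooth_on S g \<Longrightarrow> smooth_on S (\<lambda>x. f x + g x)"
  unfolding smooth_on_def using cont_diff_on_add by blast

lemma smooth_on_bounded_linear:
  "bounded_linear L \<Longrightarrow> smooth_on S f \<Longrightarrow> smooth_on S (\<lambda>x. L (f x))"
  unfolding smooth_on_def using cont_diff_on_bounded_linear by blast

lemma smooth_on_mult:
  fixes f g :: "'b::real_normed_vector \<Rightarrow> complex"
  shows "smooth_on S f \<Longrightarrow> smooth_on S g \<Longrightarrow> smooth_on S (\<lambda>x. f x * g x)"
  unfolding smooth_on_def using cont_diff_on_bilinear[OF bounded_bilinear_mult] by blast

lemma smooth_on_inverse:
  fixes f :: "'b::real_normed_vector \<Rightarrow> complex"
  shows "(\<And>x. x \<in> S \<Longrightarrow> f x \<noteq> 0) \<Longrightarrow> smooth_on S f \<Longrightarrow> smooth_on S (\<lambda>x. inverse (f x))"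
  unfolding smooth_on_def using cont_diff_on_inverse by blast

lemma smooth_on_compose_linear:
  "bounded_linear L \<Longrightarrow> L ` T \<subseteq> S \<Longrightarrow> smooth_on S f \<Longrightarrow> smooth_on T (\<lambda>x. f (L x))"
  unfolding smooth_on_def using cont_diff_on_compose_linear by blast

lemma smooth_on_uminus: "smooth_on S f \<Longrightarrow> smooth_on S (\<lambda>x. - f x)"
  by (rule smooth_on_bounded_linear[OF bounded_linear_minus[OF bounded_linear_ident]])

lemma smooth_on_diff: "smooth_on S f \<Longrightarrow> smooth_on S g \<Longrightarrow> smooth_on S (\<lambda>x. f x - g x)"
  using smooth_on_add[of S f "\<lambda>x. - g x"] smooth_on_uminus[of S g] by simp

lemma smooth_on_cnj: "smooth_on S f \<Longrightarrow> smooth_on S (\<lambda>x. cnj (f x))"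
  by (rule smooth_on_bounded_linear[OF bounded_linear_cnj])

lemma smooth_on_divide:
  fixes f :: "'b::real_normed_vector \<Rightarrow> complex"
  shows "smooth_on S f \<Longrightarrow> smooth_on S (\<lambda>x. f x / c)"
  using smooth_on_mult[of S f "\<lambda>x. inverse c"] by (simp add: field_simps)

lemma smooth_on_sum:
  "(\<And>i. i \<in> A \<Longrightarrow> smooth_on S (f i)) \<Longrightarrow> smooth_on S (\<lambda>x. \<Sum>i\<in>A. f i x)"
  by (induction A rule: infinite_finite_induct) (auto intro: smooth_on_add)

lemma smooth_on_prod:
  fixes f :: "'i \<Rightarrow> 'b::real_normed_vector \<Rightarrow> complex"
  shows "(\<And>i. i \<in> A \<Longrightarrow> smooth_on S (f i)) \<Longrightarrow> smooth_on S (\<lambda>x. \<Prod>i\<in>A. f i x)"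
  by (induction A rule: infinite_finite_induct) (auto intro: smooth_on_mult)

lemma smooth_on_imp_continuous_on: "smooth_on S f \<Longrightarrow> continuous_on S f"
  unfolding smooth_on_def by (metis cont_diff_on.simps(1))

lemma smooth_on_obtain_derivative:
  assumes "smooth_on S f"
  obtains f' where "\<And>x. x\<in>S \<Longrightarrow> (f has_derivative f' x) (at x within S)"
    "\<And>v. continuous_on S (\<lambda>x. f' x v)"
  using assms[unfolded smooth_on_def, rule_format, of "Suc 0"] by auto

lemma smooth_on_differentiable:
  assumes "open S" "smooth_on S f" "x \<in> S"
  shows "f differentiable (at x)"
  using smooth_on_obtain_derivative[OF assms(2)] assms(1,3)
  by (metis at_within_open differentiable_def)

lemma smooth_on_derivative:
  assumes "open S" "smooth_on S f"
  shows "smooth_on S (\<lambda>x. frechet_derivative f (at x) v)"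
  unfolding smooth_on_def
proof
  fix k
  have "cont_diff_on (Suc k) S f" using assms unfolding smooth_on_def by blast
  then obtain f' where f: "\<And>x. x\<in>S \<Longrightarrow> (f has_derivative f' x) (at x within S)"
    "\<And>v. cont_diff_on k S (\<lambda>x. f' x v)" by auto
  have "frechet_derivative f (at x) v = f' x v" if "x \<in> S" for x
    using f(1)[OF that] that assms(1) by (metis at_within_open frechet_derivative_at)
  then show "cont_diff_on k S (\<lambda>x. frechet_derivative f (at x) v)"
    using f(2)[of v] by (simp cong: cont_diff_on_cong)
qed

section \<open>Symmetry of second derivatives\<close>

lemma has_real_derivative_along_line:
  fixes f :: "'b::real_normed_vector \<Rightarrow> real"
  assumes "f differentiable (at (x + s *\<^sub>R v))"
  shows "((\<lambda>s. f (x + s *\<^sub>R v)) has_real_derivative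
     frechet_derivative f (at (x + s *\<^sub>R v)) v) (at s)"
proof -
  have 1: "((\<lambda>s. x + s *\<^sub>R v) has_derivative (\<lambda>h. h *\<^sub>R v)) (at s)"
    by (auto intro!: derivative_eq_intros)
  have 2: "(f has_derivative frechet_derivative f (at (x + s *\<^sub>R v))) (at (x + s *\<^sub>R v))"
    using assms frechet_derivative_works by blast
  have "((\<lambda>s. f (x + s *\<^sub>R v)) has_derivative
      (\<lambda>h. frechet_derivative f (at (x + s *\<^sub>R v)) (h *\<^sub>R v))) (at s)"
    using diff_chain_at[OF 1 2] by (simp add: o_def)
  moreover have "frechet_derivative f (at (x + s *\<^sub>R v)) (h *\<^sub>R v)
      = h * frechet_derivative f (at (x + s *\<^sub>R v)) v" for h
    using linear_frechet_derivative[OF assms] by (simp add: linear_scale)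
  ultimately show ?thesis
    by (simp add: has_field_derivative_def mult_commute_abs)
qed

text \<open>Two applications of the mean value theorem to the second difference quotient.\<close>

lemma second_difference_mean_value:
  fixes f :: "'b::real_normed_vector \<Rightarrow> real"
  assumes "open S" "smooth_on S f" "h > 0"
    and dom: "\<And>a b. 0 \<le> a \<Longrightarrow> a \<le> h \<Longrightarrow> 0 \<le> b \<Longrightarrow> b \<le> h \<Longrightarrow> x + a *\<^sub>R v + b *\<^sub>R w \<in> S"
  shows "\<exists>a b. 0 \<le> a \<and> a \<le> h \<and> 0 \<le> b \<and> b \<le> h \<and>
    f (x + h *\<^sub>R v + h *\<^sub>R w) - f (x + h *\<^sub>R v) - f (x + h *\<^sub>R w) + f x =
    h * h * frechet_derivative (\<lambda>y. frechet_derivative f (at y) v) (at (x + a *\<^sub>R v + b *\<^sub>R w)) w"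
proof -
  define fv where "fv = (\<lambda>y. frechet_derivative f (at y) v)"
  have sm: "smooth_on S fv" unfolding fv_def by (rule smooth_on_derivative[OF assms(1,2)])
  have dif: "f differentiable (at y)" "fv differentiable (at y)" if "y \<in> S" for y
    using smooth_on_differentiable assms(1,2) sm that by auto
  have d1: "((\<lambda>a. f (x + a *\<^sub>R v + h *\<^sub>R w) - f (x + a *\<^sub>R v)) has_real_derivative
      (fv (x + a *\<^sub>R v + h *\<^sub>R w) - fv (x + a *\<^sub>R v))) (at a)" if "0 \<le> a" "a \<le> h" for a
  proof -
    have "x + h *\<^sub>R w + a *\<^sub>R v \<in> S" "x + a *\<^sub>R v \<in> S"
      using dom[of a h] dom[of a 0] that assms(3) by (auto simp: algebra_simps)
    from has_real_derivative_along_line[OF dif(1)[OF this(1)]]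
      has_real_derivative_along_line[OF dif(1)[OF this(2)]]
    show ?thesis unfolding fv_def by (auto intro!: DERIV_diff simp: algebra_simps)
  qed
  from MVT2[OF assms(3) d1] obtain a where a: "0 < a" "a < h"
    "f (x + h *\<^sub>R v + h *\<^sub>R w) - f (x + h *\<^sub>R v) - (f (x + 0 *\<^sub>R v + h *\<^sub>R w) - f (x + 0 *\<^sub>R v))
     = (h - 0) * (fv (x + a *\<^sub>R v + h *\<^sub>R w) - fv (x + a *\<^sub>R v))" by auto
  have d2: "((\<lambda>b. fv (x + a *\<^sub>R v + b *\<^sub>R w)) has_real_derivative
      frechet_derivative fv (at (x + a *\<^sub>R v + b *\<^sub>R w)) w) (at b)" if "0 \<le> b" "b \<le> h" for b
    using has_real_derivative_along_line[OF dif(2)[OF dom[of a b]]] that a by auto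
  from MVT2[OF assms(3) d2] obtain b where b: "0 < b" "b < h"
    "fv (x + a *\<^sub>R v + h *\<^sub>R w) - fv (x + a *\<^sub>R v + 0 *\<^sub>R w)
      = (h - 0) * frechet_derivative fv (at (x + a *\<^sub>R v + b *\<^sub>R w)) w" by auto
  have "f (x + h *\<^sub>R v + h *\<^sub>R w) - f (x + h *\<^sub>R v) - f (x + h *\<^sub>R w) + f x
    = h * h * frechet_derivative fv (at (x + a *\<^sub>R v + b *\<^sub>R w)) w"
    using a(3) b(3) by (simp add: algebra_simps)
  then show ?thesis using a b unfolding fv_def by (intro exI[of _ a] exI[of _ b]) auto
qed

text \<open>The second difference over a small parallelogram is symmetric in v and w, and by the
  mean value theorem it is h^2 times either mixed derivative at a nearby point. Continuity of both
  mixed derivatives at x does the rest.\<close>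

lemma real_derivatives_commute:
  fixes f :: "'b::real_normed_vector \<Rightarrow> real"
  assumes "open S" "smooth_on S f" "x \<in> S"
  shows "frechet_derivative (\<lambda>y. frechet_derivative f (at y) v) (at x) w =
         frechet_derivative (\<lambda>y. frechet_derivative f (at y) w) (at x) v"
proof -
  define A where "A = (\<lambda>y. frechet_derivative (\<lambda>y. frechet_derivative f (at y) v) (at y) w)"
  define B where "B = (\<lambda>y. frechet_derivative (\<lambda>y. frechet_derivative f (at y) w) (at y) v)"
  have c: "continuous_on S A" "continuous_on S B" unfolding A_def B_def
    using assms by (auto intro!: smooth_on_imp_continuous_on smooth_on_derivative)
  have "\<bar>A x - B x\<bar> \<le> e" if "e > 0" for e
  proof -
    have "isCont A x" "isCont B x" using c assms(1,3) continuous_on_eq_continuous_at by blast+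
    moreover have "e / 2 > 0" using \<open>e > 0\<close> by simp
    ultimately have "\<exists>d>0. \<forall>y. dist y x < d \<longrightarrow> dist (A y) (A x) < e/2"
      "\<exists>d>0. \<forall>y. dist y x < d \<longrightarrow> dist (B y) (B x) < e/2"
      unfolding continuous_at_eps_delta by blast+
    then obtain d1 d2 where d: "d1 > 0" "\<And>y. dist y x < d1 \<Longrightarrow> dist (A y) (A x) < e/2"
      "d2 > 0" "\<And>y. dist y x < d2 \<Longrightarrow> dist (B y) (B x) < e/2"
      by blast
    obtain d3 where d3: "d3 > 0" "ball x d3 \<subseteq> S" using assms open_contains_ball by blast
    define d where "d = min d1 (min d2 d3)"
    have dpos: "d > 0" using d d3 by (simp add: d_def)
    \<comment> \<open>This size keeps the whole parallelogram within distance d of x; the summand 1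
      keeps the denominator positive when v and w vanish.\<close>
    define h where "h = d / (2 * (norm v + norm w + 1))"
    have np: "norm v + norm w + 1 > 0" by (smt (verit) norm_ge_zero)
    have h: "h > 0" using dpos np by (simp add: h_def)
    have near: "dist (x + a *\<^sub>R v + b *\<^sub>R w) x < d"
      if "0 \<le> a" "a \<le> h" "0 \<le> b" "b \<le> h" for a b
    proof -
      have "dist (x + a *\<^sub>R v + b *\<^sub>R w) x = norm (a *\<^sub>R v + b *\<^sub>R w)" by (simp add: dist_norm)
      also have "\<dots> \<le> a * norm v + b * norm w"
        using that by (metis abs_of_nonneg norm_scaleR norm_triangle_ineq)
      also have "\<dots> \<le> h * norm v + h * norm w"
        using that by (intro add_mono mult_right_mono) auto
      also have "\<dots> < h * (2 * (norm v + norm w + 1))"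
      proof -
        have "norm v + norm w < 2 * (norm v + norm w + 1)" by (smt (verit) norm_ge_zero)
        then show ?thesis using h by (metis distrib_left mult_strict_left_mono)
      qed
      also have "\<dots> = d" using np by (simp add: h_def)
      finally show ?thesis .
    qed
    have near': "dist (x + a *\<^sub>R w + b *\<^sub>R v) x < d"
      if "0 \<le> a" "a \<le> h" "0 \<le> b" "b \<le> h" for a b
      using near[of b a] that by (simp add: algebra_simps)
    have dom: "x + a *\<^sub>R v + b *\<^sub>R w \<in> S" if "0 \<le> a" "a \<le> h" "0 \<le> b" "b \<le> h" for a b
      using near[OF that] d3 unfolding d_def by (auto simp: dist_commute)
    have dom': "x + a *\<^sub>R w + b *\<^sub>R v \<in> S" if "0 \<le> a" "a \<le> h" "0 \<le> b" "b \<le> h" for a b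
      using near'[OF that] d3 unfolding d_def by (auto simp: dist_commute)
    obtain a b where ab: "0 \<le> a" "a \<le> h" "0 \<le> b" "b \<le> h"
      "f (x + h *\<^sub>R v + h *\<^sub>R w) - f (x + h *\<^sub>R v) - f (x + h *\<^sub>R w) + f x
        = h * h * A (x + a *\<^sub>R v + b *\<^sub>R w)"
      using second_difference_mean_value[OF assms(1,2) h dom] unfolding A_def by blast
    obtain a' b' where ab': "0 \<le> a'" "a' \<le> h" "0 \<le> b'" "b' \<le> h"
      "f (x + h *\<^sub>R w + h *\<^sub>R v) - f (x + h *\<^sub>R w) - f (x + h *\<^sub>R v) + f x
        = h * h * B (x + a' *\<^sub>R w + b' *\<^sub>R v)"
      using second_difference_mean_value[OF assms(1,2) h dom'] unfolding B_def by blast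
    have "h * h * A (x + a *\<^sub>R v + b *\<^sub>R w) = h * h * B (x + a' *\<^sub>R w + b' *\<^sub>R v)"
      using ab(5) ab'(5) by (simp add: algebra_simps)
    then have "A (x + a *\<^sub>R v + b *\<^sub>R w) = B (x + a' *\<^sub>R w + b' *\<^sub>R v)" using h by simp
    moreover have "dist (A (x + a *\<^sub>R v + b *\<^sub>R w)) (A x) < e/2"
      using d(2) near[OF ab(1-4)] by (simp add: d_def)
    moreover have "dist (B (x + a' *\<^sub>R w + b' *\<^sub>R v)) (B x) < e/2"
      using d(4) near'[OF ab'(1-4)] by (simp add: d_def)
    ultimately show ?thesis unfolding dist_real_def by linarith
  qed
  then have "\<bar>A x - B x\<bar> \<le> 0" using field_le_epsilon[of "\<bar>A x - B x\<bar>" 0] by simp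
  then show ?thesis unfolding A_def B_def by simp
qed

lemma frechet_derivative_bounded_linear:
  assumes "bounded_linear L" "f differentiable (at x)"
  shows "frechet_derivative (\<lambda>y. L (f y)) (at x) v = L (frechet_derivative f (at x) v)"
proof -
  have "((\<lambda>y. L (f y)) has_derivative (\<lambda>v. L (frechet_derivative f (at x) v))) (at x)"
    using assms frechet_derivative_works bounded_linear.has_derivative by blast
  then show ?thesis using frechet_derivative_at by metis
qed

lemma frechet_derivative_cong_open:
  assumes "open S" "x \<in> S" "\<And>y. y \<in> S \<Longrightarrow> f y = g y"
  shows "frechet_derivative f (at x) = frechet_derivative g (at x)"
proof -
  have "(f has_derivative f') (at x) \<longleftrightarrow> (g has_derivative f') (at x)" for f'
    using assms by (metis has_derivative_transform_within_open)
  then show ?thesis unfolding frechet_derivative_def by simp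
qed

lemma complex_derivatives_commute:
  fixes f :: "'b::real_normed_vector \<Rightarrow> complex"
  assumes "open S" "smooth_on S f" "x \<in> S"
  shows "frechet_derivative (\<lambda>y. frechet_derivative f (at y) v) (at x) w =
         frechet_derivative (\<lambda>y. frechet_derivative f (at y) w) (at x) v"
proof -
  have *: "L (frechet_derivative (\<lambda>y. frechet_derivative f (at y) v) (at x) w) =
         L (frechet_derivative (\<lambda>y. frechet_derivative f (at y) w) (at x) v)"
    if L: "bounded_linear L" for L :: "complex \<Rightarrow> real"
  proof -
    have "L (frechet_derivative (\<lambda>y. frechet_derivative f (at y) v) (at x) w)
      = frechet_derivative (\<lambda>y. L (frechet_derivative f (at y) v)) (at x) w" for v w
      using frechet_derivative_bounded_linear[OF L] smooth_on_derivative[OF assms(1,2)]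
        smooth_on_differentiable assms by metis
    moreover have "frechet_derivative (\<lambda>y. L (frechet_derivative f (at y) v)) (at x) w
      = frechet_derivative (\<lambda>y. frechet_derivative (\<lambda>y. L (f y)) (at y) v) (at x) w" for v w
      using frechet_derivative_cong_open[OF assms(1,3)]
        frechet_derivative_bounded_linear[OF L smooth_on_differentiable[OF assms(1,2)]]
      by (metis (no_types, lifting))
    ultimately show ?thesis
      using real_derivatives_commute[OF assms(1) smooth_on_bounded_linear[OF L assms(2)] assms(3)]
      by simp
  qed
  show ?thesis
    using *[OF bounded_linear_Re] *[OF bounded_linear_Im] complex_eqI by blast
qed
section \<open>Matrices\<close>

definition cscale :: "complex \<Rightarrow> complex^'n^'m \<Rightarrow> complex^'n^'m" (infixr "*\<^sub>m" 75) where
  "c *\<^sub>m A = (\<chi> i j. c * A $ i $ j)"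

definition adj :: "complex^'n^'m \<Rightarrow> complex^'m^'n" where
  "adj A = (\<chi> i j. cnj (A $ j $ i))"

lemma cscale_nth [simp]: "(c *\<^sub>m A) $ i $ j = c * A $ i $ j"
  by (simp add: cscale_def)

lemma adj_nth [simp]: "adj A $ i $ j = cnj (A $ j $ i)"
  by (simp add: adj_def)

lemma matrix_mult_nth: "(A ** B) $ i $ j = (\<Sum>k\<in>UNIV. A $ i $ k * B $ k $ j)"
  by (simp add: matrix_matrix_mult_def)

lemma matrix_diff_ldistrib: "A ** (B - C) = A ** B - A ** (C :: complex^'n^'m)"
  by (simp add: vec_eq_iff matrix_mult_nth algebra_simps sum_subtractf)

lemma matrix_diff_rdistrib: "(A - B) ** C = A ** C - B ** (C :: complex^'n^'m)"
  by (simp add: vec_eq_iff matrix_mult_nth algebra_simps sum_subtractf)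

lemma matrix_add_rdistrib': "(A + B) ** C = A ** C + B ** (C :: complex^'n^'m)"
  by (simp add: vec_eq_iff matrix_mult_nth algebra_simps sum.distrib)

lemma matrix_uminus_left: "(- A) ** C = - (A ** (C :: complex^'n^'m))"
  by (simp add: vec_eq_iff matrix_mult_nth sum_negf)

lemma matrix_uminus_right: "A ** (- C) = - (A ** (C :: complex^'n^'m))"
  by (simp add: vec_eq_iff matrix_mult_nth sum_negf)

lemma matrix_sum_left: "(\<Sum>i\<in>I. A i) ** C = (\<Sum>i\<in>I. A i ** (C :: complex^'n^'m))"
  by (induction I rule: infinite_finite_induct) (auto simp: matrix_add_rdistrib')

lemma matrix_sum_right: "C ** (\<Sum>i\<in>I. A i) = (\<Sum>i\<in>I. C ** (A i :: complex^'n^'m))"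
  by (induction I rule: infinite_finite_induct) (auto simp: matrix_add_ldistrib)

lemma cscale_mult_left: "(c *\<^sub>m A) ** B = c *\<^sub>m (A ** B)"
  by (simp add: vec_eq_iff matrix_mult_nth sum_distrib_left mult.assoc)

lemma cscale_mult_right: "A ** (c *\<^sub>m B) = c *\<^sub>m (A ** B)"
  by (simp add: vec_eq_iff matrix_mult_nth sum_distrib_left algebra_simps)

lemma cscale_add_right: "c *\<^sub>m (A + B) = c *\<^sub>m A + c *\<^sub>m B"
  by (simp add: vec_eq_iff algebra_simps)

lemma cscale_diff_right: "c *\<^sub>m (A - B) = c *\<^sub>m A - c *\<^sub>m B"
  by (simp add: vec_eq_iff algebra_simps)

lemma cscale_uminus_right: "c *\<^sub>m (- A) = - (c *\<^sub>m A)"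
  by (simp add: vec_eq_iff)

lemma cscale_add_left: "(c + d) *\<^sub>m A = c *\<^sub>m A + d *\<^sub>m A"
  by (simp add: vec_eq_iff algebra_simps)

lemma cscale_diff_left: "(c - d) *\<^sub>m A = c *\<^sub>m A - d *\<^sub>m A"
  by (simp add: vec_eq_iff algebra_simps)

lemma cscale_uminus_left: "(- c) *\<^sub>m A = - (c *\<^sub>m A)"
  by (simp add: vec_eq_iff)

lemma cscale_cscale: "c *\<^sub>m d *\<^sub>m A = (c * d) *\<^sub>m A"
  by (simp add: vec_eq_iff)

lemma cscale_zero [simp]: "0 *\<^sub>m A = 0" "c *\<^sub>m 0 = 0"
  by (simp_all add: vec_eq_iff)

lemma cscale_sum_right: "c *\<^sub>m (\<Sum>i\<in>I. A i) = (\<Sum>i\<in>I. c *\<^sub>m A i)"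
  by (induction I rule: infinite_finite_induct) (auto simp: cscale_add_right)

lemma cscale_sum_left: "(\<Sum>i\<in>I. c i) *\<^sub>m A = (\<Sum>i\<in>I. c i *\<^sub>m A)"
  by (induction I rule: infinite_finite_induct) (auto simp: cscale_add_left)

lemma adj_mult: "adj (A ** B) = adj B ** adj A"
  by (simp add: vec_eq_iff matrix_mult_nth mult.commute)

lemma adj_adj [simp]: "adj (adj A) = A"
  by (simp add: vec_eq_iff)

lemma adj_add: "adj (A + B) = adj A + adj B"
  by (simp add: vec_eq_iff)

lemma adj_cscale: "adj (c *\<^sub>m A) = cnj c *\<^sub>m adj A"
  by (simp add: vec_eq_iff)

lemma adj_sum: "adj (\<Sum>i\<in>I. A i) = (\<Sum>i\<in>I. adj (A i))"
  by (induction I rule: infinite_finite_induct) (auto simp: adj_add vec_eq_iff)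

lemma adj_mat1 [simp]: "adj (mat 1) = mat 1"
  by (simp add: vec_eq_iff mat_def)

lemma trace_cscale: "trace (c *\<^sub>m A) = c * trace A"
  by (simp add: trace_def sum_distrib_left)

lemma trace_sum: "trace (\<Sum>i\<in>I. A i) = (\<Sum>i\<in>I. trace (A i :: complex^'n^'n))"
  by (simp add: trace_def) (rule sum.swap)

lemma trace_adj: "trace (adj A) = cnj (trace A)"
  by (simp add: trace_def)

lemmas matrix_algebra = matrix_mul_assoc matrix_add_ldistrib matrix_add_rdistrib'
  matrix_diff_ldistrib matrix_diff_rdistrib matrix_uminus_left matrix_uminus_right
  matrix_sum_left matrix_sum_right cscale_mult_left cscale_mult_right
  cscale_add_right cscale_diff_right cscale_uminus_right cscale_uminus_left cscale_cscale
  cscale_sum_right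

lemma matrix_inv_inverse:
  assumes "invertible (A :: complex^'n^'n)"
  shows "A ** ginv A = mat 1" "ginv A ** A = mat 1"
  using assms someI_ex[of "\<lambda>B. A ** B = mat 1 \<and> B ** A = mat 1"]
  unfolding invertible_def matrix_inv_def by blast+

lemma matrix_inv_eqI:
  assumes "A ** B = mat 1" "B ** A = mat (1::complex)"
  shows "ginv A = B"
proof -
  have "invertible A" using assms unfolding invertible_def by blast
  from matrix_inv_inverse[OF this] have "ginv A = ginv A ** (A ** B)" "ginv A ** A = mat 1"
    using assms by auto
  then show ?thesis by (simp add: matrix_mul_assoc)
qed

lemma adj_ginv:
  assumes "invertible A" "adj A = A"
  shows "adj (ginv A) = ginv A"
proof -
  have "A ** adj (ginv A) = mat 1" "adj (ginv A) ** A = mat 1"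
    using matrix_inv_inverse[OF assms(1)] assms(2)
    by (metis adj_mult adj_mat1)+
  then show ?thesis using matrix_inv_eqI by metis
qed

text \<open>Cramer's rule for the standard basis vectors. It presents the entries of the inverse as
  quotients of determinants, which is how smoothness passes from a matrix to its inverse.\<close>

lemma matrix_inv_cramer:
  assumes "invertible (A :: complex^'n^'n)"
  shows "ginv A $ r $ s =
    det (\<chi> i j. if j = r then (axis s 1 :: complex^'n) $ i else A $ i $ j) / det A"
proof -
  have "A *v (ginv A *v axis s 1) = axis s 1"
    using matrix_inv_inverse[OF assms] by (simp add: matrix_vector_mul_assoc)
  then have "ginv A *v axis s 1 =
      (\<chi> k. det (\<chi> i j. if j = k then (axis s 1 :: complex^'n) $ i else A $ i $ j) / det A)"
    using cramer[of A] assms invertible_det_nz by blast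
  moreover have "(ginv A *v axis s 1) $ r = ginv A $ r $ s"
    by (simp add: matrix_vector_mult_def axis_def if_distrib cong: if_cong)
  ultimately show ?thesis by simp
qed


section \<open>Wirtinger operators\<close>

text \<open>\<open>wd (v, w)\<close> is the operator $\frac12(D_v - i D_w)$. It comprises $\partial_a$,
  $\partial_{\bar a}$ and, as \<open>wd (2 v, 0)\<close>, the plain directional derivative \<open>D\<^sub>v\<close>.\<close>

definition wd ::
  "'e \<times> 'e \<Rightarrow> ('e::real_normed_vector \<Rightarrow> complex) \<Rightarrow> 'e \<Rightarrow> complex" where
  "wd \<xi> f x = (frechet_derivative f (at x) (fst \<xi>) - \<i> * frechet_derivative f (at x) (snd \<xi>)) / 2"

text \<open>Exchanges a holomorphic direction with its conjugate. A direction whose second component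
  is 0, such as time, is fixed and hence real.\<close>

definition bar :: "'e \<times> 'e \<Rightarrow> 'e \<times> 'e::real_normed_vector" where
  "bar \<xi> = (fst \<xi>, - snd \<xi>)"

lemma bar_bar [simp]: "bar (bar \<xi>) = \<xi>"
  by (simp add: bar_def)

definition Md :: "'e \<times> 'e \<Rightarrow> ('e::real_normed_vector \<Rightarrow> complex^'n^'m) \<Rightarrow> 'e \<Rightarrow> complex^'n^'m" where
  "Md \<xi> F x = (\<chi> r s. wd \<xi> (\<lambda>y. F y $ r $ s) x)"

lemma Md_nth [simp]: "Md \<xi> F x $ r $ s = wd \<xi> (\<lambda>y. F y $ r $ s) x"
  by (simp add: Md_def)

definition msmooth :: "'e::real_normed_vector set \<Rightarrow> ('e \<Rightarrow> complex^'n^'m) \<Rightarrow> bool" where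
  "msmooth W F \<longleftrightarrow> (\<forall>r s. smooth_on W (\<lambda>y. F y $ r $ s))"

lemma msmoothD: "msmooth W F \<Longrightarrow> smooth_on W (\<lambda>y. F y $ r $ s)"
  by (simp add: msmooth_def)

lemma smooth_on_imp_msmooth: "smooth_on W F \<Longrightarrow> msmooth W F"
  unfolding msmooth_def
  using smooth_on_bounded_linear[OF bounded_linear_compose[OF bounded_linear_vec_nth bounded_linear_vec_nth]]
  by blast

lemma msmooth_add: "msmooth W F \<Longrightarrow> msmooth W H \<Longrightarrow> msmooth W (\<lambda>y. F y + H y)"
  by (simp add: msmooth_def smooth_on_add)

lemma msmooth_diff: "msmooth W F \<Longrightarrow> msmooth W H \<Longrightarrow> msmooth W (\<lambda>y. F y - H y)"
  by (simp add: msmooth_def smooth_on_diff)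

lemma msmooth_sum: "(\<And>i. i \<in> I \<Longrightarrow> msmooth W (F i)) \<Longrightarrow> msmooth W (\<lambda>y. \<Sum>i\<in>I. F i y)"
  by (simp add: msmooth_def smooth_on_sum)

lemma msmooth_cscale: "smooth_on W f \<Longrightarrow> msmooth W F \<Longrightarrow> msmooth W (\<lambda>y. f y *\<^sub>m F y)"
  by (simp add: msmooth_def smooth_on_mult)

lemma msmooth_mult: "msmooth W F \<Longrightarrow> msmooth W H \<Longrightarrow> msmooth W (\<lambda>y. F y ** H y)"
  by (simp add: msmooth_def matrix_mult_nth smooth_on_sum smooth_on_mult)

lemma msmooth_adj: "msmooth W F \<Longrightarrow> msmooth W (\<lambda>y. adj (F y))"
  by (simp add: msmooth_def smooth_on_cnj)

lemma smooth_on_trace: "msmooth W F \<Longrightarrow> smooth_on W (\<lambda>y. trace (F y))"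
  by (simp add: msmooth_def trace_def smooth_on_sum)

lemma smooth_on_det: "msmooth W F \<Longrightarrow> smooth_on W (\<lambda>y. det (F y))"
  by (simp add: msmooth_def det_def smooth_on_sum smooth_on_mult smooth_on_prod)

lemma msmooth_ginv:
  fixes F :: "'e::real_normed_vector \<Rightarrow> complex^'n^'n"
  assumes "msmooth W F" "\<And>x. x \<in> W \<Longrightarrow> invertible (F x)"
  shows "msmooth W (\<lambda>y. ginv (F y))"
  unfolding msmooth_def
proof (intro allI)
  fix r s
  let ?N = "\<lambda>y. det (\<chi> i j. if j = r then (axis s 1 :: complex^'n) $ i else F y $ i $ j)"
  have "msmooth W (\<lambda>y. \<chi> i j. if j = r then (axis s 1 :: complex^'n) $ i else F y $ i $ j)"
    unfolding msmooth_def
  proof (intro allI)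
    fix i j
    show "smooth_on W (\<lambda>y. (\<chi> i j. if j = r then (axis s 1 :: complex^'n) $ i else F y $ i $ j) $ i $ j)"
      by (cases "j = r") (use assms(1) in \<open>auto simp: msmooth_def\<close>)
  qed
  then have "smooth_on W ?N" by (rule smooth_on_det)
  moreover have "smooth_on W (\<lambda>y. inverse (det (F y)))"
    using assms invertible_det_nz by (intro smooth_on_inverse smooth_on_det) auto
  ultimately have "smooth_on W (\<lambda>y. ?N y * inverse (det (F y)))"
    by (rule smooth_on_mult)
  moreover have "ginv (F y) $ r $ s = ?N y * inverse (det (F y))" if "y \<in> W" for y
    using matrix_inv_cramer[OF assms(2)[OF that]] by (simp only: divide_inverse)
  ultimately show "smooth_on W (\<lambda>y. ginv (F y) $ r $ s)"
    using smooth_on_cong[of W "\<lambda>y. ginv (F y) $ r $ s" "\<lambda>y. ?N y * inverse (det (F y))"]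
    by blast
qed

text \<open>On an open set Frechet derivatives are determined by the values in the set; this is what
  lets \<open>wd\<close> be computed after rewriting a function on \<open>W\<close> only.\<close>

locale open_dom =
  fixes W :: "'e::real_normed_vector set"
  assumes open_W: "open W"
begin

lemma smooth_on_wd: "smooth_on W f \<Longrightarrow> smooth_on W (wd \<xi> f)"
  unfolding wd_def
  by (intro smooth_on_divide smooth_on_diff smooth_on_mult smooth_on_const
      smooth_on_derivative open_W)

lemma wd_cong: "(\<And>y. y \<in> W \<Longrightarrow> f y = g y) \<Longrightarrow> x \<in> W \<Longrightarrow> wd \<xi> f x = wd \<xi> g x"
  using frechet_derivative_cong_open[OF open_W, of x f g] by (simp add: wd_def)

lemma has_derivativeD:
  "smooth_on W f \<Longrightarrow> x \<in> W \<Longrightarrow> (f has_derivative frechet_derivative f (at x)) (at x)"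
  using smooth_on_differentiable[OF open_W] frechet_derivative_works by blast

lemma wd_eqI:
  assumes "(f has_derivative f') (at x)"
  shows "wd \<xi> f x = (f' (fst \<xi>) - \<i> * f' (snd \<xi>)) / 2"
  unfolding wd_def using frechet_derivative_at[OF assms] by simp

lemma wd_const [simp]: "wd \<xi> (\<lambda>y. c) x = 0"
  by (simp add: wd_def)

lemma wd_add:
  assumes "smooth_on W f" "smooth_on W g" "x \<in> W"
  shows "wd \<xi> (\<lambda>y. f y + g y) x = wd \<xi> f x + wd \<xi> g x"
  by (subst wd_eqI[OF has_derivative_add[OF has_derivativeD[OF assms(1,3)] has_derivativeD[OF assms(2,3)]]])
    (simp add: wd_def field_simps)

lemma wd_diff:
  assumes "smooth_on W f" "smooth_on W g" "x \<in> W"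
  shows "wd \<xi> (\<lambda>y. f y - g y) x = wd \<xi> f x - wd \<xi> g x"
  by (subst wd_eqI[OF has_derivative_diff[OF has_derivativeD[OF assms(1,3)] has_derivativeD[OF assms(2,3)]]])
    (simp add: wd_def field_simps)

lemma wd_mult:
  assumes "smooth_on W f" "smooth_on W g" "x \<in> W"
  shows "wd \<xi> (\<lambda>y. f y * g y) x = wd \<xi> f x * g x + f x * wd \<xi> g x"
  by (subst wd_eqI[OF has_derivative_mult[OF has_derivativeD[OF assms(1,3)] has_derivativeD[OF assms(2,3)]]])
    (simp add: wd_def field_simps)

lemma wd_sum:
  assumes "\<And>i. i \<in> I \<Longrightarrow> smooth_on W (f i)" "x \<in> W"
  shows "wd \<xi> (\<lambda>y. \<Sum>i\<in>I. f i y) x = (\<Sum>i\<in>I. wd \<xi> (f i) x)"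
  using assms(1)
proof (induction I rule: infinite_finite_induct)
  case (insert a I)
  then show ?case using assms(2) by (simp add: wd_add smooth_on_sum)
qed auto

lemma wd_cnj:
  assumes "smooth_on W f" "x \<in> W"
  shows "wd \<xi> (\<lambda>y. cnj (f y)) x = cnj (wd (bar \<xi>) f x)"
proof -
  have "linear (frechet_derivative f (at x))"
    using has_derivativeD[OF assms] has_derivative_linear by blast
  then have "frechet_derivative f (at x) (- snd \<xi>) = - frechet_derivative f (at x) (snd \<xi>)"
    by (rule linear_neg)
  then show ?thesis
    by (subst wd_eqI[OF bounded_linear.has_derivative[OF bounded_linear_cnj has_derivativeD[OF assms]]])
      (simp add: wd_def bar_def)
qed

lemma wd_commute:
  assumes "smooth_on W f" "x \<in> W"
  shows "wd \<xi> (wd \<zeta> f) x = wd \<zeta> (wd \<xi> f) x"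
proof -
  have *: "wd \<xi> (wd \<zeta> f) x =
     (wd \<xi> (\<lambda>y. frechet_derivative f (at y) (fst \<zeta>)) x
      - \<i> * wd \<xi> (\<lambda>y. frechet_derivative f (at y) (snd \<zeta>)) x) / 2" for \<xi> \<zeta>
  proof -
    have s: "smooth_on W (\<lambda>y. frechet_derivative f (at y) v)" for v
      by (rule smooth_on_derivative[OF open_W assms(1)])
    have eq: "wd \<zeta> f = (\<lambda>y. (1/2) * (frechet_derivative f (at y) (fst \<zeta>)
        - \<i> * frechet_derivative f (at y) (snd \<zeta>)))"
      by (simp add: wd_def fun_eq_iff)
    show ?thesis unfolding eq
      by (subst wd_mult[OF smooth_on_const smooth_on_diff[OF s smooth_on_mult[OF smooth_on_const s]] assms(2)])
        (simp add: wd_mult wd_diff smooth_on_mult s assms(2))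
  qed
  have "frechet_derivative (\<lambda>y. frechet_derivative f (at y) v) (at x) w =
         frechet_derivative (\<lambda>y. frechet_derivative f (at y) w) (at x) v" for v w
    by (rule complex_derivatives_commute[OF open_W assms])
  then have "frechet_derivative (\<lambda>y. frechet_derivative f (at y) (fst \<zeta>)) (at x) w =
      frechet_derivative (\<lambda>y. frechet_derivative f (at y) w) (at x) (fst \<zeta>)"
    "frechet_derivative (\<lambda>y. frechet_derivative f (at y) (snd \<zeta>)) (at x) w =
      frechet_derivative (\<lambda>y. frechet_derivative f (at y) w) (at x) (snd \<zeta>)" for w
    by blast+
  then show ?thesis
    unfolding *[of \<xi> \<zeta>] *[of \<zeta> \<xi>] by (simp add: wd_def field_simps)
qed

lemma msmooth_Md: "msmooth W F \<Longrightarrow> msmooth W (Md \<xi> F)"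
  by (simp add: msmooth_def smooth_on_wd)

lemma Md_cong: "(\<And>y. y \<in> W \<Longrightarrow> F y = H y) \<Longrightarrow> x \<in> W \<Longrightarrow> Md \<xi> F x = Md \<xi> H x"
  by (simp add: vec_eq_iff) (blast intro: wd_cong)

lemma Md_const [simp]: "Md \<xi> (\<lambda>y. A) x = 0"
  by (simp add: vec_eq_iff)

lemma Md_add:
  "msmooth W F \<Longrightarrow> msmooth W H \<Longrightarrow> x \<in> W \<Longrightarrow> Md \<xi> (\<lambda>y. F y + H y) x = Md \<xi> F x + Md \<xi> H x"
  by (simp add: vec_eq_iff wd_add msmoothD)

lemma Md_diff:
  "msmooth W F \<Longrightarrow> msmooth W H \<Longrightarrow> x \<in> W \<Longrightarrow> Md \<xi> (\<lambda>y. F y - H y) x = Md \<xi> F x - Md \<xi> H x"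
  by (simp add: vec_eq_iff wd_diff msmoothD)

lemma Md_sum:
  "(\<And>i. i \<in> I \<Longrightarrow> msmooth W (F i)) \<Longrightarrow> x \<in> W \<Longrightarrow>
   Md \<xi> (\<lambda>y. \<Sum>i\<in>I. F i y) x = (\<Sum>i\<in>I. Md \<xi> (F i) x)"
  by (simp add: vec_eq_iff wd_sum msmoothD)

lemma Md_cscale:
  "smooth_on W f \<Longrightarrow> msmooth W F \<Longrightarrow> x \<in> W \<Longrightarrow>
   Md \<xi> (\<lambda>y. f y *\<^sub>m F y) x = wd \<xi> f x *\<^sub>m F x + f x *\<^sub>m Md \<xi> F x"
  by (simp add: vec_eq_iff wd_mult msmoothD)

lemma Md_mult:
  "msmooth W F \<Longrightarrow> msmooth W H \<Longrightarrow> x \<in> W \<Longrightarrow>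
   Md \<xi> (\<lambda>y. F y ** H y) x = Md \<xi> F x ** H x + F x ** Md \<xi> H x"
  by (simp add: vec_eq_iff matrix_mult_nth wd_sum wd_mult msmoothD smooth_on_mult sum.distrib)

lemma Md_adj:
  "msmooth W F \<Longrightarrow> x \<in> W \<Longrightarrow> Md \<xi> (\<lambda>y. adj (F y)) x = adj (Md (bar \<xi>) F x)"
  by (simp add: vec_eq_iff wd_cnj msmoothD)

lemma wd_trace: "msmooth W F \<Longrightarrow> x \<in> W \<Longrightarrow> wd \<xi> (\<lambda>y. trace (F y)) x = trace (Md \<xi> F x)"
  by (simp add: trace_def wd_sum msmoothD)

lemma Md_commute: "msmooth W F \<Longrightarrow> x \<in> W \<Longrightarrow> Md \<xi> (Md \<zeta> F) x = Md \<zeta> (Md \<xi> F) x"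
  by (simp add: vec_eq_iff wd_commute[of _ _ \<xi> \<zeta>] msmoothD)

lemma Md_ginv:
  assumes "msmooth W F" "\<And>y. y \<in> W \<Longrightarrow> invertible (F y)" "x \<in> W"
  shows "Md \<xi> (\<lambda>y. ginv (F y)) x = - (ginv (F x) ** Md \<xi> F x ** ginv (F x))"
proof -
  note inv = matrix_inv_inverse[OF assms(2)]
  have s: "msmooth W (\<lambda>y. ginv (F y))" by (rule msmooth_ginv[OF assms(1,2)])
  have "0 = Md \<xi> (\<lambda>y. ginv (F y) ** F y) x"
    using Md_cong[of "\<lambda>y. ginv (F y) ** F y" "\<lambda>y. mat 1" x \<xi>] inv assms(3) by simp
  also have "\<dots> = Md \<xi> (\<lambda>y. ginv (F y)) x ** F x + ginv (F x) ** Md \<xi> F x"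
    by (rule Md_mult[OF s assms(1,3)])
  finally have "Md \<xi> (\<lambda>y. ginv (F y)) x ** F x = - (ginv (F x) ** Md \<xi> F x)"
    by (simp add: eq_neg_iff_add_eq_0)
  then have "Md \<xi> (\<lambda>y. ginv (F y)) x ** (F x ** ginv (F x)) = - (ginv (F x) ** Md \<xi> F x ** ginv (F x))"
    by (simp add: matrix_mul_assoc matrix_uminus_left)
  then show ?thesis using inv(1)[OF assms(3)] by simp
qed

end
section \<open>Evolution equations\<close>

text \<open>A tensor $X_{ij}^k$ is a family of matrices with \<open>X i $ j $ k\<close> $= X_{ij}^k$; \<open>ip H\<close> is
  \<open>inner_21 H\<close> in this notation.\<close>

definition ip :: "complex^'n^'n::finite \<Rightarrow> ('n \<Rightarrow> complex^'n^'n) \<Rightarrow> ('n \<Rightarrow> complex^'n^'n) \<Rightarrow> complex" where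
  "ip H X Y = (\<Sum>i\<in>UNIV. \<Sum>m\<in>UNIV. ginv H $ m $ i * trace (X i ** H ** adj (Y m) ** ginv H))"

text \<open>The derivation of the tensor algebra induced by the endomorphism with matrix \<open>\<eta>\<close>. With
  \<open>\<eta>\<close> the connection matrix it is the correction term of the covariant derivative, with \<open>\<eta>\<close>
  the curvature it is the commutator of covariant derivatives.\<close>

definition act :: "complex^'n^'n::finite \<Rightarrow> ('n \<Rightarrow> complex^'n^'n) \<Rightarrow> 'n \<Rightarrow> complex^'n^'n" where
  "act \<eta> X i = X i ** \<eta> - \<eta> ** X i - (\<Sum>p\<in>UNIV. \<eta> $ i $ p *\<^sub>m X p)"

lemma ip_add_left: "ip H (\<lambda>i. X i + Y i) Z = ip H X Z + ip H Y Z"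
  by (simp add: ip_def matrix_algebra trace_add algebra_simps sum.distrib)

lemma ip_cscale_left: "ip H (\<lambda>i. c *\<^sub>m X i) Z = c * ip H X Z"
  by (simp add: ip_def matrix_algebra trace_cscale sum_distrib_left algebra_simps)

lemma ip_zero_left: "ip H (\<lambda>i. 0) Z = 0"
  using ip_cscale_left[of H 0 "\<lambda>i. 0" Z] by simp

lemma ip_sum_left: "ip H (\<lambda>i. \<Sum>k\<in>I. X k i) Z = (\<Sum>k\<in>I. ip H (X k) Z)"
  by (induction I rule: infinite_finite_induct) (auto simp: ip_add_left ip_zero_left)

lemma cnj_ip:
  assumes "invertible H" "adj H = H"
  shows "cnj (ip H X Y) = ip H Y X"
proof -
  have k: "cnj (ginv H $ m $ i) = ginv H $ i $ m" for m i
    using adj_ginv[OF assms] by (metis adj_nth)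
  have t: "cnj (trace (X i ** H ** adj (Y m) ** ginv H)) = trace (Y m ** H ** adj (X i) ** ginv H)"
    for i m
  proof -
    have "cnj (trace (X i ** H ** adj (Y m) ** ginv H))
        = trace (adj (X i ** H ** adj (Y m) ** ginv H))"
      by (simp add: trace_adj)
    also have "\<dots> = trace (ginv H ** (Y m ** H ** adj (X i)))"
      using assms(2) by (simp add: adj_mult adj_ginv[OF assms] matrix_mul_assoc)
    also have "\<dots> = trace (Y m ** H ** adj (X i) ** ginv H)"
      by (rule trace_mul_sym)
    finally show ?thesis .
  qed
  show ?thesis
    unfolding ip_def by (simp add: k t) (rule sum.swap)
qed

lemma act_add_left: "act (\<eta> + \<zeta>) X i = act \<eta> X i + act \<zeta> X i"
  by (simp add: act_def matrix_algebra cscale_add_left sum.distrib)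

lemma act_cscale_left: "act (c *\<^sub>m \<eta>) X i = c *\<^sub>m act \<eta> X i"
  by (simp add: act_def matrix_algebra)

lemma act_zero_left: "act 0 X i = 0"
  using act_cscale_left[of 0 0 X i] by simp

lemma act_sum_left: "act (\<Sum>k\<in>I. \<eta> k) X i = (\<Sum>k\<in>I. act (\<eta> k) X i)"
  by (induction I rule: infinite_finite_induct) (auto simp: act_add_left act_zero_left)

lemma act_diff_right: "act \<eta> (\<lambda>i. X i - Y i) i = act \<eta> X i - act \<eta> Y i"
  by (simp add: act_def matrix_algebra sum_subtractf)

lemma msmooth_act:
  assumes "msmooth W \<eta>" "\<And>i. msmooth W (X i)"
  shows "msmooth W (\<lambda>y. act (\<eta> y) (\<lambda>i. X i y) i)"
  unfolding act_def using assms
  by (intro msmooth_diff msmooth_mult msmooth_sum msmooth_cscale) (auto intro: msmoothD)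

lemma (in open_dom) Md_act:
  assumes "msmooth W \<eta>" "\<And>i. msmooth W (X i)" "x \<in> W"
  shows "Md \<xi> (\<lambda>y. act (\<eta> y) (\<lambda>i. X i y) i) x =
    act (Md \<xi> \<eta> x) (\<lambda>i. X i x) i + act (\<eta> x) (\<lambda>i. Md \<xi> (X i) x) i"
proof -
  note s = assms(1,2) msmooth_mult[OF assms(1,2)] msmooth_mult[OF assms(2,1)] msmoothD[OF assms(1)]
    msmooth_cscale msmooth_sum msmooth_diff
  show ?thesis
    unfolding act_def
    by (simp add: Md_diff Md_mult Md_sum Md_cscale s assms(3) sum.distrib)
qed

locale herm_field = open_dom W for W :: "'e::real_normed_vector set" +
  fixes G :: "'e \<Rightarrow> complex^'n^'n::finite"
  assumes smooth_G: "msmooth W G"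
    and inv_G: "y \<in> W \<Longrightarrow> invertible (G y)"
    and herm_G: "y \<in> W \<Longrightarrow> adj (G y) = G y"
begin

lemma smooth_ginv: "msmooth W (\<lambda>y. ginv (G y))"
  by (rule msmooth_ginv[OF smooth_G inv_G])

lemma smooth_ip:
  assumes "\<And>i. msmooth W (X i)" "\<And>i. msmooth W (Y i)"
  shows "smooth_on W (\<lambda>y. ip (G y) (\<lambda>i. X i y) (\<lambda>i. Y i y))"
  unfolding ip_def using assms smooth_G smooth_ginv
  by (intro smooth_on_sum smooth_on_mult smooth_on_trace msmooth_mult msmooth_adj msmoothD)

lemma G_ginv [simp]: "y \<in> W \<Longrightarrow> G y ** ginv (G y) = mat 1" "y \<in> W \<Longrightarrow> ginv (G y) ** G y = mat 1"
  using matrix_inv_inverse[OF inv_G] by blast+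

lemma G_ginv_assoc [simp]:
  "y \<in> W \<Longrightarrow> A ** G y ** ginv (G y) = A" "y \<in> W \<Longrightarrow> A ** ginv (G y) ** G y = A"
  by (simp_all flip: matrix_mul_assoc)

lemma Md_ginv_G:
  "x \<in> W \<Longrightarrow> Md \<xi> (\<lambda>y. ginv (G y)) x = - (ginv (G x) ** Md \<xi> G x ** ginv (G x))"
  by (rule Md_ginv[OF smooth_G inv_G])

text \<open>Metric compatibility in matrix form: differentiating the metric factors inside
  \<open>ip\<close> yields exactly the three terms of \<open>act\<close> on the first argument,
  while the second argument receives the conjugate operator. The direction is arbitrary, so the same
  formula serves for space and for time.\<close>

lemma wd_ip:
  assumes X: "\<And>i. msmooth W (X i)" and Y: "\<And>i. msmooth W (Y i)" and x: "x \<in> W"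
  shows "wd \<xi> (\<lambda>y. ip (G y) (\<lambda>i. X i y) (\<lambda>i. Y i y)) x =
    ip (G x) (\<lambda>i. Md \<xi> (X i) x + act (Md \<xi> G x ** ginv (G x)) (\<lambda>i. X i x) i) (\<lambda>i. Y i x) +
    ip (G x) (\<lambda>i. X i x) (\<lambda>i. Md (bar \<xi>) (Y i) x)"
proof -
  define \<eta> where "\<eta> = Md \<xi> G x ** ginv (G x)"
  define k where "k = ginv (G x)"
  define T where "T = (\<lambda>i m. trace (X i x ** G x ** adj (Y m x) ** k))"
  have dG: "Md \<xi> G x = \<eta> ** G x" using x by (simp add: \<eta>_def)
  have dI: "Md \<xi> (\<lambda>y. ginv (G y)) x = - (k ** \<eta>)"
    using Md_ginv_G[OF x] by (simp add: \<eta>_def k_def matrix_mul_assoc)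
  have dk: "wd \<xi> (\<lambda>y. ginv (G y) $ m $ i) x = - (\<Sum>p\<in>UNIV. k $ m $ p * \<eta> $ p $ i)" for m i
  proof -
    have "wd \<xi> (\<lambda>y. ginv (G y) $ m $ i) x = Md \<xi> (\<lambda>y. ginv (G y)) x $ m $ i" by simp
    then show ?thesis unfolding dI by (simp add: matrix_mult_nth)
  qed
  note s = X Y smooth_G smooth_ginv
  have dT: "wd \<xi> (\<lambda>y. trace (X i y ** G y ** adj (Y m y) ** ginv (G y))) x =
      trace (Md \<xi> (X i) x ** G x ** adj (Y m x) ** k) + trace (X i x ** \<eta> ** G x ** adj (Y m x) ** k)
      + trace (X i x ** G x ** adj (Md (bar \<xi>) (Y m) x) ** k)
      - trace (\<eta> ** X i x ** G x ** adj (Y m x) ** k)" for i m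
  proof -
    have c: "trace (X i x ** G x ** adj (Y m x) ** k ** \<eta>)
        = trace (\<eta> ** X i x ** G x ** adj (Y m x) ** k)"
      by (subst trace_mul_sym) (simp add: matrix_mul_assoc)
    show ?thesis
      by (simp add: wd_trace Md_mult Md_adj msmooth_mult msmooth_adj s x dG dI matrix_algebra
          trace_add trace_sub c flip: k_def)
  qed
  have dip: "wd \<xi> (\<lambda>y. ip (G y) (\<lambda>i. X i y) (\<lambda>i. Y i y)) x =
     (\<Sum>i\<in>UNIV. \<Sum>m\<in>UNIV. wd \<xi> (\<lambda>y. ginv (G y) $ m $ i) x * T i m +
        k $ m $ i * wd \<xi> (\<lambda>y. trace (X i y ** G y ** adj (Y m y) ** ginv (G y))) x)"
    unfolding ip_def T_def k_def
    by (simp add: wd_sum wd_mult smooth_on_sum smooth_on_mult smooth_on_trace msmooth_mult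
        msmooth_adj s msmoothD x)
  \<comment> \<open>The derivative of the inverse metric that contracts the first lower index
    becomes the last term of \<open>act\<close>.\<close>
  have swap: "(\<Sum>i\<in>UNIV. \<Sum>m\<in>UNIV. (\<Sum>p\<in>UNIV. k $ m $ p * \<eta> $ p $ i) * T i m) =
      (\<Sum>i\<in>UNIV. \<Sum>m\<in>UNIV. k $ m $ i * (\<Sum>p\<in>UNIV. \<eta> $ i $ p * T p m))"
  proof -
    have "(\<Sum>i\<in>UNIV. \<Sum>m\<in>UNIV. (\<Sum>p\<in>UNIV. k $ m $ p * \<eta> $ p $ i) * T i m) =
        (\<Sum>m\<in>UNIV. \<Sum>i\<in>UNIV. \<Sum>p\<in>UNIV. k $ m $ p * \<eta> $ p $ i * T i m)"
      by (subst sum.swap) (simp add: sum_distrib_right)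
    also have "\<dots> = (\<Sum>m\<in>UNIV. \<Sum>p\<in>UNIV. \<Sum>i\<in>UNIV. k $ m $ p * \<eta> $ p $ i * T i m)"
      by (intro sum.cong refl sum.swap)
    also have "\<dots> = (\<Sum>p\<in>UNIV. \<Sum>m\<in>UNIV. k $ m $ p * (\<Sum>i\<in>UNIV. \<eta> $ p $ i * T i m))"
      by (subst sum.swap) (simp add: sum_distrib_left mult.assoc)
    finally show ?thesis .
  qed
  have rhs: "ip (G x) (\<lambda>i. Md \<xi> (X i) x + act \<eta> (\<lambda>i. X i x) i) (\<lambda>i. Y i x) +
    ip (G x) (\<lambda>i. X i x) (\<lambda>i. Md (bar \<xi>) (Y i) x) =
    (\<Sum>i\<in>UNIV. \<Sum>m\<in>UNIV. k $ m $ i *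
      (trace (Md \<xi> (X i) x ** G x ** adj (Y m x) ** k) + trace (X i x ** \<eta> ** G x ** adj (Y m x) ** k)
      + trace (X i x ** G x ** adj (Md (bar \<xi>) (Y m) x) ** k)
      - trace (\<eta> ** X i x ** G x ** adj (Y m x) ** k)) -
      k $ m $ i * (\<Sum>p\<in>UNIV. \<eta> $ i $ p * T p m))"
    unfolding ip_def act_def T_def k_def
    by (simp add: matrix_algebra trace_add trace_sub trace_cscale trace_sum sum.distrib[symmetric]
        algebra_simps)
  show ?thesis
    unfolding \<eta>_def[symmetric] rhs dip dk dT
    by (simp add: sum.distrib sum_subtractf sum_negf swap)
qed

text \<open>Conjugate of \<open>wd_ip\<close> through the Hermitian symmetry of \<open>ip\<close>:
  in a conjugate direction the correction moves to the second argument.\<close>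

lemma wd_bar_ip:
  assumes X: "\<And>i. msmooth W (X i)" and Y: "\<And>i. msmooth W (Y i)" and x: "x \<in> W"
  shows "wd (bar \<xi>) (\<lambda>y. ip (G y) (\<lambda>i. X i y) (\<lambda>i. Y i y)) x =
    ip (G x) (\<lambda>i. Md (bar \<xi>) (X i) x) (\<lambda>i. Y i x) +
    ip (G x) (\<lambda>i. X i x) (\<lambda>i. Md \<xi> (Y i) x + act (Md \<xi> G x ** ginv (G x)) (\<lambda>i. Y i x) i)"
proof -
  have "wd (bar \<xi>) (\<lambda>y. ip (G y) (\<lambda>i. X i y) (\<lambda>i. Y i y)) x
      = wd (bar \<xi>) (\<lambda>y. cnj (ip (G y) (\<lambda>i. Y i y) (\<lambda>i. X i y))) x"
    by (rule wd_cong[OF _ x]) (simp add: cnj_ip inv_G herm_G)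
  also have "\<dots> = cnj (wd \<xi> (\<lambda>y. ip (G y) (\<lambda>i. Y i y) (\<lambda>i. X i y)) x)"
    by (subst wd_cnj[OF smooth_ip[OF Y X] x]) simp
  finally show ?thesis
    by (simp add: wd_ip[OF Y X x] cnj_ip inv_G herm_G x)
qed

end

text \<open>The directions stay abstract: what the identities exploit is that all operators
  \<open>wd\<close> commute, that time is a real direction, and that \<open>Gh\<close> does not
  change with time.\<close>

locale evolving_metric = herm_field W G + hat: herm_field W Gh
  for W :: "'e::real_normed_vector set" and G Gh :: "'e \<Rightarrow> complex^'n^'n::finite" +
  fixes d :: "'n \<Rightarrow> 'e \<times> 'e" and \<tau> :: "'e \<times> 'e"
  assumes bar_\<tau>: "bar \<tau> = \<tau>"
    and stationary: "y \<in> W \<Longrightarrow> Md \<tau> Gh y = 0"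
begin

definition conn :: "('e \<Rightarrow> complex^'n^'n) \<Rightarrow> 'n \<Rightarrow> 'e \<Rightarrow> complex^'n^'n" where
  "conn H a y = Md (d a) H y ** ginv (H y)"

text \<open>The conjugate derivative of the connection matrix. It is minus the Chern curvature with
  its last index raised, which explains the sign in \<open>Ric_eq\<close>.\<close>

definition curv :: "('e \<Rightarrow> complex^'n^'n) \<Rightarrow> 'n \<Rightarrow> 'n \<Rightarrow> 'e \<Rightarrow> complex^'n^'n" where
  "curv H b a = Md (bar (d b)) (conn H a)"

definition \<Psi> :: "'n \<Rightarrow> 'e \<Rightarrow> complex^'n^'n" where
  "\<Psi> a y = conn G a y - conn Gh a y"

text \<open>Always taken with the connection of \<open>G\<close>, also for \<open>curv Gh\<close>. A
  conjugate index carried as a parameter, like b in \<open>curv G b\<close>, needs no correction in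
  a (1,0) direction.\<close>

definition nab :: "'n \<Rightarrow> ('n \<Rightarrow> 'e \<Rightarrow> complex^'n^'n) \<Rightarrow> 'n \<Rightarrow> 'e \<Rightarrow> complex^'n^'n" where
  "nab a X i y = Md (d a) (X i) y + act (conn G a y) (\<lambda>i. X i y) i"

definition tr_g :: "('n \<Rightarrow> 'n \<Rightarrow> complex^'n^'n) \<Rightarrow> 'e \<Rightarrow> complex^'n^'n" where
  "tr_g A y = (\<Sum>a\<in>UNIV. \<Sum>b\<in>UNIV. ginv (G y) $ b $ a *\<^sub>m A b a)"

text \<open>Expressed by derivatives of \<open>G\<close> so as to match
  \<open>second_chern_ricci\<close> entry by entry; \<open>Ric_eq\<close> gives the form in terms of
  \<open>curv\<close>.\<close>

definition Ric :: "'e \<Rightarrow> complex^'n^'n" where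
  "Ric y = tr_g (\<lambda>b a. Md (d a) G y ** ginv (G y) ** Md (bar (d b)) G y
     - Md (bar (d b)) (Md (d a) G) y) y"

definition E :: "'e \<Rightarrow> complex^'n^'n" where
  "E y = Md \<tau> G y + Ric y"

definition lap :: "('e \<Rightarrow> complex) \<Rightarrow> 'e \<Rightarrow> complex" where
  "lap f y = (\<Sum>a\<in>UNIV. \<Sum>b\<in>UNIV. ginv (G y) $ b $ a * wd (bar (d b)) (wd (d a) f) y)"

text \<open>What is left of the time derivative of Psi after its Laplacian is removed: the covariant
  derivative of \<open>E\<close>, torsion times curvature from the Bianchi identity, and the fixed
  curvature differentiated with the moving connection.\<close>

definition Z :: "'n \<Rightarrow> 'e \<Rightarrow> complex^'n^'n" where
  "Z i y = (Md (d i) E y - conn G i y ** E y) ** ginv (G y) +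
     tr_g (\<lambda>b a. (\<Sum>p\<in>UNIV. (conn G a y $ i $ p - conn G i y $ a $ p) *\<^sub>m curv G b p y)
        + nab a (curv Gh b) i y) y"

definition S :: "'e \<Rightarrow> complex" where
  "S y = ip (G y) (\<lambda>i. \<Psi> i y) (\<lambda>i. \<Psi> i y)"

definition u :: "'e \<Rightarrow> complex" where
  "u y = trace (G y ** ginv (Gh y))"

lemma smooth_conn: "msmooth W (conn G a)" "msmooth W (conn Gh a)"
  unfolding conn_def
  by (intro msmooth_mult msmooth_Md smooth_G smooth_ginv hat.smooth_G hat.smooth_ginv)+

lemma smooth_curv: "msmooth W (curv G b a)" "msmooth W (curv Gh b a)"
  unfolding curv_def by (intro msmooth_Md smooth_conn)+

lemma smooth_\<Psi>: "msmooth W (\<Psi> a)"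
  unfolding \<Psi>_def by (intro msmooth_diff smooth_conn)

lemma smooth_tr_g:
  "(\<And>b a. msmooth W (A b a)) \<Longrightarrow> msmooth W (\<lambda>y. tr_g (\<lambda>b a. A b a y) y)"
  unfolding tr_g_def by (intro msmooth_sum msmooth_cscale msmoothD smooth_ginv)

lemma smooth_Ric: "msmooth W Ric"
  unfolding Ric_def
  by (intro smooth_tr_g msmooth_diff msmooth_mult msmooth_Md smooth_G smooth_ginv)

lemma smooth_E: "msmooth W E"
  unfolding E_def by (intro msmooth_add msmooth_Md smooth_G smooth_Ric)

lemma smooth_nab: "(\<And>i. msmooth W (X i)) \<Longrightarrow> msmooth W (nab a X i)"
  unfolding nab_def by (intro msmooth_add msmooth_Md msmooth_act smooth_conn)

lemma smooth_S: "smooth_on W S"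
  unfolding S_def by (intro smooth_ip smooth_\<Psi>)

lemma smooth_u: "smooth_on W u"
  unfolding u_def by (intro smooth_on_trace msmooth_mult smooth_G hat.smooth_ginv)

lemma tr_g_add: "tr_g (\<lambda>b a. A b a + B b a) y = tr_g A y + tr_g B y"
  by (simp add: tr_g_def cscale_add_right sum.distrib)

lemma tr_g_diff: "tr_g (\<lambda>b a. A b a - B b a) y = tr_g A y - tr_g B y"
  by (simp add: tr_g_def cscale_diff_right sum_subtractf)

lemma tr_g_uminus: "tr_g (\<lambda>b a. - A b a) y = - tr_g A y"
  by (simp add: tr_g_def cscale_uminus_right sum_negf)

lemma tr_g_mult_right: "tr_g (\<lambda>b a. A b a ** B) y = tr_g A y ** B"
  by (simp add: tr_g_def matrix_algebra)

lemma tr_g_mult_left: "tr_g (\<lambda>b a. B ** A b a) y = B ** tr_g A y"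
  by (simp add: tr_g_def matrix_algebra)

section \<open>Commutation and Bianchi identities\<close>

lemma Md_G: "x \<in> W \<Longrightarrow> Md (d a) G x = conn G a x ** G x"
  by (simp add: conn_def)

lemma Md_bar_G: "x \<in> W \<Longrightarrow> Md (bar (d a)) G x = G x ** adj (conn G a x)"
proof -
  assume x: "x \<in> W"
  have "Md (bar (d a)) G x = Md (bar (d a)) (\<lambda>y. adj (G y)) x"
    by (rule Md_cong[OF _ x]) (simp add: herm_G)
  also have "\<dots> = adj (Md (d a) G x)" by (simp add: Md_adj smooth_G x)
  also have "\<dots> = G x ** adj (conn G a x)" using x by (simp add: Md_G adj_mult herm_G)
  finally show ?thesis .
qed

text \<open>A conjugate derivative carries no correction on unbarred indices, so commuting it past
  \<open>nab\<close> merely differentiates the connection matrix, and that derivative is the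
  curvature.\<close>

lemma Md_bar_nab:
  assumes "\<And>i. msmooth W (X i)" "x \<in> W"
  shows "Md (bar (d b)) (nab a X i) x =
    nab a (\<lambda>i. Md (bar (d b)) (X i)) i x + act (curv G b a x) (\<lambda>i. X i x) i"
  unfolding nab_def[of a X i] curv_def
  by (simp add: Md_add Md_act msmooth_Md msmooth_act smooth_conn assms
      Md_commute[of _ _ "bar (d b)"] nab_def)

text \<open>The curvature of the Chern connection has no (2,0) part: second derivatives of
  \<open>G\<close> are symmetric in the two directions, and only products of first derivatives
  survive.\<close>

lemma conn_curl:
  assumes x: "x \<in> W"
  shows "Md (d a) (conn G i) x - Md (d i) (conn G a) x
    = conn G a x ** conn G i x - conn G i x ** conn G a x"
proof -
  have "Md (d a) (conn G i) x = Md (d a) (Md (d i) G) x ** ginv (G x) - conn G i x ** conn G a x" for a i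
    unfolding conn_def
    by (simp add: Md_mult Md_ginv_G msmooth_Md smooth_G smooth_ginv x matrix_algebra)
  then show ?thesis
    using Md_commute[OF smooth_G x, of "d a" "d i"] by simp
qed

text \<open>A conjugate derivative of \<open>conn_curl\<close>. The commutator terms agree on both
  sides; the corrections for the lower indices i and a do not, and their difference is the
  torsion.\<close>

lemma bianchi:
  assumes x: "x \<in> W"
  shows "nab a (curv G b) i x = nab i (curv G b) a x
    - (\<Sum>p\<in>UNIV. (conn G a x $ i $ p - conn G i x $ a $ p) *\<^sub>m curv G b p x)"
proof -
  note s = smooth_conn smooth_curv msmooth_Md msmooth_mult
  have "Md (bar (d b)) (\<lambda>y. Md (d a) (conn G i) y - Md (d i) (conn G a) y) x
     = Md (bar (d b)) (\<lambda>y. conn G a y ** conn G i y - conn G i y ** conn G a y) x"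
    by (rule Md_cong[OF conn_curl x])
  then have "Md (d a) (curv G b i) x - Md (d i) (curv G b a) x
    = curv G b a x ** conn G i x + conn G a x ** curv G b i x
      - (curv G b i x ** conn G a x + conn G i x ** curv G b a x)"
    unfolding curv_def
    by (simp add: Md_diff Md_mult s x Md_commute[of _ _ "bar (d b)"])
  then show ?thesis
    unfolding nab_def act_def
    by (simp add: cscale_diff_left sum_subtractf algebra_simps)
qed

lemma Ric_eq:
  assumes x: "x \<in> W"
  shows "tr_g (\<lambda>b a. curv G b a x) x = - (Ric x ** ginv (G x))"
proof -
  have "curv G b a x = - ((Md (d a) G x ** ginv (G x) ** Md (bar (d b)) G x
     - Md (bar (d b)) (Md (d a) G) x) ** ginv (G x))" for a b
    unfolding curv_def conn_def
    by (simp add: Md_mult Md_ginv_G msmooth_Md smooth_G smooth_ginv x matrix_algebra)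
  then show ?thesis unfolding Ric_def
    by (simp add: tr_g_uminus tr_g_mult_right)
qed

text \<open>The metric is parallel: the derivative of \<open>ginv G\<close> cancels against the
  correction for the lower index a, and what remains is the covariant derivative of an
  endomorphism.\<close>

lemma tr_nab_curv:
  assumes x: "x \<in> W"
  shows "tr_g (\<lambda>b a. nab i (curv G b) a x) x =
    Md (d i) (\<lambda>y. tr_g (\<lambda>b a. curv G b a y) y) x
    + tr_g (\<lambda>b a. curv G b a x) x ** conn G i x - conn G i x ** tr_g (\<lambda>b a. curv G b a x) x"
proof -
  have dI: "Md (d i) (\<lambda>y. ginv (G y)) x = - (ginv (G x) ** conn G i x)"
    using Md_ginv_G[OF x] by (simp add: conn_def matrix_mul_assoc)
  have dk: "wd (d i) (\<lambda>y. ginv (G y) $ b $ a) x = - (\<Sum>p\<in>UNIV. ginv (G x) $ b $ p * conn G i x $ p $ a)"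
    for b a
  proof -
    have "wd (d i) (\<lambda>y. ginv (G y) $ b $ a) x = Md (d i) (\<lambda>y. ginv (G y)) x $ b $ a" by simp
    then show ?thesis unfolding dI by (simp add: matrix_mult_nth)
  qed
  have 1: "Md (d i) (\<lambda>y. tr_g (\<lambda>b a. curv G b a y) y) x =
     (\<Sum>a\<in>UNIV. \<Sum>b\<in>UNIV. wd (d i) (\<lambda>y. ginv (G y) $ b $ a) x *\<^sub>m curv G b a x)
     + tr_g (\<lambda>b a. Md (d i) (curv G b a) x) x"
    unfolding tr_g_def
    by (simp add: Md_sum Md_cscale msmooth_sum msmooth_cscale msmoothD smooth_ginv smooth_curv x
        sum.distrib)
  have "(\<Sum>a\<in>UNIV. \<Sum>b\<in>UNIV. wd (d i) (\<lambda>y. ginv (G y) $ b $ a) x *\<^sub>m curv G b a x)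
    = - (\<Sum>a\<in>UNIV. \<Sum>b\<in>UNIV. \<Sum>p\<in>UNIV. (ginv (G x) $ b $ p * conn G i x $ p $ a) *\<^sub>m curv G b a x)"
    by (simp add: dk cscale_uminus_left cscale_sum_left sum_negf)
  also have "\<dots> = - (\<Sum>b\<in>UNIV. \<Sum>a\<in>UNIV. \<Sum>p\<in>UNIV. (ginv (G x) $ b $ p * conn G i x $ p $ a) *\<^sub>m curv G b a x)"
    by (subst sum.swap) simp
  also have "\<dots> = - (\<Sum>b\<in>UNIV. \<Sum>p\<in>UNIV. \<Sum>a\<in>UNIV. (ginv (G x) $ b $ p * conn G i x $ p $ a) *\<^sub>m curv G b a x)"
    by (subst sum.swap) simp
  also have "\<dots> = - (\<Sum>p\<in>UNIV. \<Sum>b\<in>UNIV. \<Sum>a\<in>UNIV. (ginv (G x) $ b $ p * conn G i x $ p $ a) *\<^sub>m curv G b a x)"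
    by (subst sum.swap) simp
  also have "\<dots> = - tr_g (\<lambda>b a. \<Sum>p\<in>UNIV. conn G i x $ a $ p *\<^sub>m curv G b p x) x"
    by (simp add: tr_g_def cscale_sum_right cscale_cscale)
  finally have 2: "(\<Sum>a\<in>UNIV. \<Sum>b\<in>UNIV. wd (d i) (\<lambda>y. ginv (G y) $ b $ a) x *\<^sub>m curv G b a x)
    = - tr_g (\<lambda>b a. \<Sum>p\<in>UNIV. conn G i x $ a $ p *\<^sub>m curv G b p x) x" .
  show ?thesis unfolding 1 2 nab_def act_def
    by (simp add: tr_g_add tr_g_diff tr_g_mult_left tr_g_mult_right)
qed

section \<open>Evolution of Psi, S and u\<close>

lemma Md_\<tau>_conn_hat:
  assumes x: "x \<in> W"
  shows "Md \<tau> (conn Gh i) x = 0"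
proof -
  have "Md \<tau> (Md (d i) Gh) x = Md (d i) (Md \<tau> Gh) x"
    by (rule Md_commute[OF hat.smooth_G x])
  also have "\<dots> = Md (d i) (\<lambda>y. 0) x"
    by (rule Md_cong[OF stationary x])
  finally have "Md \<tau> (Md (d i) Gh) x = 0" by simp
  then show ?thesis
    unfolding conn_def
    by (simp add: Md_mult msmooth_Md hat.smooth_G hat.smooth_ginv x hat.Md_ginv_G stationary
        matrix_algebra)
qed

text \<open>A connection matrix varies by the covariant derivative of (d/dt G) G^{-1}. Writing d/dt
  G as \<open>E\<close> minus \<open>Ric\<close> isolates \<open>E\<close>, whose derivative the
  hypotheses control, and leaves the derivative of the traced curvature.\<close>

lemma Md_\<tau>_\<Psi>:
  assumes x: "x \<in> W"
  shows "Md \<tau> (\<Psi> i) x = (Md (d i) E x - conn G i x ** E x) ** ginv (G x)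
    + tr_g (\<lambda>b a. nab i (curv G b) a x) x"
proof -
  define \<rho> where "\<rho> = (\<lambda>y. tr_g (\<lambda>b a. curv G b a y) y)"
  have s\<rho>: "msmooth W \<rho>" unfolding \<rho>_def by (intro smooth_tr_g smooth_curv)
  have G\<tau>: "Md \<tau> G y = E y + \<rho> y ** G y" if "y \<in> W" for y
    using that by (simp add: E_def \<rho>_def Ric_eq matrix_uminus_left)
  have "Md (d i) (Md \<tau> G) x = Md (d i) (\<lambda>y. E y + \<rho> y ** G y) x" "Md \<tau> G x = E x + \<rho> x ** G x"
    using Md_cong[OF G\<tau> x] G\<tau>[OF x] by simp_all
  then have 1: "Md (d i) (Md \<tau> G) x = Md (d i) E x + Md (d i) \<rho> x ** G x + \<rho> x ** conn G i x ** G x"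
    "Md \<tau> G x = E x + \<rho> x ** G x"
    by (simp_all add: Md_add Md_mult msmooth_mult smooth_E s\<rho> smooth_G x Md_G matrix_mul_assoc)
  have "Md \<tau> (\<Psi> i) x = Md \<tau> (conn G i) x"
    unfolding \<Psi>_def by (simp add: Md_diff smooth_conn x Md_\<tau>_conn_hat)
  also have "\<dots> = (Md (d i) (Md \<tau> G) x - conn G i x ** Md \<tau> G x) ** ginv (G x)"
    unfolding conn_def
    by (simp add: Md_mult Md_ginv_G msmooth_Md smooth_G smooth_ginv x matrix_algebra
        Md_commute[of _ _ \<tau>])
  also have "\<dots> = (Md (d i) E x - conn G i x ** E x) ** ginv (G x)
     + (Md (d i) \<rho> x + \<rho> x ** conn G i x - conn G i x ** \<rho> x)"
    unfolding 1 using x by (simp add: matrix_algebra)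
  finally show ?thesis unfolding tr_nab_curv[OF x] \<rho>_def .
qed

text \<open>The Bianchi identity moves the free index i into the curvature and the contracted index
  a onto the derivative. Curvature with lower index i is the conjugate derivative of Psi plus a
  fixed term, so the trace becomes a Laplacian of Psi: this is where the equation turns out to be
  parabolic.\<close>

lemma Psi_evolution:
  assumes x: "x \<in> W"
  shows "Md \<tau> (\<Psi> i) x = tr_g (\<lambda>b a. nab a (\<lambda>i. Md (bar (d b)) (\<Psi> i)) i x) x + Z i x"
proof -
  \<comment> \<open>Needed on all of \<open>W\<close> and not only at x, because \<open>nab\<close>
    differentiates it once more.\<close>
  have "Md (bar (d b)) (\<Psi> i) y = curv G b i y - curv Gh b i y" if "y \<in> W" for b i y
    unfolding \<Psi>_def curv_def using that by (simp add: Md_diff smooth_conn)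
  then have "nab a (\<lambda>i. Md (bar (d b)) (\<Psi> i)) i x
      = nab a (\<lambda>i y. curv G b i y - curv Gh b i y) i x" for a b
    unfolding nab_def using x Md_cong[of "Md (bar (d b)) (\<Psi> i)" "\<lambda>y. curv G b i y - curv Gh b i y" x "d a"]
    by simp
  then have "nab a (\<lambda>i. Md (bar (d b)) (\<Psi> i)) i x = nab a (curv G b) i x - nab a (curv Gh b) i x" for a b
    by (simp add: nab_def Md_diff smooth_curv x act_diff_right)
  then show ?thesis
    unfolding Z_def Md_\<tau>_\<Psi>[OF x] by (simp add: bianchi[OF x, of _ _ i] tr_g_add tr_g_diff)
qed

text \<open>Commuting derivatives in the Laplacian produces \<open>act\<close> of the traced
  curvature, and differentiating the inner product in time produces \<open>act\<close> of (d/dt G)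
  G^{-1}. These differ by E G^{-1}, so the curvature terms quadratic in Psi cancel. The two
  subtracted sums are the squared norms of the (1,0) and (0,1) derivatives of Psi.\<close>

lemma S_evolution:
  assumes x: "x \<in> W"
  shows "wd \<tau> S x - lap S x =
    ip (G x) (\<lambda>i. Z i x) (\<lambda>i. \<Psi> i x) + ip (G x) (\<lambda>i. \<Psi> i x) (\<lambda>i. Z i x)
    + ip (G x) (act (E x ** ginv (G x)) (\<lambda>i. \<Psi> i x)) (\<lambda>i. \<Psi> i x)
    - (\<Sum>a\<in>UNIV. \<Sum>b\<in>UNIV. ginv (G x) $ b $ a *
        ip (G x) (\<lambda>i. nab a \<Psi> i x) (\<lambda>i. nab b \<Psi> i x))
    - (\<Sum>a\<in>UNIV. \<Sum>b\<in>UNIV. ginv (G x) $ b $ a *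
        ip (G x) (\<lambda>i. Md (bar (d b)) (\<Psi> i) x) (\<lambda>i. Md (bar (d a)) (\<Psi> i) x))"
proof -
  let ?P = "\<lambda>i. \<Psi> i x" and ?k = "ginv (G x)"
  let ?D = "\<lambda>b i. Md (bar (d b)) (\<Psi> i)"
  have 1: "wd (d a) S y = ip (G y) (\<lambda>i. nab a \<Psi> i y) (\<lambda>i. \<Psi> i y) + ip (G y) (\<lambda>i. \<Psi> i y) (\<lambda>i. ?D a i y)"
    if "y \<in> W" for a y
    unfolding S_def nab_def conn_def using wd_ip[OF smooth_\<Psi> smooth_\<Psi> that] by simp
  have 2: "wd (bar (d b)) (wd (d a) S) x =
      ip (G x) (\<lambda>i. nab a (?D b) i x) ?P + ip (G x) (act (curv G b a x) ?P) ?P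
      + ip (G x) (\<lambda>i. nab a \<Psi> i x) (\<lambda>i. nab b \<Psi> i x)
      + ip (G x) (\<lambda>i. ?D b i x) (\<lambda>i. ?D a i x) + ip (G x) ?P (\<lambda>i. nab b (?D a) i x)" for a b
  proof -
    have "wd (bar (d b)) (wd (d a) S) x =
      wd (bar (d b)) (\<lambda>y. ip (G y) (\<lambda>i. nab a \<Psi> i y) (\<lambda>i. \<Psi> i y) + ip (G y) (\<lambda>i. \<Psi> i y) (\<lambda>i. ?D a i y)) x"
      by (rule wd_cong[OF 1 x])
    also have "\<dots> = ip (G x) (\<lambda>i. Md (bar (d b)) (nab a \<Psi> i) x) ?P
      + ip (G x) (\<lambda>i. nab a \<Psi> i x) (\<lambda>i. nab b \<Psi> i x)
      + (ip (G x) (\<lambda>i. ?D b i x) (\<lambda>i. ?D a i x) + ip (G x) ?P (\<lambda>i. nab b (?D a) i x))"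
      by (simp add: wd_add smooth_ip smooth_nab smooth_\<Psi> msmooth_Md x wd_bar_ip nab_def[of b] conn_def)
    finally show ?thesis
      by (simp add: Md_bar_nab smooth_\<Psi> x ip_add_left)
  qed
  have k: "cnj (?k $ b $ a) = ?k $ a $ b" for a b
    using adj_ginv[OF inv_G herm_G] x by (metis adj_nth)
  have L: "(\<Sum>a\<in>UNIV. \<Sum>b\<in>UNIV. ?k $ b $ a * ip (G x) (\<lambda>i. nab a (?D b) i x) ?P)
     = ip (G x) (\<lambda>i. tr_g (\<lambda>b a. nab a (?D b) i x) x) ?P"
    unfolding tr_g_def by (simp add: ip_sum_left ip_cscale_left)
  \<comment> \<open>In the second argument the roles of a and b are interchanged; Hermitian symmetry
    of \<open>ip\<close> and of the inverse metric restores the order used in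
    \<open>tr_g\<close>.\<close>
  have L': "(\<Sum>a\<in>UNIV. \<Sum>b\<in>UNIV. ?k $ b $ a * ip (G x) ?P (\<lambda>i. nab b (?D a) i x))
     = ip (G x) ?P (\<lambda>i. tr_g (\<lambda>b a. nab a (?D b) i x) x)"
  proof -
    have "ip (G x) ?P (\<lambda>i. tr_g (\<lambda>b a. nab a (?D b) i x) x)
      = cnj (ip (G x) (\<lambda>i. tr_g (\<lambda>b a. nab a (?D b) i x) x) ?P)"
      by (simp add: cnj_ip inv_G herm_G x)
    also have "\<dots> = (\<Sum>a\<in>UNIV. \<Sum>b\<in>UNIV. ?k $ a $ b * ip (G x) ?P (\<lambda>i. nab a (?D b) i x))"
      unfolding L[symmetric] by (simp add: k cnj_ip inv_G herm_G x)
    also have "\<dots> = (\<Sum>a\<in>UNIV. \<Sum>b\<in>UNIV. ?k $ b $ a * ip (G x) ?P (\<lambda>i. nab b (?D a) i x))"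
      by (rule sum.swap)
    finally show ?thesis by simp
  qed
  have A: "(\<Sum>a\<in>UNIV. \<Sum>b\<in>UNIV. ?k $ b $ a * ip (G x) (act (curv G b a x) ?P) ?P)
     = ip (G x) (act (tr_g (\<lambda>b a. curv G b a x) x) ?P) ?P"
  proof -
    have "act (tr_g (\<lambda>b a. curv G b a x) x) ?P
        = (\<lambda>i. \<Sum>a\<in>UNIV. \<Sum>b\<in>UNIV. ?k $ b $ a *\<^sub>m act (curv G b a x) ?P i)"
      by (simp add: fun_eq_iff tr_g_def act_sum_left act_cscale_left)
    then show ?thesis by (simp add: ip_sum_left ip_cscale_left)
  qed
  have lap: "lap S x = ip (G x) (\<lambda>i. tr_g (\<lambda>b a. nab a (?D b) i x) x) ?P
     + ip (G x) ?P (\<lambda>i. tr_g (\<lambda>b a. nab a (?D b) i x) x)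
     + ip (G x) (act (tr_g (\<lambda>b a. curv G b a x) x) ?P) ?P
     + (\<Sum>a\<in>UNIV. \<Sum>b\<in>UNIV. ?k $ b $ a * ip (G x) (\<lambda>i. nab a \<Psi> i x) (\<lambda>i. nab b \<Psi> i x))
     + (\<Sum>a\<in>UNIV. \<Sum>b\<in>UNIV. ?k $ b $ a * ip (G x) (\<lambda>i. ?D b i x) (\<lambda>i. ?D a i x))"
    unfolding lap_def 2 L[symmetric] L'[symmetric] A[symmetric]
    by (simp add: distrib_left sum.distrib)
  have \<tau>: "wd \<tau> S x = ip (G x) (\<lambda>i. Md \<tau> (\<Psi> i) x + act (Md \<tau> G x ** ?k) ?P i) ?P
     + ip (G x) ?P (\<lambda>i. Md \<tau> (\<Psi> i) x)"
    unfolding S_def using wd_ip[OF smooth_\<Psi> smooth_\<Psi> x, of \<tau>] by (simp add: bar_\<tau>)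
  have ip_add_right: "ip (G x) ?P (\<lambda>i. A i + B i) = ip (G x) ?P A + ip (G x) ?P B" for A B
  proof -
    have "cnj (ip (G x) ?P (\<lambda>i. A i + B i)) = cnj (ip (G x) ?P A + ip (G x) ?P B)"
      by (simp add: cnj_ip inv_G herm_G x ip_add_left)
    then show ?thesis using complex_cnj_cancel_iff by blast
  qed
  have "Md \<tau> G x ** ?k = E x ** ?k + tr_g (\<lambda>b a. curv G b a x) x"
    using x by (simp add: E_def Ric_eq matrix_algebra)
  then show ?thesis
    unfolding \<tau> lap by (simp add: Psi_evolution[OF x] act_add_left ip_add_left ip_add_right)
qed

text \<open>Second derivatives of \<open>G\<close> cancel between the Laplacian of u and
  \<open>Ric\<close>. The product of two connection matrices is the good quadratic term; each
  further sum term contains a derivative of the fixed matrix \<open>L\<close>.\<close>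

lemma u_evolution:
  assumes x: "x \<in> W"
  defines "L \<equiv> \<lambda>y. ginv (Gh y)"
  shows "wd \<tau> u x - lap u x = trace (E x ** L x)
    - (\<Sum>a\<in>UNIV. \<Sum>b\<in>UNIV. ginv (G x) $ b $ a *
        (trace (conn G a x ** G x ** adj (conn G b x) ** L x)
         + trace (conn G a x ** G x ** Md (bar (d b)) L x)
         + trace (G x ** adj (conn G b x) ** Md (d a) L x)
         + trace (G x ** Md (bar (d b)) (Md (d a) L) x)))"
proof -
  have sL: "msmooth W L" unfolding L_def by (rule hat.smooth_ginv)
  note s = smooth_G sL msmooth_mult msmooth_Md msmooth_add
  have uL: "u = (\<lambda>y. trace (G y ** L y))" by (simp add: fun_eq_iff u_def L_def)
  have "Md \<tau> L x = 0"
    unfolding L_def by (simp add: hat.Md_ginv_G x stationary)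
  then have 0: "wd \<tau> u x = trace (Md \<tau> G x ** L x)"
    unfolding uL by (simp add: wd_trace Md_mult s x)
  have u: "wd (d a) u y = trace (Md (d a) G y ** L y + G y ** Md (d a) L y)" if "y \<in> W" for a y
    unfolding uL using that by (simp add: wd_trace Md_mult s)
  have 2: "wd (bar (d b)) (wd (d a) u) x = trace (Md (bar (d b)) (Md (d a) G) x ** L x
      + Md (d a) G x ** Md (bar (d b)) L x + (Md (bar (d b)) G x ** Md (d a) L x
      + G x ** Md (bar (d b)) (Md (d a) L) x))" for a b
    using wd_cong[OF u x, where \<xi> = "bar (d b)"] by (simp add: wd_trace Md_add Md_mult s x)
  have "trace (Ric x ** L x) = (\<Sum>a\<in>UNIV. \<Sum>b\<in>UNIV. ginv (G x) $ b $ a *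
        (trace (conn G a x ** G x ** adj (conn G b x) ** L x) - trace (Md (bar (d b)) (Md (d a) G) x ** L x)))"
    unfolding Ric_def tr_g_def
    by (simp add: Md_G Md_bar_G x matrix_algebra trace_sum trace_cscale trace_sub right_diff_distrib)
  moreover have "trace (E x ** L x) = wd \<tau> u x + trace (Ric x ** L x)"
    by (simp add: E_def 0 matrix_algebra trace_add)
  moreover have "lap u x = (\<Sum>a\<in>UNIV. \<Sum>b\<in>UNIV. ginv (G x) $ b $ a *
      (trace (Md (bar (d b)) (Md (d a) G) x ** L x)
         + trace (conn G a x ** G x ** Md (bar (d b)) L x)
         + trace (G x ** adj (conn G b x) ** Md (d a) L x)
         + trace (G x ** Md (bar (d b)) (Md (d a) L) x)))"
    unfolding lap_def 2 by (simp add: Md_G Md_bar_G x trace_add add.assoc)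
  ultimately show ?thesis
    by (simp add: distrib_left right_diff_distrib sum.distrib sum_subtractf)
qed

end
section \<open>Norms\<close>

text \<open>The entrywise \<open>\<ell>\<^sup>1\<close> norm is used because it is submultiplicative under every contraction of
  indices, without dimension constants.\<close>

definition N1 :: "complex^'n^'m \<Rightarrow> real" where
  "N1 A = (\<Sum>r\<in>UNIV. \<Sum>s\<in>UNIV. cmod (A $ r $ s))"

lemma N1_nonneg [simp]: "0 \<le> N1 A"
  by (simp add: N1_def sum_nonneg)

lemma N1_zero [simp]: "N1 0 = 0"
  by (simp add: N1_def)

lemma entry_le_N1: "cmod (A $ r $ s) \<le> N1 (A :: complex^'n::finite^'m::finite)"
proof -
  have "cmod (A $ r $ s) \<le> (\<Sum>s\<in>UNIV. cmod (A $ r $ s))"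
    by (rule member_le_sum) auto
  also have "\<dots> \<le> N1 A" unfolding N1_def
    by (rule member_le_sum[of r UNIV "\<lambda>r. \<Sum>s\<in>UNIV. cmod (A $ r $ s)"]) (auto intro: sum_nonneg)
  finally show ?thesis .
qed

lemma N1_add: "N1 (A + B) \<le> N1 A + N1 B"
  unfolding N1_def by (simp add: sum.distrib[symmetric] sum_mono norm_triangle_ineq)

lemma N1_diff: "N1 (A - B) \<le> N1 A + N1 B"
  unfolding N1_def by (simp add: sum.distrib[symmetric] sum_mono norm_triangle_ineq4)

lemma N1_sum: "N1 (\<Sum>i\<in>I. A i) \<le> (\<Sum>i\<in>I. N1 (A i))"
proof (induction I rule: infinite_finite_induct)
  case (insert i I)
  then show ?case using N1_add[of "A i" "\<Sum>i\<in>I. A i"] by simp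
qed auto

lemma N1_cscale: "N1 (c *\<^sub>m A) = cmod c * N1 A"
  by (simp add: N1_def norm_mult sum_distrib_left)

lemma N1_adj: "N1 (adj A) = N1 A"
  unfolding N1_def by (subst sum.swap) simp

lemma N1_mult: "N1 (A ** B) \<le> N1 A * N1 (B :: complex^'n::finite^'k::finite)"
proof -
  have "N1 (A ** B) \<le> (\<Sum>r\<in>UNIV. \<Sum>s\<in>UNIV. \<Sum>k\<in>UNIV. cmod (A $ r $ k) * cmod (B $ k $ s))"
    unfolding N1_def matrix_mult_nth
    by (intro sum_mono order.trans[OF norm_sum]) (simp add: norm_mult)
  also have "\<dots> = (\<Sum>r\<in>UNIV. \<Sum>k\<in>UNIV. cmod (A $ r $ k) * (\<Sum>s\<in>UNIV. cmod (B $ k $ s)))"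
    by (subst sum.swap) (simp add: sum_distrib_left)
  also have "\<dots> \<le> (\<Sum>r\<in>UNIV. \<Sum>k\<in>UNIV. cmod (A $ r $ k) * N1 B)"
    unfolding N1_def
    by (intro sum_mono mult_left_mono member_le_sum[where f="\<lambda>k. \<Sum>s\<in>UNIV. cmod (B $ k $ s)"])
      (auto intro: sum_nonneg)
  also have "\<dots> = N1 A * N1 B"
    by (simp add: N1_def sum_distrib_right)
  finally show ?thesis .
qed

lemma N1_mult_le: "N1 A \<le> a \<Longrightarrow> N1 B \<le> b \<Longrightarrow> N1 (A ** B) \<le> a * (b::real)"
  for A :: "complex^'k::finite^'m::finite" and B :: "complex^'n::finite^'k"
  using N1_mult[of A B] mult_mono[of "N1 A" a "N1 B" b] N1_nonneg[of A] N1_nonneg[of B] by linarith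

lemma trace_le_N1: "cmod (trace A) \<le> N1 (A :: complex^'n::finite^'n)"
proof -
  have "cmod (trace A) \<le> (\<Sum>r\<in>UNIV. cmod (A $ r $ r))"
    unfolding trace_def by (rule norm_sum)
  also have "\<dots> \<le> N1 A"
    unfolding N1_def by (intro sum_mono member_le_sum[where f="\<lambda>s. cmod (A $ _ $ s)"]) auto
  finally show ?thesis .
qed

lemma weighted_double_sum_le:
  fixes A :: "complex^'n::finite^'n"
  assumes "\<And>a b. 0 \<le> f a b"
  shows "(\<Sum>a\<in>UNIV. \<Sum>b\<in>UNIV. cmod (A $ b $ a) * f a b) \<le> N1 A * (\<Sum>a\<in>UNIV. \<Sum>b\<in>UNIV. f a b)"
  unfolding sum_distrib_left by (intro sum_mono mult_right_mono entry_le_N1 assms)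

lemma sum_mult_le:
  fixes f g :: "'i::finite \<Rightarrow> real"
  assumes "\<And>i. 0 \<le> f i" "\<And>i. 0 \<le> g i"
  shows "(\<Sum>i\<in>UNIV. f i * g i) \<le> (\<Sum>i\<in>UNIV. f i) * (\<Sum>i\<in>UNIV. g i)"
  unfolding sum_distrib_right using assms
  by (intro sum_mono mult_left_mono member_le_sum) auto

text \<open>The factor 3 counts the indices of the tensor: every term of \<open>act\<close>
  contracts the endomorphism with one of them.\<close>

lemma sum_act_le: "(\<Sum>i\<in>UNIV. N1 (act \<eta> X i)) \<le> 3 * (N1 \<eta> * (\<Sum>i\<in>UNIV. N1 (X i)))"
proof -
  have "N1 (act \<eta> X i) \<le> N1 (X i) * N1 \<eta> + N1 \<eta> * N1 (X i) + (\<Sum>p\<in>UNIV. cmod (\<eta> $ i $ p) * N1 (X p))" for i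
  proof -
    have "N1 (\<Sum>p\<in>UNIV. \<eta> $ i $ p *\<^sub>m X p) \<le> (\<Sum>p\<in>UNIV. cmod (\<eta> $ i $ p) * N1 (X p))"
      using N1_sum[of "\<lambda>p. \<eta> $ i $ p *\<^sub>m X p" UNIV] by (simp add: N1_cscale)
    moreover have "N1 (act \<eta> X i) \<le> N1 (X i ** \<eta>) + N1 (\<eta> ** X i) + N1 (\<Sum>p\<in>UNIV. \<eta> $ i $ p *\<^sub>m X p)"
      unfolding act_def by (intro order.trans[OF N1_diff] add_mono N1_diff order.refl)
    ultimately show ?thesis using N1_mult[of "X i" \<eta>] N1_mult[of \<eta> "X i"] by linarith
  qed
  then have "(\<Sum>i\<in>UNIV. N1 (act \<eta> X i)) \<le>
     (\<Sum>i\<in>UNIV. N1 (X i) * N1 \<eta> + N1 \<eta> * N1 (X i) + (\<Sum>p\<in>UNIV. cmod (\<eta> $ i $ p) * N1 (X p)))"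
    by (rule sum_mono)
  also have "\<dots> = 2 * (N1 \<eta> * (\<Sum>i\<in>UNIV. N1 (X i))) + (\<Sum>i\<in>UNIV. \<Sum>p\<in>UNIV. cmod (\<eta> $ i $ p) * N1 (X p))"
    by (simp add: sum.distrib sum_distrib_left mult.commute)
  also have "(\<Sum>i\<in>UNIV. \<Sum>p\<in>UNIV. cmod (\<eta> $ i $ p) * N1 (X p))
      \<le> (\<Sum>i\<in>UNIV. (\<Sum>p\<in>UNIV. cmod (\<eta> $ i $ p)) * (\<Sum>p\<in>UNIV. N1 (X p)))"
    by (intro sum_mono sum_mult_le) auto
  also have "\<dots> = N1 \<eta> * (\<Sum>i\<in>UNIV. N1 (X i))"
    by (simp add: N1_def sum_distrib_right)
  finally show ?thesis by simp
qed


section \<open>Frames\<close>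

text \<open>A common shape for the inner products of all tensor types, with a tuple of indices as
  the single index.\<close>

definition hform :: "('i::finite \<Rightarrow> 'i \<Rightarrow> complex) \<Rightarrow> ('i \<Rightarrow> complex) \<Rightarrow> ('i \<Rightarrow> complex) \<Rightarrow> complex" where
  "hform V A B = (\<Sum>I\<in>UNIV. \<Sum>J\<in>UNIV. V I J * A I * cnj (B J))"

text \<open>\<open>R\<close> passes to the components in an orthonormal frame and \<open>L\<close> is its inverse.\<close>

definition framed :: "real \<Rightarrow> ('i::finite \<Rightarrow> 'i \<Rightarrow> complex) \<Rightarrow> bool" where
  "framed b V \<longleftrightarrow> (\<exists>(R :: 'i \<Rightarrow> 'i \<Rightarrow> complex) L. (\<forall>I J. V I J = (\<Sum>K\<in>UNIV. R K I * cnj (R K J))) \<and>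
     (\<forall>I J. (\<Sum>K\<in>UNIV. L I K * R K J) = (if I = J then 1 else 0)) \<and>
     (\<forall>I K. cmod (R K I) \<le> b \<and> cmod (L I K) \<le> b))"

text \<open>In the frame the form is a sum of squares |c_K|^2 with c = R A, and A = L c recovers the
  components. One sum over K and one over I give the square of the cardinality.\<close>

lemma framed_bounds:
  fixes V :: "'i::finite \<Rightarrow> 'i \<Rightarrow> complex"
  assumes "framed b V"
  shows "0 \<le> Re (hform V A A)"
    and "(\<Sum>I\<in>UNIV. cmod (A I)) \<le> b * real CARD('i) ^ 2 * sqrt (Re (hform V A A))"
proof -
  obtain R L :: "'i \<Rightarrow> 'i \<Rightarrow> complex" where V: "\<And>I J. V I J = (\<Sum>K\<in>UNIV. R K I * cnj (R K J))"
    and LR: "\<And>I J. (\<Sum>K\<in>UNIV. L I K * R K J) = (if I = J then 1 else 0)"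
    and b: "\<And>I K. cmod (L I K) \<le> b"
    using assms unfolding framed_def by blast
  define c where "c = (\<lambda>K. \<Sum>I\<in>UNIV. R K I * A I)"
  have "hform V A A = (\<Sum>I\<in>UNIV. \<Sum>J\<in>UNIV. \<Sum>K\<in>UNIV. (R K I * A I) * cnj (R K J * A J))"
    unfolding hform_def V by (simp add: sum_distrib_left sum_distrib_right algebra_simps)
  also have "\<dots> = (\<Sum>I\<in>UNIV. \<Sum>K\<in>UNIV. \<Sum>J\<in>UNIV. (R K I * A I) * cnj (R K J * A J))"
    by (intro sum.cong refl sum.swap)
  also have "\<dots> = (\<Sum>K\<in>UNIV. \<Sum>I\<in>UNIV. \<Sum>J\<in>UNIV. (R K I * A I) * cnj (R K J * A J))"
    by (rule sum.swap)
  also have "\<dots> = (\<Sum>K\<in>UNIV. c K * cnj (c K))"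
    unfolding c_def by (simp add: sum_product)
  also have "\<dots> = (\<Sum>K\<in>UNIV. of_real ((cmod (c K))\<^sup>2))"
    by (intro sum.cong refl) (rule complex_norm_square[symmetric])
  finally have H: "Re (hform V A A) = (\<Sum>K\<in>UNIV. (cmod (c K))\<^sup>2)"
    by simp
  then show "0 \<le> Re (hform V A A)" by (simp add: sum_nonneg)
  have c: "cmod (c K) \<le> sqrt (Re (hform V A A))" for K
    unfolding H by (rule real_le_rsqrt) (rule member_le_sum[where f="\<lambda>K. (cmod (c K))\<^sup>2"]; simp)
  have "A I = (\<Sum>K\<in>UNIV. L I K * c K)" for I
  proof -
    have "(\<Sum>K\<in>UNIV. L I K * c K) = (\<Sum>K\<in>UNIV. \<Sum>J\<in>UNIV. L I K * R K J * A J)"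
      unfolding c_def by (simp add: sum_distrib_left mult.assoc)
    also have "\<dots> = (\<Sum>J\<in>UNIV. \<Sum>K\<in>UNIV. L I K * R K J * A J)"
      by (rule sum.swap)
    also have "\<dots> = (\<Sum>J\<in>UNIV. (if I = J then 1 else 0) * A J)"
      unfolding LR[symmetric] by (simp add: sum_distrib_right)
    also have "\<dots> = (\<Sum>J\<in>UNIV. if I = J then A J else 0)"
      by (intro sum.cong) auto
    also have "\<dots> = A I" by simp
    finally show ?thesis by simp
  qed
  moreover have "cmod (\<Sum>K\<in>UNIV. L I K * c K) \<le> (\<Sum>K\<in>(UNIV::'i set). b * sqrt (Re (hform V A A)))" for I
    by (intro order.trans[OF norm_sum] sum_mono)
      (use c b order.trans[OF norm_ge_zero b] in \<open>auto simp: norm_mult intro: mult_mono\<close>)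
  ultimately have "cmod (A I) \<le> (\<Sum>K\<in>(UNIV::'i set). b * sqrt (Re (hform V A A)))" for I
    by simp
  then have "cmod (A I) \<le> real CARD('i) * (b * sqrt (Re (hform V A A)))" for I
    by simp
  then have "(\<Sum>I\<in>UNIV. cmod (A I)) \<le> (\<Sum>I\<in>(UNIV::'i set). real CARD('i) * (b * sqrt (Re (hform V A A))))"
    by (rule sum_mono)
  then show "(\<Sum>I\<in>UNIV. cmod (A I)) \<le> b * real CARD('i) ^ 2 * sqrt (Re (hform V A A))"
    by (simp add: power2_eq_square algebra_simps)
qed

lemma sum_prod_UNIV: "(\<Sum>p\<in>UNIV. f p) = (\<Sum>a\<in>UNIV. \<Sum>b\<in>UNIV. f (a, b))"
  for f :: "'a::finite \<times> 'b::finite \<Rightarrow> 'c::comm_monoid_add"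
  by (subst UNIV_Times_UNIV[symmetric], subst sum.cartesian_product) simp

definition tensor :: "('i \<Rightarrow> 'i \<Rightarrow> complex) \<Rightarrow> ('j \<Rightarrow> 'j \<Rightarrow> complex) \<Rightarrow> 'i \<times> 'j \<Rightarrow> 'i \<times> 'j \<Rightarrow> complex" where
  "tensor V V' p q = V (fst p) (fst q) * V' (snd p) (snd q)"

text \<open>Products of orthonormal frames are orthonormal for the product form, so a bound for one
  frame of the metric handles tensors of every type.\<close>

lemma framed_tensor:
  fixes V :: "'i::finite \<Rightarrow> 'i \<Rightarrow> complex" and V' :: "'j::finite \<Rightarrow> 'j \<Rightarrow> complex"
  assumes "framed b V" "framed c V'"
  shows "framed (b * c) (tensor V V')"
proof -
  obtain R L :: "'i \<Rightarrow> 'i \<Rightarrow> complex" where 1: "\<And>I J. V I J = (\<Sum>K\<in>UNIV. R K I * cnj (R K J))"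
    "\<And>I J. (\<Sum>K\<in>UNIV. L I K * R K J) = (if I = J then 1 else 0)"
    "\<And>I K. cmod (R K I) \<le> b" "\<And>I K. cmod (L I K) \<le> b"
    using assms(1) unfolding framed_def by blast
  obtain R' L' :: "'j \<Rightarrow> 'j \<Rightarrow> complex" where 2: "\<And>I J. V' I J = (\<Sum>K\<in>UNIV. R' K I * cnj (R' K J))"
    "\<And>I J. (\<Sum>K\<in>UNIV. L' I K * R' K J) = (if I = J then 1 else 0)"
    "\<And>I K. cmod (R' K I) \<le> c" "\<And>I K. cmod (L' I K) \<le> c"
    using assms(2) unfolding framed_def by blast
  have "tensor V V' p q = (\<Sum>K\<in>UNIV. (R (fst K) (fst p) * R' (snd K) (snd p)) *
      cnj (R (fst K) (fst q) * R' (snd K) (snd q)))" for p q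
    unfolding tensor_def 1 2 sum_product by (simp add: sum_prod_UNIV algebra_simps)
  moreover have "(\<Sum>K\<in>UNIV. (L (fst p) (fst K) * L' (snd p) (snd K)) * (R (fst K) (fst q) * R' (snd K) (snd q)))
      = (if p = q then 1 else 0)" for p q
  proof -
    have "(\<Sum>K\<in>UNIV. (L (fst p) (fst K) * L' (snd p) (snd K)) * (R (fst K) (fst q) * R' (snd K) (snd q)))
      = (\<Sum>K\<in>UNIV. L (fst p) K * R K (fst q)) * (\<Sum>K\<in>UNIV. L' (snd p) K * R' K (snd q))"
      unfolding sum_product by (simp add: sum_prod_UNIV algebra_simps)
    then show ?thesis unfolding 1 2 by (simp add: prod_eq_iff)
  qed
  moreover have "cmod (R (fst K) (fst p) * R' (snd K) (snd p)) \<le> b * c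
      \<and> cmod (L (fst p) (fst K) * L' (snd p) (snd K)) \<le> b * c" for p K
    unfolding norm_mult
    using mult_mono[OF 1(3) 2(3)] mult_mono[OF 1(4) 2(4)] order.trans[OF norm_ge_zero 1(3)] by simp
  ultimately show ?thesis
    unfolding framed_def
    by (intro exI[of _ "\<lambda>K p. R (fst K) (fst p) * R' (snd K) (snd p)"]
        exI[of _ "\<lambda>p K. L (fst p) (fst K) * L' (snd p) (snd K)"]) blast
qed

lemma hform_tensor:
  "hform (tensor V V') A B =
    (\<Sum>a\<in>UNIV. \<Sum>b\<in>UNIV. V a b * hform V' (\<lambda>I. A (a, I)) (\<lambda>J. B (b, J)))"
proof -
  have "hform (tensor V V') A B =
     (\<Sum>a\<in>UNIV. \<Sum>I\<in>UNIV. \<Sum>b\<in>UNIV. \<Sum>J\<in>UNIV. V a b * (V' I J * A (a, I) * cnj (B (b, J))))"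
    unfolding hform_def sum_prod_UNIV tensor_def by (simp add: algebra_simps)
  also have "\<dots> = (\<Sum>a\<in>UNIV. \<Sum>b\<in>UNIV. \<Sum>I\<in>UNIV. \<Sum>J\<in>UNIV. V a b * (V' I J * A (a, I) * cnj (B (b, J))))"
    by (intro sum.cong refl sum.swap)
  finally show ?thesis by (simp add: hform_def sum_distrib_left)
qed

text \<open>The rows of \<open>Q\<close> form an orthonormal basis for \<open>herm_form H\<close>,
  and \<open>P\<close> converts a vector into its components. Both directions of the conversion are
  bounded.\<close>

definition frame_bound :: "real \<Rightarrow> complex^'n^'n::finite \<Rightarrow> bool" where
  "frame_bound b H \<longleftrightarrow> (\<exists>(P :: complex^'n^'n) (Q :: complex^'n^'n). P ** Q = mat 1 \<and> Q ** P = mat 1 \<and> H = P ** adj P \<and>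
     (\<forall>i j. cmod (P $ i $ j) \<le> b \<and> cmod (Q $ i $ j) \<le> b))"

lemma frame_ginv:
  assumes "P ** Q = mat 1" "Q ** P = mat 1"
  shows "ginv (P ** adj P) = adj Q ** (Q :: complex^'n^'n::finite)"
proof (rule matrix_inv_eqI)
  have 1: "adj P ** adj Q = mat 1" "adj Q ** adj P = mat 1"
    using assms by (metis adj_mat1 adj_mult)+
  have "P ** adj P ** (adj Q ** Q) = P ** (adj P ** adj Q) ** Q" by (simp add: matrix_mul_assoc)
  then show "P ** adj P ** (adj Q ** Q) = mat 1" using 1 assms by simp
  have "adj Q ** Q ** (P ** adj P) = adj Q ** (Q ** P) ** adj P" by (simp add: matrix_mul_assoc)
  then show "adj Q ** Q ** (P ** adj P) = mat 1" using 1 assms by simp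
qed

text \<open>An upper index, a lower index and a barred lower index. \<open>P\<close> and
  \<open>Q\<close> exchange roles between the first two; the third frame is the conjugate of the
  second.\<close>

lemma framed_metric:
  fixes H :: "complex^'n^'n::finite"
  assumes "frame_bound b H"
  shows "framed b (\<lambda>k q. H $ k $ q)" "framed b (\<lambda>i m. ginv H $ m $ i)" "framed b (\<lambda>s q. ginv H $ s $ q)"
proof -
  obtain P Q :: "complex^'n^'n" where PQ: "P ** Q = mat 1" "Q ** P = mat 1" and H: "H = P ** adj P"
    and b: "\<And>i j. cmod (P $ i $ j) \<le> b" "\<And>i j. cmod (Q $ i $ j) \<le> b"
    using assms unfolding frame_bound_def by blast
  have k: "ginv H = adj Q ** Q" unfolding H by (rule frame_ginv[OF PQ])
  have pq: "(\<Sum>K\<in>UNIV. P $ i $ K * Q $ K $ j) = (if i = j then 1 else 0)" for i j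
    using arg_cong[OF PQ(1), of "\<lambda>A. A $ i $ j"] by (simp add: matrix_mult_nth mat_def)
  show "framed b (\<lambda>k q. H $ k $ q)"
    unfolding framed_def
    by (rule exI[of _ "\<lambda>K I. P $ I $ K"], rule exI[of _ "\<lambda>I K. Q $ K $ I"])
      (use pq b in \<open>auto simp: H matrix_mult_nth mult.commute[of "Q $ _ $ _"]\<close>)
  show "framed b (\<lambda>i m. ginv H $ m $ i)"
    unfolding framed_def
    by (rule exI[of _ "\<lambda>K I. Q $ K $ I"], rule exI[of _ "\<lambda>I K. P $ I $ K"])
      (use pq b in \<open>auto simp: k matrix_mult_nth mult.commute\<close>)
  have "(\<Sum>K\<in>UNIV. cnj (P $ i $ K) * cnj (Q $ K $ j)) = (if i = j then 1 else 0)" for i j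
    using arg_cong[OF pq[of i j], of cnj] by simp
  then show "framed b (\<lambda>s q. ginv H $ s $ q)"
    unfolding framed_def
    by (intro exI[of _ "\<lambda>K I. cnj (Q $ K $ I)"] exI[of _ "\<lambda>I K. cnj (P $ I $ K)"])
      (use b in \<open>auto simp: k matrix_mult_nth\<close>)
qed

text \<open>Cholesky factorisation by induction on the index set, passing to the Schur complement.\<close>

lemma cholesky_on:
  fixes h :: "'n \<Rightarrow> 'n \<Rightarrow> complex"
  assumes "finite A"
    and "\<And>r s. r \<in> A \<Longrightarrow> s \<in> A \<Longrightarrow> h s r = cnj (h r s)"
    and "\<And>v. (\<exists>r\<in>A. v r \<noteq> 0) \<Longrightarrow> 0 < Re (\<Sum>r\<in>A. \<Sum>s\<in>A. h r s * v r * cnj (v s))"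
  shows "\<exists>P :: 'n \<Rightarrow> 'n \<Rightarrow> complex. \<forall>r\<in>A. \<forall>s\<in>A. h r s = (\<Sum>k\<in>A. P r k * cnj (P s k))"
  using assms
proof (induction A arbitrary: h rule: finite_induct)
  case (insert x A)
  define hx where "hx = h x x"
  have "0 < Re (\<Sum>r\<in>insert x A. \<Sum>s\<in>insert x A. h r s * (if r = x then 1 else 0) * cnj (if s = x then 1 else 0))"
    by (rule insert.prems(2)[of "\<lambda>r. if r = x then 1 else 0"]) auto
  also have "(\<Sum>r\<in>insert x A. \<Sum>s\<in>insert x A. h r s * (if r = x then 1 else 0) * cnj (if s = x then 1 else 0))
      = (\<Sum>r\<in>insert x A. \<Sum>s\<in>insert x A. if s = x then (if r = x then hx else 0) else 0)"
    by (intro sum.cong) (auto simp: hx_def)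
  also have "\<dots> = hx"
    using insert.hyps(1) by (simp only: sum.delta finite_insert insertI1 if_True)
  finally have pos: "0 < Re hx" .
  have "cnj hx = hx" using insert.prems(1)[of x x] by (simp add: hx_def)
  then have real: "hx = of_real (Re hx)" by (metis Reals_cnj_iff of_real_Re)
  define h' where "h' = (\<lambda>r s. h r s - h r x * h x s / hx)"
  have hne: "hx \<noteq> 0" using pos by auto
  have "\<exists>P :: 'n \<Rightarrow> 'n \<Rightarrow> complex. \<forall>r\<in>A. \<forall>s\<in>A. h' r s = (\<Sum>k\<in>A. P r k * cnj (P s k))"
  proof (rule insert.IH)
    show "h' s r = cnj (h' r s)" if "r \<in> A" "s \<in> A" for r s
      using insert.prems(1)[of r s] insert.prems(1)[of r x] insert.prems(1)[of x s] that \<open>cnj hx = hx\<close>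
      by (simp add: h'_def)
    fix v :: "'n \<Rightarrow> complex"
    assume v: "\<exists>r\<in>A. v r \<noteq> 0"
    define c where "c = (\<Sum>r\<in>A. h r x * v r)"
    \<comment> \<open>The value at x minimises the form among all extensions of v, so that the form
      of \<open>h\<close> on w equals the form of the Schur complement on v.\<close>
    define w where "w = v(x := - c / hx)"
    have wA: "w r = v r" if "r \<in> A" for r using that insert.hyps by (auto simp: w_def)
    have cc: "(\<Sum>s\<in>A. h x s * cnj (v s)) = cnj c"
      unfolding c_def cnj_sum using insert.prems(1)[of _ x] by (intro sum.cong) auto
    have "(\<Sum>r\<in>insert x A. \<Sum>s\<in>insert x A. h r s * w r * cnj (w s)) =
       hx * w x * cnj (w x) + w x * cnj c + c * cnj (w x) + (\<Sum>r\<in>A. \<Sum>s\<in>A. h r s * v r * cnj (v s))"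
    proof -
      have "(\<Sum>s\<in>A. h x s * w x * cnj (w s)) = w x * cnj c"
        unfolding cc[symmetric] sum_distrib_left by (intro sum.cong) (auto simp: wA)
      moreover have "(\<Sum>r\<in>A. h r x * w r * cnj (w x)) = c * cnj (w x)"
        unfolding c_def sum_distrib_right by (intro sum.cong) (auto simp: wA)
      moreover have "(\<Sum>r\<in>A. \<Sum>s\<in>A. h r s * w r * cnj (w s)) = (\<Sum>r\<in>A. \<Sum>s\<in>A. h r s * v r * cnj (v s))"
        by (intro sum.cong) (auto simp: wA)
      ultimately show ?thesis
        using insert.hyps by (simp add: sum.distrib hx_def algebra_simps)
    qed
    also have "\<dots> = (\<Sum>r\<in>A. \<Sum>s\<in>A. h r s * v r * cnj (v s)) - c * cnj c / hx"
      using hne \<open>cnj hx = hx\<close> by (simp add: w_def field_simps)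
    also have "c * cnj c / hx = (\<Sum>r\<in>A. \<Sum>s\<in>A. h r x * h x s / hx * v r * cnj (v s))"
      unfolding cc[symmetric] unfolding c_def sum_product sum_divide_distrib
      by (intro sum.cong) (auto simp: algebra_simps)
    also have "(\<Sum>r\<in>A. \<Sum>s\<in>A. h r s * v r * cnj (v s)) - \<dots> = (\<Sum>r\<in>A. \<Sum>s\<in>A. h' r s * v r * cnj (v s))"
      by (simp add: h'_def sum_subtractf left_diff_distrib)
    finally show "0 < Re (\<Sum>r\<in>A. \<Sum>s\<in>A. h' r s * v r * cnj (v s))"
      using insert.prems(2)[of w] v wA by fastforce
  qed
  then obtain P :: "'n \<Rightarrow> 'n \<Rightarrow> complex" where P: "\<And>r s. r \<in> A \<Longrightarrow> s \<in> A \<Longrightarrow> h' r s = (\<Sum>k\<in>A. P r k * cnj (P s k))" by blast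
  define q where "q = complex_of_real (sqrt (Re hx))"
  have q: "q * q = hx" "cnj q = q" "q \<noteq> 0"
    using pos real by (auto simp: q_def simp flip: of_real_mult)
  \<comment> \<open>Column x is the column of \<open>h\<close> divided by the root of the pivot, row
    x vanishes elsewhere, and the remaining block factors the Schur complement.\<close>
  define P' where "P' = (\<lambda>r k. if k = x then h r x / q else if r = x then 0 else P r k)"
  have "h r s = (\<Sum>k\<in>insert x A. P' r k * cnj (P' s k))" if rs: "r \<in> insert x A" "s \<in> insert x A" for r s
  proof -
    have 1: "(\<Sum>k\<in>insert x A. P' r k * cnj (P' s k)) = h r x * h x s / hx + (\<Sum>k\<in>A. P' r k * cnj (P' s k))"
      using insert.hyps insert.prems(1)[of s x] rs q by (simp add: P'_def flip: q(1))
    show ?thesis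
    proof (cases "r = x \<or> s = x")
      case True
      then have "(\<Sum>k\<in>A. P' r k * cnj (P' s k)) = 0"
        using insert.hyps by (intro sum.neutral) (auto simp: P'_def)
      then show ?thesis using True hne unfolding 1 by (auto simp: hx_def)
    next
      case False
      then have "(\<Sum>k\<in>A. P' r k * cnj (P' s k)) = (\<Sum>k\<in>A. P r k * cnj (P s k))"
        using insert.hyps by (intro sum.cong) (auto simp: P'_def)
      also have "\<dots> = h' r s" using P[of r s] rs False by auto
      finally show ?thesis unfolding 1 h'_def by simp
    qed
  qed
  then show ?case by blast
qed auto

text \<open>Definiteness makes the factor invertible: a row vector annihilated by it has form
  zero.\<close>

lemma cholesky:
  fixes H :: "complex^'n^'n::finite"
  assumes "\<And>r s. H $ s $ r = cnj (H $ r $ s)" "\<And>v. v \<noteq> 0 \<Longrightarrow> herm_form H v > 0"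
  obtains P Q :: "complex^'n^'n" where "P ** Q = mat 1" "Q ** P = mat 1" "H = P ** adj P"
proof -
  have "\<exists>P :: 'n \<Rightarrow> 'n \<Rightarrow> complex. \<forall>r\<in>UNIV. \<forall>s\<in>UNIV. H $ r $ s = (\<Sum>k\<in>UNIV. P r k * cnj (P s k))"
  proof (rule cholesky_on[OF finite_class.finite_UNIV assms(1)])
    fix v :: "'n \<Rightarrow> complex" assume "\<exists>r\<in>UNIV. v r \<noteq> 0"
    then have "(\<chi> i. v i) \<noteq> 0" by (auto simp: vec_eq_iff)
    from assms(2)[OF this] show "0 < Re (\<Sum>r\<in>UNIV. \<Sum>s\<in>UNIV. H $ r $ s * v r * cnj (v s))"
      by (simp add: herm_form_def)
  qed
  then obtain P :: "'n \<Rightarrow> 'n \<Rightarrow> complex" where P: "\<And>r s. H $ r $ s = (\<Sum>k\<in>UNIV. P r k * cnj (P s k))" by blast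
  define P' where "P' = (\<chi> r k. P r k)"
  have H: "H = P' ** adj P'" by (simp add: vec_eq_iff matrix_mult_nth P'_def P)
  have inj: "v = 0" if "v v* P' = 0" for v
  proof (rule ccontr)
    assume v: "v \<noteq> 0"
    have z: "(\<Sum>r\<in>UNIV. P r k * v $ r) = 0" for k
      using arg_cong[OF that, of "\<lambda>w. w $ k"] by (simp add: vector_matrix_mult_def P'_def mult.commute)
    have "(\<Sum>r\<in>UNIV. \<Sum>s\<in>UNIV. H $ r $ s * v $ r * cnj (v $ s))
       = (\<Sum>r\<in>UNIV. \<Sum>s\<in>UNIV. \<Sum>k\<in>UNIV. (P r k * v $ r) * cnj (P s k * v $ s))"
      unfolding P by (simp add: sum_distrib_left sum_distrib_right algebra_simps)
    also have "\<dots> = (\<Sum>r\<in>UNIV. \<Sum>k\<in>UNIV. \<Sum>s\<in>UNIV. (P r k * v $ r) * cnj (P s k * v $ s))"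
      by (intro sum.cong refl sum.swap)
    also have "\<dots> = 0"
      unfolding sum_distrib_left[symmetric] cnj_sum[symmetric] z by simp
    finally have "herm_form H v = 0" by (simp add: herm_form_def)
    then show False using assms(2)[OF v] by simp
  qed
  have "transpose P' *v v = v v* P'" for v by simp
  then have "\<exists>B. B ** transpose P' = mat 1"
    using inj by (subst matrix_left_invertible_ker) simp
  then obtain B where "B ** transpose P' = mat 1" by blast
  then have "P' ** transpose B = mat 1"
    by (metis matrix_transpose_mul transpose_mat transpose_transpose)
  then show thesis using that[of P' "transpose B"] H matrix_left_right_inverse by blast
qed

section \<open>Entry sums of tensors bounded by their norms\<close>

definition frame_const :: "'n::finite itself \<Rightarrow> real \<Rightarrow> real" where
  "frame_const _ b = b ^ 4 * real CARD('n) ^ 8"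

text \<open>One constant for all tensors that occur. They have at most four indices, which gives the
  power b^4 and at most CARD('n)^4 components; the latter number enters \<open>framed_bounds\<close>
  squared.\<close>

lemma framed_bounds_le:
  fixes V :: "'i::finite \<Rightarrow> 'i \<Rightarrow> complex"
  assumes "framed c V" "c \<le> b ^ 4" "CARD('i) \<le> CARD('n::finite) ^ 4"
  shows "(\<Sum>I\<in>UNIV. cmod (A I)) \<le> frame_const TYPE('n) b * sqrt (Re (hform V A A))"
proof -
  have c0: "0 \<le> c"
    using assms(1) unfolding framed_def by (meson norm_ge_zero order.trans)
  have "real CARD('i) ^ 2 \<le> (real CARD('n) ^ 4) ^ 2"
    using assms(3) by (intro power_mono) (metis of_nat_le_iff of_nat_power, simp)
  then have "c * real CARD('i) ^ 2 \<le> b ^ 4 * real CARD('n) ^ 8"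
    using assms(2) c0 by (intro mult_mono) auto
  then have "c * real CARD('i) ^ 2 * sqrt (Re (hform V A A)) \<le> frame_const TYPE('n) b * sqrt (Re (hform V A A))"
    using framed_bounds(1)[OF assms(1)] unfolding frame_const_def by (intro mult_right_mono) auto
  then show ?thesis using framed_bounds(2)[OF assms(1), of A] by linarith
qed

text \<open>Separate metrics for the three indices are needed because u is a trace with respect to
  \<open>Gh\<close>: its good term measures the second lower index of Psi by \<open>Gh\<close> and
  the other two indices by \<open>G\<close>.\<close>

definition form3 :: "complex^'n^'n::finite \<Rightarrow> complex^'n^'n \<Rightarrow> complex^'n^'n \<Rightarrow>
    ('n \<Rightarrow> complex^'n^'n) \<Rightarrow> ('n \<Rightarrow> complex^'n^'n) \<Rightarrow> complex" where
  "form3 k l H X Y = (\<Sum>i\<in>UNIV. \<Sum>m\<in>UNIV. k $ m $ i * trace (X i ** H ** adj (Y m) ** l))"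

abbreviation tens3 :: "complex^'n^'n::finite \<Rightarrow> complex^'n^'n \<Rightarrow> complex^'n^'n \<Rightarrow>
    'n \<times> 'n \<times> 'n \<Rightarrow> 'n \<times> 'n \<times> 'n \<Rightarrow> complex" where
  "tens3 k l H \<equiv> tensor (\<lambda>i m. k $ m $ i) (tensor (\<lambda>j p. l $ p $ j) (\<lambda>k q. H $ k $ q))"

lemma form3_hform:
  "form3 k l H X Y = hform (tens3 k l H) (\<lambda>(i, j, k). X i $ j $ k) (\<lambda>(i, j, k). Y i $ j $ k)"
proof -
  have "trace (X i ** H ** adj (Y m) ** l) = (\<Sum>j\<in>UNIV. \<Sum>p\<in>UNIV. l $ p $ j *
      (\<Sum>a\<in>UNIV. \<Sum>q\<in>UNIV. H $ a $ q * X i $ j $ a * cnj (Y m $ p $ q)))" for i m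
  proof -
    have "trace (X i ** H ** adj (Y m) ** l) =
       (\<Sum>j\<in>UNIV. \<Sum>p\<in>UNIV. \<Sum>q\<in>UNIV. \<Sum>a\<in>UNIV. l $ p $ j * (H $ a $ q * X i $ j $ a * cnj (Y m $ p $ q)))"
      unfolding trace_def matrix_mult_nth adj_nth
      by (simp add: sum_distrib_left sum_distrib_right algebra_simps)
    also have "\<dots> = (\<Sum>j\<in>UNIV. \<Sum>p\<in>UNIV. \<Sum>a\<in>UNIV. \<Sum>q\<in>UNIV. l $ p $ j * (H $ a $ q * X i $ j $ a * cnj (Y m $ p $ q)))"
      by (intro sum.cong refl sum.swap)
    finally show ?thesis by (simp add: sum_distrib_left)
  qed
  then show ?thesis
    unfolding form3_def hform_tensor by (simp add: hform_def)
qed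

lemma ip_form3: "ip H X Y = form3 (ginv H) (ginv H) H X Y"
  by (simp add: ip_def form3_def)

lemma inner_21_hform:
  "inner_21 H A B = hform (tens3 (ginv H) (ginv H) H) (\<lambda>(i, j, k). A i j k) (\<lambda>(i, j, k). B i j k)"
  unfolding inner_21_def hform_def sum_prod_UNIV tensor_def by (simp add: algebra_simps)

lemma ip_inner_21: "inner_21 H (\<lambda>i j k. X i $ j $ k) (\<lambda>i j k. Y i $ j $ k) = ip H X Y"
  by (simp add: inner_21_hform ip_form3 form3_hform)

lemma inner_11_hform:
  "inner_11 H A B = hform (tensor (\<lambda>r p. ginv H $ p $ r) (\<lambda>s q. ginv H $ s $ q))
     (\<lambda>(r, s). A r s) (\<lambda>(r, s). B r s)"
  unfolding inner_11_def hform_def sum_prod_UNIV tensor_def by (simp add: algebra_simps)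

lemma framed_tens3:
  assumes "frame_bound b H" "frame_bound b H'"
  shows "framed (b * (b * b)) (tens3 (ginv H) (ginv H') H)"
  by (intro framed_tensor framed_metric assms)

lemma card_prod_le: "0 < n \<Longrightarrow> n * n \<le> n ^ 4" "0 < n \<Longrightarrow> n * (n * n) \<le> n ^ 4" "n * (n * (n * n)) \<le> n ^ 4"
  for n :: nat
  using power_increasing[of 2 4 n] power_increasing[of 3 4 n]
  by (auto simp: numeral_eq_Suc)

lemma b_prod_le: "1 \<le> b \<Longrightarrow> b * b \<le> b ^ 4" "1 \<le> b \<Longrightarrow> b * (b * b) \<le> b ^ 4" "b * (b * (b * b)) \<le> b ^ 4"
  for b :: real
  using power_increasing[of 2 4 b] power_increasing[of 3 4 b]
  by (auto simp: numeral_eq_Suc)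

lemma sum_le_norm_11:
  fixes H :: "complex^'n^'n::finite"
  assumes "1 \<le> b" "frame_bound b H"
  shows "(\<Sum>r\<in>UNIV. \<Sum>s\<in>UNIV. cmod (A r s)) \<le> frame_const TYPE('n) b * norm_11 H A"
  using framed_bounds_le[where 'n = 'n, OF framed_tensor[OF framed_metric(2,3)[OF assms(2)]]
      b_prod_le(1)[OF assms(1)], of "\<lambda>(r, s). A r s"] card_prod_le(1)[of "CARD('n)"]
  by (simp add: norm_11_def inner_11_hform sum_prod_UNIV)

lemma
  fixes H :: "complex^'n^'n::finite"
  assumes "frame_bound b H"
  shows inner_21_nonneg: "0 \<le> Re (inner_21 H A A)"
    and sum_le_norm_21: "1 \<le> b \<Longrightarrow>
      (\<Sum>i\<in>UNIV. \<Sum>j\<in>UNIV. \<Sum>k\<in>UNIV. cmod (A i j k)) \<le> frame_const TYPE('n) b * norm_21 H A"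
  using framed_bounds_le[where 'n = 'n, OF framed_tens3[OF assms assms] b_prod_le(2), of "\<lambda>(i, j, k). A i j k"]
    framed_bounds(1)[OF framed_tens3[OF assms assms], of "\<lambda>(i, j, k). A i j k"] card_prod_le(2)[of "CARD('n)"]
  by (simp_all add: norm_21_def inner_21_hform sum_prod_UNIV)

lemma sum_le_form3:
  fixes H :: "complex^'n^'n::finite"
  assumes "1 \<le> b" "frame_bound b H" "frame_bound b H'"
  shows "(\<Sum>i\<in>UNIV. N1 (X i)) \<le> frame_const TYPE('n) b * sqrt (Re (form3 (ginv H) (ginv H') H X X))"
  using framed_bounds_le[where 'n = 'n, OF framed_tens3[OF assms(2,3)] b_prod_le(2)[OF assms(1)], of "\<lambda>(i, j, k). X i $ j $ k"]
    card_prod_le(2)[of "CARD('n)"]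
  by (simp add: form3_hform sum_prod_UNIV N1_def)

lemma form3_nonneg:
  fixes H :: "complex^'n^'n::finite"
  assumes "frame_bound b H" "frame_bound b H'"
  shows "0 \<le> Re (form3 (ginv H) (ginv H') H X X)"
  using framed_bounds(1)[OF framed_tens3[OF assms]] by (simp add: form3_hform)

lemma sum_le_norm_d_11:
  fixes H :: "complex^'n^'n::finite"
  assumes "1 \<le> b" "frame_bound b H"
  shows "(\<Sum>a\<in>UNIV. \<Sum>r\<in>UNIV. \<Sum>s\<in>UNIV. cmod (A a r s)) \<le> frame_const TYPE('n) b * norm_d_11 H A"
  using framed_bounds_le[where 'n = 'n, OF framed_tensor[OF framed_metric(2)[OF assms(2)]
      framed_tensor[OF framed_metric(2,3)[OF assms(2)]]] b_prod_le(2)[OF assms(1)],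
      of "\<lambda>(a, r, s). A a r s"] card_prod_le(2)[of "CARD('n)"]
  by (simp add: norm_d_11_def inner_11_hform sum_prod_UNIV hform_tensor[of "\<lambda>i m. ginv H $ m $ i" "tensor _ _"])

text \<open>The frame shows that the radicand is nonnegative. This identifies the squared norm with
  the sum subtracted in \<open>S_evolution\<close>.\<close>

lemma norm_d_21_sq:
  fixes H :: "complex^'n^'n::finite"
  assumes "frame_bound b H"
  shows "(norm_d_21 H B)\<^sup>2 =
      Re (\<Sum>a\<in>UNIV. \<Sum>b\<in>UNIV. ginv H $ b $ a * inner_21 H (B a) (B b))"
  using framed_bounds(1)[OF framed_tensor[OF framed_metric(2)[OF assms] framed_tens3[OF assms assms]],
      of "\<lambda>(a, i, j, k). B a i j k"]
  by (simp add: norm_d_21_def inner_21_hform hform_tensor[of "\<lambda>i m. ginv H $ m $ i" "tens3 _ _ _"])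

lemma
  fixes H :: "complex^'n^'n::finite"
  assumes "frame_bound b H"
  shows norm_dbar_21_sq: "(norm_dbar_21 H B)\<^sup>2 =
      Re (\<Sum>a\<in>UNIV. \<Sum>b\<in>UNIV. ginv H $ a $ b * inner_21 H (B a) (B b))"
    and sum_le_norm_dbar_21: "1 \<le> b \<Longrightarrow>
      (\<Sum>a\<in>UNIV. \<Sum>i\<in>UNIV. \<Sum>j\<in>UNIV. \<Sum>k\<in>UNIV. cmod (B a i j k)) \<le> frame_const TYPE('n) b * norm_dbar_21 H B"
  using framed_bounds(1)[OF framed_tensor[OF framed_metric(3)[OF assms] framed_tens3[OF assms assms]],
      of "\<lambda>(a, i, j, k). B a i j k"]
    framed_bounds_le[where 'n = 'n, OF framed_tensor[OF framed_metric(3)[OF assms] framed_tens3[OF assms assms]]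
      b_prod_le(3), of "\<lambda>(a, i, j, k). B a i j k"] card_prod_le(3)[of "CARD('n)"]
  by (simp_all add: norm_dbar_21_def inner_21_hform sum_prod_UNIV
      hform_tensor[of "\<lambda>s q. ginv H $ s $ q" "tens3 _ _ _"])

lemma norm_d_21_nonneg:
  assumes "frame_bound b H"
  shows "0 \<le> norm_d_21 H B"
  using framed_bounds(1)[OF framed_tensor[OF framed_metric(2)[OF assms] framed_tens3[OF assms assms]],
      of "\<lambda>(a, i, j, k). B a i j k"]
  by (simp add: norm_d_21_def inner_21_hform hform_tensor[of "\<lambda>i m. ginv H $ m $ i" "tens3 _ _ _"])

lemma norm_dbar_21_nonneg:
  assumes "frame_bound b H"
  shows "0 \<le> norm_dbar_21 H B"
  using framed_bounds(1)[OF framed_tensor[OF framed_metric(3)[OF assms] framed_tens3[OF assms assms]],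
      of "\<lambda>(a, i, j, k). B a i j k"]
  by (simp add: norm_dbar_21_def inner_21_hform hform_tensor[of "\<lambda>s q. ginv H $ s $ q" "tens3 _ _ _"])

section \<open>Uniform frames for comparable metrics\<close>

lemma herm_form_frame:
  "herm_form (P ** adj P) v = (\<Sum>k\<in>UNIV. (cmod (\<Sum>r\<in>UNIV. v $ r * P $ r $ k))\<^sup>2)"
proof -
  have "(\<Sum>r\<in>UNIV. \<Sum>s\<in>UNIV. (P ** adj P) $ r $ s * v $ r * cnj (v $ s))
     = (\<Sum>r\<in>UNIV. \<Sum>s\<in>UNIV. \<Sum>k\<in>UNIV. (v $ r * P $ r $ k) * cnj (v $ s * P $ s $ k))"
    unfolding matrix_mult_nth by (simp add: sum_distrib_left sum_distrib_right algebra_simps)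
  also have "\<dots> = (\<Sum>r\<in>UNIV. \<Sum>k\<in>UNIV. \<Sum>s\<in>UNIV. (v $ r * P $ r $ k) * cnj (v $ s * P $ s $ k))"
    by (intro sum.cong refl sum.swap)
  also have "\<dots> = (\<Sum>k\<in>UNIV. \<Sum>r\<in>UNIV. \<Sum>s\<in>UNIV. (v $ r * P $ r $ k) * cnj (v $ s * P $ s $ k))"
    by (rule sum.swap)
  also have "\<dots> = (\<Sum>k\<in>UNIV. of_real ((cmod (\<Sum>r\<in>UNIV. v $ r * P $ r $ k))\<^sup>2))"
    by (simp add: complex_norm_square cnj_sum sum_product flip: of_real_power)
  finally show ?thesis by (simp add: herm_form_def)
qed

text \<open>Diagonal entries of \<open>P ** adj P\<close> and of \<open>adj Q ** Q\<close> are sums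
  of squares of the entries of a row of \<open>P\<close> or a column of \<open>Q\<close>.\<close>

lemma frame_entries:
  fixes P Q :: "complex^'n^'n::finite"
  assumes "P ** Q = mat 1" "Q ** P = mat 1"
  shows "(cmod (P $ r $ k))\<^sup>2 \<le> N1 (P ** adj P)" "(cmod (Q $ k $ r))\<^sup>2 \<le> N1 (ginv (P ** adj P))"
proof -
  have "(cmod (P $ r $ k))\<^sup>2 \<le> (\<Sum>k\<in>UNIV. (cmod (P $ r $ k))\<^sup>2)"
    by (rule member_le_sum) auto
  also have "\<dots> = cmod ((P ** adj P) $ r $ r)"
  proof -
    have "(P ** adj P) $ r $ r = of_real (\<Sum>k\<in>UNIV. (cmod (P $ r $ k))\<^sup>2)"
      unfolding matrix_mult_nth adj_nth of_real_sum complex_norm_square ..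
    then show ?thesis by (simp only: norm_of_real) (simp add: sum_nonneg)
  qed
  also have "\<dots> \<le> N1 (P ** adj P)" by (rule entry_le_N1)
  finally show "(cmod (P $ r $ k))\<^sup>2 \<le> N1 (P ** adj P)" .
  have "(cmod (Q $ k $ r))\<^sup>2 \<le> (\<Sum>k\<in>UNIV. (cmod (Q $ k $ r))\<^sup>2)"
    by (rule member_le_sum[where f="\<lambda>k. (cmod (Q $ k $ r))\<^sup>2"]) auto
  also have "\<dots> = cmod ((adj Q ** Q) $ r $ r)"
  proof -
    have "(adj Q ** Q) $ r $ r = of_real (\<Sum>k\<in>UNIV. (cmod (Q $ k $ r))\<^sup>2)"
      unfolding matrix_mult_nth adj_nth of_real_sum complex_norm_square by (simp only: mult.commute)
    then show ?thesis by (simp only: norm_of_real) (simp add: sum_nonneg)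
  qed
  also have "\<dots> \<le> N1 (adj Q ** Q)" by (rule entry_le_N1)
  finally show "(cmod (Q $ k $ r))\<^sup>2 \<le> N1 (ginv (P ** adj P))"
    unfolding frame_ginv[OF assms] .
qed

lemma le_of_sq_le:
  fixes x b :: real
  assumes "x\<^sup>2 \<le> b" "1 \<le> b"
  shows "x \<le> b"
proof (rule power2_le_imp_le)
  have "b \<le> b\<^sup>2" using assms(2) mult_left_mono[of 1 b b] by (simp add: power2_eq_square)
  then show "x\<^sup>2 \<le> b\<^sup>2" using assms(1) by linarith
qed (use assms in simp)

text \<open>The factor \<open>P\<close> is bounded by the diagonal of \<open>H\<close>, which is at
  most K times that of \<open>Hh\<close>. A row of \<open>Q\<close> has length 1 for
  \<open>H\<close>, hence squared length at most K for \<open>Hh\<close>; expanding it in the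
  bounded frame of \<open>Hh\<close> bounds its entries. The dimension factor comes from this
  expansion.\<close>

lemma frame_bound_comparable:
  fixes H Hh :: "complex^'n^'n::finite"
  assumes H: "\<And>r s. H $ s $ r = cnj (H $ r $ s)" "\<And>v. v \<noteq> 0 \<Longrightarrow> herm_form H v > 0"
    and Hh: "\<And>r s. Hh $ s $ r = cnj (Hh $ r $ s)" "\<And>v. v \<noteq> 0 \<Longrightarrow> herm_form Hh v > 0"
    and b: "1 \<le> b" "N1 Hh \<le> b" "N1 (ginv Hh) \<le> b" and "0 < K"
    and le: "\<And>v. herm_form Hh v / K \<le> herm_form H v" "\<And>v. herm_form H v \<le> K * herm_form Hh v"
  shows "frame_bound (real CARD('n) * (1 + K) * b) H" "frame_bound (real CARD('n) * (1 + K) * b) Hh"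
proof -
  let ?n = "real CARD('n)"
  have n: "1 \<le> ?n" by (simp add: Suc_leI)
  have bb: "(1 + K) * b \<le> ?n * (1 + K) * b" "b \<le> ?n * (1 + K) * b"
  proof -
    show 1: "(1 + K) * b \<le> ?n * (1 + K) * b"
      using n b \<open>0 < K\<close> mult_right_mono[OF n, of "(1 + K) * b"] by (simp add: mult.assoc)
    have "b \<le> (1 + K) * b" using b \<open>0 < K\<close> by (simp add: algebra_simps)
    then show "b \<le> ?n * (1 + K) * b" using 1 by linarith
  qed
  obtain Ph Qh :: "complex^'n^'n" where PQh: "Ph ** Qh = mat 1" "Qh ** Ph = mat 1" "Hh = Ph ** adj Ph"
    using cholesky[OF Hh] by blast
  have hb: "cmod (Ph $ i $ j) \<le> b" "cmod (Qh $ i $ j) \<le> b" for i j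
    using frame_entries(1)[OF PQh(1,2), of i j] frame_entries(2)[OF PQh(1,2), of i j] b
      le_of_sq_le[of _ b]
    unfolding PQh(3)[symmetric] by (meson order.trans)+
  have "cmod (Ph $ i $ j) \<le> ?n * (1 + K) * b \<and> cmod (Qh $ i $ j) \<le> ?n * (1 + K) * b" for i j
    using hb[of i j] bb by linarith
  then show "frame_bound (?n * (1 + K) * b) Hh"
    unfolding frame_bound_def using PQh by blast
  obtain P Q :: "complex^'n^'n" where PQ: "P ** Q = mat 1" "Q ** P = mat 1" "H = P ** adj P"
    using cholesky[OF H] by blast
  have "cmod (P $ i $ j) \<le> ?n * (1 + K) * b" for i j
  proof -
    have ax: "herm_form A (axis i 1) = Re (A $ i $ i)" for A :: "complex^'n^'n"
    proof -
      have "(\<Sum>r\<in>UNIV. \<Sum>s\<in>UNIV. A $ r $ s * axis i 1 $ r * cnj (axis i 1 $ s))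
         = (\<Sum>r\<in>UNIV. \<Sum>s\<in>UNIV. if s = i then (if r = i then A $ i $ i else 0) else 0)"
        by (intro sum.cong) (auto simp: axis_def)
      then show ?thesis by (simp add: herm_form_def)
    qed
    have "(cmod (P $ i $ j))\<^sup>2 \<le> (\<Sum>k\<in>UNIV. (cmod (P $ i $ k))\<^sup>2)"
      by (rule member_le_sum) auto
    also have "\<dots> = herm_form H (axis i 1)"
      unfolding PQ(3) herm_form_frame
    proof (intro sum.cong refl arg_cong[where f="\<lambda>x. (cmod x)\<^sup>2"])
      fix k
      have "(\<Sum>r\<in>UNIV. axis i 1 $ r * P $ r $ k) = (\<Sum>r\<in>UNIV. if r = i then P $ i $ k else 0)"
        by (intro sum.cong) (auto simp: axis_def)
      then show "P $ i $ k = (\<Sum>r\<in>UNIV. axis i 1 $ r * P $ r $ k)" by simp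
    qed
    also have "\<dots> \<le> K * herm_form Hh (axis i 1)" by (rule le(2))
    also have "\<dots> \<le> K * b"
    proof -
      have "Re (Hh $ i $ i) \<le> b" using complex_Re_le_cmod entry_le_N1 b(2) order.trans by metis
      then show ?thesis unfolding ax using \<open>0 < K\<close> by simp
    qed
    also have "\<dots> \<le> (1 + K) * b" using b by (simp add: algebra_simps)
    finally have "cmod (P $ i $ j) \<le> (1 + K) * b"
    proof (rule le_of_sq_le)
      have "0 \<le> K * b" using b \<open>0 < K\<close> by simp
      then show "1 \<le> (1 + K) * b" using b by (simp add: distrib_right)
    qed
    then show ?thesis using bb by linarith
  qed
  moreover have "cmod (Q $ i $ j) \<le> ?n * (1 + K) * b" for i j
  proof -
    define v where "v = Q $ i"
    define c where "c = (\<lambda>k. \<Sum>r\<in>UNIV. v $ r * Ph $ r $ k)"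
    have "(\<Sum>r\<in>UNIV. v $ r * P $ r $ k) = (if i = k then 1 else 0)" for k
      using arg_cong[OF PQ(2), of "\<lambda>A. A $ i $ k"] by (simp add: matrix_mult_nth v_def mat_def)
    then have "herm_form H v = (\<Sum>k\<in>UNIV. (cmod (if i = k then 1 else 0))\<^sup>2)"
      unfolding PQ(3) herm_form_frame by presburger
    also have "\<dots> = (\<Sum>k\<in>UNIV. if i = k then 1 else 0)" by (intro sum.cong) auto
    also have "\<dots> = 1" by simp
    finally have "herm_form Hh v \<le> K"
      using le(1)[of v] \<open>0 < K\<close> by (simp add: field_simps)
    then have cK: "(\<Sum>k\<in>UNIV. (cmod (c k))\<^sup>2) \<le> K"
      unfolding PQh(3) herm_form_frame c_def .
    have "(cmod (c k))\<^sup>2 \<le> 1 + K" for k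
      using member_le_sum[of k UNIV "\<lambda>k. (cmod (c k))\<^sup>2"] cK by simp
    then have c: "cmod (c k) \<le> 1 + K" for k
      using \<open>0 < K\<close> by (simp add: le_of_sq_le)
    have "v $ j = (\<Sum>k\<in>UNIV. c k * Qh $ k $ j)"
    proof -
      have "(\<Sum>k\<in>UNIV. c k * Qh $ k $ j) = (\<Sum>k\<in>UNIV. \<Sum>r\<in>UNIV. v $ r * (Ph $ r $ k * Qh $ k $ j))"
        unfolding c_def by (simp add: sum_distrib_right mult.assoc)
      also have "\<dots> = (\<Sum>r\<in>UNIV. v $ r * (Ph ** Qh) $ r $ j)"
        by (subst sum.swap) (simp add: sum_distrib_left matrix_mult_nth)
      also have "\<dots> = (\<Sum>r\<in>UNIV. if r = j then v $ j else 0)"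
        unfolding PQh(1) by (intro sum.cong) (auto simp: mat_def)
      finally show ?thesis by simp
    qed
    then have "cmod (Q $ i $ j) \<le> (\<Sum>k\<in>UNIV. cmod (c k * Qh $ k $ j))"
      unfolding v_def using norm_sum by metis
    also have "\<dots> \<le> (\<Sum>k\<in>(UNIV :: 'n set). (1 + K) * b)"
      unfolding norm_mult using c hb \<open>0 < K\<close> by (intro sum_mono mult_mono) auto
    finally show ?thesis by simp
  qed
  ultimately show "frame_bound (?n * (1 + K) * b) H"
    unfolding frame_bound_def using PQ by blast
qed

lemma frame_bound_N1:
  fixes H :: "complex^'n^'n::finite"
  assumes "frame_bound b H"
  shows "N1 H \<le> (real CARD('n) ^ 2 * b)\<^sup>2" "N1 (ginv H) \<le> (real CARD('n) ^ 2 * b)\<^sup>2"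
proof -
  obtain P Q :: "complex^'n^'n" where PQ: "P ** Q = mat 1" "Q ** P = mat 1" and H: "H = P ** adj P"
    and b: "\<And>i j. cmod (P $ i $ j) \<le> b" "\<And>i j. cmod (Q $ i $ j) \<le> b"
    using assms unfolding frame_bound_def by blast
  have "N1 A \<le> (\<Sum>r\<in>(UNIV::'n set). \<Sum>s\<in>(UNIV::'n set). b)"
    if "\<And>i j. cmod (A $ i $ j) \<le> b" for A :: "complex^'n^'n"
    unfolding N1_def using that by (intro sum_mono) auto
  then have "N1 P \<le> real CARD('n) ^ 2 * b" "N1 Q \<le> real CARD('n) ^ 2 * b"
    using b by (auto simp: power2_eq_square mult.assoc)
  then show "N1 H \<le> (real CARD('n) ^ 2 * b)\<^sup>2" "N1 (ginv H) \<le> (real CARD('n) ^ 2 * b)\<^sup>2"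
    unfolding H frame_ginv[OF PQ] power2_eq_square[of "real CARD('n) ^ 2 * b"]
    by (auto intro!: N1_mult_le simp: N1_adj)
qed

lemma norm_le_form3:
  "cmod (form3 k l H X Y) \<le> N1 k * (N1 H * N1 l * ((\<Sum>i\<in>UNIV. N1 (X i)) * (\<Sum>i\<in>UNIV. N1 (Y i))))"
proof -
  have "cmod (trace (X i ** H ** adj (Y m) ** l)) \<le> N1 (X i) * N1 H * N1 (Y m) * N1 l" for i m
    by (rule order.trans[OF trace_le_N1]) (intro N1_mult_le order.refl, simp add: N1_adj)
  then have "cmod (form3 k l H X Y) \<le> (\<Sum>i\<in>UNIV. \<Sum>m\<in>UNIV. cmod (k $ m $ i) * (N1 (X i) * N1 H * N1 (Y m) * N1 l))"
    unfolding form3_def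
    by (intro order.trans[OF norm_sum] sum_mono) (simp add: norm_mult mult_left_mono)
  also have "\<dots> \<le> N1 k * (\<Sum>i\<in>UNIV. \<Sum>m\<in>UNIV. N1 (X i) * N1 H * N1 (Y m) * N1 l)"
    by (rule weighted_double_sum_le) simp
  also have "(\<Sum>i\<in>UNIV. \<Sum>m\<in>UNIV. N1 (X i) * N1 H * N1 (Y m) * N1 l)
     = N1 H * N1 l * ((\<Sum>i\<in>UNIV. N1 (X i)) * (\<Sum>i\<in>UNIV. N1 (Y i)))"
    by (subst sum_product) (simp add: sum_distrib_left mult_ac)
  finally show ?thesis by (simp add: algebra_simps)
qed
section \<open>Differential inequalities\<close>

text \<open>Young's inequality lets the subtracted squares absorb the terms linear in D1 and D2 at
  the cost of c^2 s^2 each. Since s, s^2 and s^3 are at most 1 + s^3, the total s + 4 s^2 + 2 s^3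
  costs the factor 1 + 4 + 2 = 7.\<close>

lemma cubic_estimate:
  fixes c s D1 D2 Z A :: real
  assumes "1 \<le> c" "0 \<le> s" "0 \<le> D1" "0 \<le> D2"
    and "Z \<le> c * s * (D1 + D2 + 1 + s + s\<^sup>2)" "A \<le> c * (1 + s) * s\<^sup>2"
  shows "Z + A - D1\<^sup>2 - D2\<^sup>2 \<le> 7 * c\<^sup>2 * (1 + s ^ 3)"
proof -
  have c2: "c \<le> c\<^sup>2" using assms(1) by (simp add: power2_eq_square)
  have sq: "c * s * D \<le> c\<^sup>2 * s\<^sup>2 + D\<^sup>2" for D
  proof -
    have "0 \<le> (c * s - D / 2)\<^sup>2 + 3 / 4 * D\<^sup>2" by simp
    then show ?thesis by (simp add: power2_eq_square algebra_simps)
  qed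
  have s: "s \<le> 1 + s ^ 3" "s\<^sup>2 \<le> 1 + s ^ 3"
  proof -
    have "s \<le> 1 + s ^ 3 \<and> s\<^sup>2 \<le> 1 + s ^ 3"
    proof (cases "s \<le> 1")
      case True
      then have "s \<le> 1" "s\<^sup>2 \<le> 1" "0 \<le> s ^ 3" using assms(2) by (auto intro: power_le_one)
      then show ?thesis by linarith
    next
      case False
      then have "s ^ 1 \<le> s ^ 3" "s ^ 2 \<le> s ^ 3" by (intro power_increasing; simp)+
      then show ?thesis by simp
    qed
    then show "s \<le> 1 + s ^ 3" "s\<^sup>2 \<le> 1 + s ^ 3" by blast+
  qed
  have s3: "s * s\<^sup>2 = s ^ 3" "s * s = s\<^sup>2" by (simp_all add: power2_eq_square power3_eq_cube)
  have "Z + A - D1\<^sup>2 - D2\<^sup>2 \<le> 2 * (c\<^sup>2 * s\<^sup>2) + c * (s + 2 * s\<^sup>2 + 2 * s ^ 3)"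
  proof -
    have "c * s * (D1 + D2 + 1 + s + s\<^sup>2) = c * s * D1 + c * s * D2 + c * (s + s * s + s * s\<^sup>2)"
      by (simp add: algebra_simps)
    moreover have "c * (1 + s) * s\<^sup>2 = c * (s\<^sup>2 + s * s\<^sup>2)" by (simp add: algebra_simps)
    moreover have "c * (s + 2 * s\<^sup>2 + 2 * s ^ 3) = c * (s + s\<^sup>2 + s ^ 3) + c * (s\<^sup>2 + s ^ 3)"
      by (simp add: algebra_simps)
    ultimately show ?thesis using assms(5,6) sq[of D1] sq[of D2] unfolding s3 by linarith
  qed
  also have "\<dots> \<le> 2 * (c\<^sup>2 * s\<^sup>2) + c\<^sup>2 * (s + 2 * s\<^sup>2 + 2 * s ^ 3)"
    using mult_right_mono[OF c2, of "s + 2 * s\<^sup>2 + 2 * s ^ 3"] assms(2) by simp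
  also have "\<dots> = c\<^sup>2 * (s + 4 * s\<^sup>2 + 2 * s ^ 3)" by (simp add: algebra_simps)
  also have "\<dots> \<le> c\<^sup>2 * (7 * (1 + s ^ 3))"
    using s assms(2) by (intro mult_left_mono) auto
  finally show ?thesis by (simp only: mult.assoc mult.left_commute)
qed

text \<open>For s at least 1 each of the four powers on the right is at most s^3, and dividing by
  s^3 leaves a linear inequality.\<close>

lemma quartic_bound:
  fixes s :: real
  assumes "0 \<le> s" "0 < \<epsilon>" "0 \<le> A"
    and "\<epsilon> * s ^ 4 \<le> A * (1 + s + s\<^sup>2 + s ^ 3)"
  shows "s \<le> 1 + 4 * A / \<epsilon>"
proof (cases "s \<le> 1")
  case True
  moreover have "0 \<le> 4 * A / \<epsilon>" using assms by simp
  ultimately show ?thesis by linarith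
next
  case False
  then have "s ^ 0 \<le> s ^ 3" "s ^ 1 \<le> s ^ 3" "s ^ 2 \<le> s ^ 3" by (intro power_increasing; simp)+
  then have "A * (1 + s + s\<^sup>2 + s ^ 3) \<le> A * (4 * s ^ 3)"
    using assms(3) by (intro mult_left_mono) auto
  then have "(\<epsilon> * s) * s ^ 3 \<le> (4 * A) * s ^ 3"
    using assms(4) by (simp add: eval_nat_numeral mult_ac)
  then have "\<epsilon> * s \<le> 4 * A" using False by simp
  then show ?thesis using assms(2) by (simp add: field_simps)
qed

section \<open>Bounds for the evolution equations in terms of |Psi| and its derivatives\<close>

context evolving_metric
begin

lemma N1_tr_g: "N1 (tr_g A y) \<le> N1 (ginv (G y)) * (\<Sum>a\<in>UNIV. \<Sum>b\<in>UNIV. N1 (A b a))"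
proof -
  have "N1 (tr_g A y) \<le> (\<Sum>a\<in>UNIV. \<Sum>b\<in>UNIV. cmod (ginv (G y) $ b $ a) * N1 (A b a))"
    unfolding tr_g_def
    by (intro order.trans[OF N1_sum] sum_mono) (simp add: N1_cscale)
  also have "\<dots> \<le> N1 (ginv (G y)) * (\<Sum>a\<in>UNIV. \<Sum>b\<in>UNIV. N1 (A b a))"
    by (rule weighted_double_sum_le) simp
  finally show ?thesis .
qed

lemma cmod_trace_sum_le:
  "cmod (\<Sum>a\<in>UNIV. \<Sum>b\<in>UNIV. ginv (G y) $ b $ a * t a b)
    \<le> N1 (ginv (G y)) * (\<Sum>a\<in>UNIV. \<Sum>b\<in>UNIV. cmod (t a b))"
proof -
  have "cmod (\<Sum>a\<in>UNIV. \<Sum>b\<in>UNIV. ginv (G y) $ b $ a * t a b)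
      \<le> (\<Sum>a\<in>UNIV. \<Sum>b\<in>UNIV. cmod (ginv (G y) $ b $ a) * cmod (t a b))"
    by (intro order.trans[OF norm_sum] sum_mono) (simp add: norm_mult)
  also have "\<dots> \<le> N1 (ginv (G y)) * (\<Sum>a\<in>UNIV. \<Sum>b\<in>UNIV. cmod (t a b))"
    by (rule weighted_double_sum_le) simp
  finally show ?thesis .
qed

lemma S_real: "y \<in> W \<Longrightarrow> cnj (S y) = S y"
  by (simp add: S_def cnj_ip inv_G herm_G)

lemma u_real:
  assumes "y \<in> W"
  shows "cnj (u y) = u y"
proof -
  have "cnj (u y) = trace (adj (G y ** ginv (Gh y)))" by (simp add: u_def trace_adj)
  also have "\<dots> = trace (ginv (Gh y) ** G y)"
    using assms by (simp add: adj_mult herm_G adj_ginv hat.inv_G hat.herm_G)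
  also have "\<dots> = u y" unfolding u_def by (rule trace_mul_sym)
  finally show ?thesis .
qed

lemma wd_bar_real:
  assumes "smooth_on W f" "\<And>y. y \<in> W \<Longrightarrow> cnj (f y) = f y" "x \<in> W"
  shows "wd (bar \<xi>) f x = cnj (wd \<xi> f x)"
proof -
  have "wd (bar \<xi>) f x = wd (bar \<xi>) (\<lambda>y. cnj (f y)) x"
    by (rule wd_cong[OF _ assms(3)]) (simp add: assms(2))
  then show ?thesis by (simp add: wd_cnj assms)
qed

lemma S_form3: "S y = form3 (ginv (G y)) (ginv (G y)) (G y) (\<lambda>i. \<Psi> i y) (\<lambda>i. \<Psi> i y)"
  by (simp add: S_def ip_form3)

definition torsion_coeff :: "'n \<Rightarrow> 'n \<Rightarrow> 'n \<Rightarrow> 'e \<Rightarrow> complex" where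
  "torsion_coeff a i p y = conn G a y $ i $ p - conn G i y $ a $ p"

text \<open>\<open>s\<close> stands for \<open>|\<Psi>|\<close>, \<open>D1\<close> and \<open>D2\<close> for the norms of the two halves of its covariant
  derivative, and \<open>b\<close> bounds the geometry of \<open>Gh\<close> and enters the hypotheses of the theorem.\<close>

lemma Z_estimate:
  assumes x: "x \<in> W" and b: "1 \<le> b" and s: "0 \<le> s" "0 \<le> D1" "0 \<le> D2"
    and k: "N1 (ginv (G x)) \<le> b"
    and hat: "(\<Sum>a\<in>UNIV. N1 (conn Gh a x)) \<le> b"
      "(\<Sum>a\<in>UNIV. \<Sum>c\<in>UNIV. N1 (curv Gh c a x)) \<le> b"
      "(\<Sum>i\<in>UNIV. \<Sum>a\<in>UNIV. \<Sum>c\<in>UNIV. N1 (Md (d a) (curv Gh c i) x)) \<le> b"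
    and Psi: "(\<Sum>a\<in>UNIV. N1 (\<Psi> a x)) \<le> b * s"
    and dE: "(\<Sum>i\<in>UNIV. N1 (Md (d i) E x - conn G i x ** E x)) \<le> b * (D1 + D2 + 1 + s\<^sup>2)"
    and T: "(\<Sum>a\<in>UNIV. \<Sum>i\<in>UNIV. \<Sum>p\<in>UNIV. cmod (torsion_coeff a i p x)) \<le> b"
    and dPsi: "(\<Sum>c\<in>UNIV. \<Sum>i\<in>UNIV. N1 (Md (bar (d c)) (\<Psi> i) x)) \<le> b * D2"
  shows "(\<Sum>i\<in>UNIV. N1 (Z i x)) \<le> 6 * b ^ 3 * (D1 + D2 + 1 + s + s\<^sup>2)"
    and "(\<Sum>a\<in>UNIV. N1 (conn G a x)) \<le> b * (1 + s)"
proof -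
  let ?T = "\<lambda>c a i. \<Sum>p\<in>UNIV. torsion_coeff a i p x *\<^sub>m curv G c p x"
  have conn: "N1 (conn G a x) \<le> N1 (\<Psi> a x) + N1 (conn Gh a x)" for a
    using N1_add[of "\<Psi> a x" "conn Gh a x"] by (simp add: \<Psi>_def)
  have "(\<Sum>a\<in>UNIV. N1 (conn G a x)) \<le> (\<Sum>a\<in>UNIV. N1 (\<Psi> a x)) + (\<Sum>a\<in>UNIV. N1 (conn Gh a x))"
    using sum_mono[of UNIV, OF conn] by (simp add: sum.distrib)
  then show C: "(\<Sum>a\<in>UNIV. N1 (conn G a x)) \<le> b * (1 + s)"
    using hat(1) Psi by (simp add: algebra_simps)
  \<comment> \<open>No bound for the curvature of \<open>G\<close> is available; as the conjugate
    derivative of Psi plus a fixed term it costs D2 + 1.\<close>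
  have curv: "N1 (curv G c p x) \<le> N1 (Md (bar (d c)) (\<Psi> p) x) + N1 (curv Gh c p x)" for c p
  proof -
    have "Md (bar (d c)) (\<Psi> p) x = curv G c p x - curv Gh c p x"
      unfolding \<Psi>_def curv_def using x by (simp add: Md_diff smooth_conn)
    then show ?thesis using N1_add[of "Md (bar (d c)) (\<Psi> p) x" "curv Gh c p x"] by simp
  qed
  have F: "(\<Sum>c\<in>UNIV. \<Sum>p\<in>UNIV. N1 (curv G c p x)) \<le> b * (D2 + 1)"
  proof -
    have "(\<Sum>c\<in>UNIV. \<Sum>p\<in>UNIV. N1 (curv G c p x)) \<le>
      (\<Sum>c\<in>UNIV. \<Sum>p\<in>UNIV. N1 (Md (bar (d c)) (\<Psi> p) x)) + (\<Sum>c\<in>UNIV. \<Sum>p\<in>UNIV. N1 (curv Gh c p x))"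
      using sum_mono[of UNIV, OF sum_mono[of UNIV, OF curv]] by (simp add: sum.distrib)
    also have "(\<Sum>c\<in>UNIV. \<Sum>p\<in>UNIV. N1 (curv Gh c p x)) = (\<Sum>a\<in>UNIV. \<Sum>c\<in>UNIV. N1 (curv Gh c a x))"
      by (rule sum.swap)
    finally show ?thesis using dPsi hat(2) by (simp add: algebra_simps)
  qed
  have T': "(\<Sum>i\<in>UNIV. \<Sum>a\<in>UNIV. \<Sum>c\<in>UNIV. N1 (?T c a i)) \<le> b * (b * (D2 + 1))"
  proof -
    have "(\<Sum>c\<in>UNIV. N1 (?T c a i)) \<le> (\<Sum>p\<in>UNIV. cmod (torsion_coeff a i p x)) * (b * (D2 + 1))" for a i
    proof -
      have "(\<Sum>c\<in>UNIV. N1 (?T c a i)) \<le> (\<Sum>c\<in>UNIV. \<Sum>p\<in>UNIV. cmod (torsion_coeff a i p x) * N1 (curv G c p x))"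
        by (intro sum_mono order.trans[OF N1_sum]) (simp add: N1_cscale)
      also have "\<dots> = (\<Sum>p\<in>UNIV. cmod (torsion_coeff a i p x) * (\<Sum>c\<in>UNIV. N1 (curv G c p x)))"
        by (subst sum.swap) (simp add: sum_distrib_left)
      also have "\<dots> \<le> (\<Sum>p\<in>UNIV. cmod (torsion_coeff a i p x)) * (\<Sum>p\<in>UNIV. \<Sum>c\<in>UNIV. N1 (curv G c p x))"
        by (rule sum_mult_le) (auto intro!: sum_nonneg)
      also have "(\<Sum>p\<in>UNIV. \<Sum>c\<in>UNIV. N1 (curv G c p x)) = (\<Sum>c\<in>UNIV. \<Sum>p\<in>UNIV. N1 (curv G c p x))"
        by (rule sum.swap)
      also have "(\<Sum>p\<in>UNIV. cmod (torsion_coeff a i p x)) * (\<Sum>c\<in>UNIV. \<Sum>p\<in>UNIV. N1 (curv G c p x))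
          \<le> (\<Sum>p\<in>UNIV. cmod (torsion_coeff a i p x)) * (b * (D2 + 1))"
        by (intro mult_left_mono F sum_nonneg) simp
      finally show ?thesis .
    qed
    then have "(\<Sum>i\<in>UNIV. \<Sum>a\<in>UNIV. \<Sum>c\<in>UNIV. N1 (?T c a i)) \<le>
        (\<Sum>i\<in>UNIV. \<Sum>a\<in>UNIV. (\<Sum>p\<in>UNIV. cmod (torsion_coeff a i p x)) * (b * (D2 + 1)))"
      by (intro sum_mono)
    also have "\<dots> = (\<Sum>a\<in>UNIV. \<Sum>i\<in>UNIV. \<Sum>p\<in>UNIV. cmod (torsion_coeff a i p x)) * (b * (D2 + 1))"
      by (subst sum.swap) (simp add: sum_distrib_right)
    also have "\<dots> \<le> b * (b * (D2 + 1))"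
      using T b s by (intro mult_right_mono) auto
    finally show ?thesis .
  qed
  have A: "(\<Sum>i\<in>UNIV. \<Sum>a\<in>UNIV. \<Sum>c\<in>UNIV. N1 (act (conn G a x) (\<lambda>i. curv Gh c i x) i)) \<le> 3 * (b * (1 + s) * b)"
  proof -
    have "(\<Sum>i\<in>UNIV. \<Sum>a\<in>UNIV. \<Sum>c\<in>UNIV. N1 (act (conn G a x) (\<lambda>i. curv Gh c i x) i))
       = (\<Sum>a\<in>UNIV. \<Sum>i\<in>UNIV. \<Sum>c\<in>UNIV. N1 (act (conn G a x) (\<lambda>i. curv Gh c i x) i))"
      by (rule sum.swap)
    also have "\<dots> = (\<Sum>a\<in>UNIV. \<Sum>c\<in>UNIV. \<Sum>i\<in>UNIV. N1 (act (conn G a x) (\<lambda>i. curv Gh c i x) i))"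
      by (intro sum.cong refl sum.swap)
    also have "\<dots> \<le> (\<Sum>a\<in>UNIV. \<Sum>c\<in>UNIV. 3 * (N1 (conn G a x) * (\<Sum>i\<in>UNIV. N1 (curv Gh c i x))))"
      by (intro sum_mono sum_act_le)
    also have "\<dots> = 3 * ((\<Sum>a\<in>UNIV. N1 (conn G a x)) * (\<Sum>c\<in>UNIV. \<Sum>i\<in>UNIV. N1 (curv Gh c i x)))"
      by (subst sum_product) (simp add: sum_distrib_left)
    also have "(\<Sum>c\<in>UNIV. \<Sum>i\<in>UNIV. N1 (curv Gh c i x)) = (\<Sum>a\<in>UNIV. \<Sum>c\<in>UNIV. N1 (curv Gh c a x))"
      by (rule sum.swap)
    also have "3 * ((\<Sum>a\<in>UNIV. N1 (conn G a x)) * \<dots>) \<le> 3 * (b * (1 + s) * b)"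
      using C hat(2) b s by (intro mult_left_mono mult_mono) (auto intro!: sum_nonneg)
    finally show ?thesis .
  qed
  have nab: "(\<Sum>i\<in>UNIV. \<Sum>a\<in>UNIV. \<Sum>c\<in>UNIV. N1 (nab a (curv Gh c) i x)) \<le> b + 3 * (b * (1 + s) * b)"
  proof -
    have "(\<Sum>i\<in>UNIV. \<Sum>a\<in>UNIV. \<Sum>c\<in>UNIV. N1 (nab a (curv Gh c) i x)) \<le>
      (\<Sum>i\<in>UNIV. \<Sum>a\<in>UNIV. \<Sum>c\<in>UNIV. N1 (Md (d a) (curv Gh c i) x)
         + N1 (act (conn G a x) (\<lambda>i. curv Gh c i x) i))"
      unfolding nab_def by (intro sum_mono N1_add)
    then show ?thesis using A hat(3) by (simp add: sum.distrib)
  qed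
  have Zi: "N1 (Z i x) \<le> N1 (Md (d i) E x - conn G i x ** E x) * b
      + b * ((\<Sum>a\<in>UNIV. \<Sum>c\<in>UNIV. N1 (?T c a i)) + (\<Sum>a\<in>UNIV. \<Sum>c\<in>UNIV. N1 (nab a (curv Gh c) i x)))" for i
  proof -
    have "N1 (tr_g (\<lambda>c a. ?T c a i + nab a (curv Gh c) i x) x)
       \<le> N1 (ginv (G x)) * (\<Sum>a\<in>UNIV. \<Sum>c\<in>UNIV. N1 (?T c a i + nab a (curv Gh c) i x))"
      by (rule N1_tr_g)
    also have "\<dots> \<le> b * (\<Sum>a\<in>UNIV. \<Sum>c\<in>UNIV. N1 (?T c a i) + N1 (nab a (curv Gh c) i x))"
      using k b by (intro mult_mono sum_mono N1_add sum_nonneg) auto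
    finally have 1: "N1 (tr_g (\<lambda>c a. ?T c a i + nab a (curv Gh c) i x) x)
       \<le> b * ((\<Sum>a\<in>UNIV. \<Sum>c\<in>UNIV. N1 (?T c a i)) + (\<Sum>a\<in>UNIV. \<Sum>c\<in>UNIV. N1 (nab a (curv Gh c) i x)))"
      by (simp add: sum.distrib)
    have 2: "N1 ((Md (d i) E x - conn G i x ** E x) ** ginv (G x)) \<le> N1 (Md (d i) E x - conn G i x ** E x) * b"
      by (rule N1_mult_le[OF order.refl k])
    show ?thesis unfolding Z_def torsion_coeff_def[symmetric]
      by (rule order.trans[OF N1_add add_mono[OF 2 1]])
  qed
  have "(\<Sum>i\<in>UNIV. N1 (Z i x)) \<le> (\<Sum>i\<in>UNIV. N1 (Md (d i) E x - conn G i x ** E x)) * b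
      + b * ((\<Sum>i\<in>UNIV. \<Sum>a\<in>UNIV. \<Sum>c\<in>UNIV. N1 (?T c a i))
         + (\<Sum>i\<in>UNIV. \<Sum>a\<in>UNIV. \<Sum>c\<in>UNIV. N1 (nab a (curv Gh c) i x)))"
    using sum_mono[of UNIV, OF Zi] by (simp add: sum.distrib sum_distrib_left sum_distrib_right distrib_left)
  also have "\<dots> \<le> (b * (D1 + D2 + 1 + s\<^sup>2)) * b + b * (b * (b * (D2 + 1)) + (b + 3 * (b * (1 + s) * b)))"
    using dE T' nab b by (intro add_mono mult_right_mono mult_left_mono) auto
  also have "\<dots> = b\<^sup>2 * (D1 + D2 + 2 + s\<^sup>2) + b ^ 3 * (D2 + 4 + 3 * s)"
    by (simp add: power2_eq_square power3_eq_cube algebra_simps)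
  also have "\<dots> \<le> b ^ 3 * (D1 + D2 + 2 + s\<^sup>2) + b ^ 3 * (D2 + 4 + 3 * s)"
    using s by (intro add_mono mult_right_mono power_increasing b) auto
  also have "\<dots> = b ^ 3 * (D1 + 2 * D2 + 6 + 3 * s + s\<^sup>2)" by (simp add: algebra_simps)
  \<comment> \<open>6 is the largest of the coefficients 1, 2, 6, 3, 1.\<close>
  also have "\<dots> \<le> b ^ 3 * (6 * (D1 + D2 + 1 + s + s\<^sup>2))"
    using s b by (intro mult_left_mono) auto
  finally show "(\<Sum>i\<in>UNIV. N1 (Z i x)) \<le> 6 * b ^ 3 * (D1 + D2 + 1 + s + s\<^sup>2)"
    by (simp only: mult.assoc mult.left_commute)
qed

text \<open>Every inner product costs b^3 for its three metric factors. Collecting powers gives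
  \<open>cubic_estimate\<close> with c = 12 b^7, where 12 = 6 + 6 comes from the two terms with
  \<open>Z\<close>; then 7 * 12^2 = 1008.\<close>

lemma S_estimate:
  assumes x: "x \<in> W" and b: "1 \<le> b" and s: "0 \<le> s" "0 \<le> D1" "0 \<le> D2"
    and k: "N1 (ginv (G x)) \<le> b" "N1 (G x) \<le> b"
    and Psi: "(\<Sum>a\<in>UNIV. N1 (\<Psi> a x)) \<le> b * s"
    and E: "N1 (E x) \<le> b * (1 + s)"
    and Z: "(\<Sum>i\<in>UNIV. N1 (Z i x)) \<le> 6 * b ^ 3 * (D1 + D2 + 1 + s + s\<^sup>2)"
    and D1: "Re (\<Sum>a\<in>UNIV. \<Sum>b\<in>UNIV. ginv (G x) $ b $ a *
        ip (G x) (\<lambda>i. nab a \<Psi> i x) (\<lambda>i. nab b \<Psi> i x)) = D1\<^sup>2"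
    and D2: "Re (\<Sum>a\<in>UNIV. \<Sum>b\<in>UNIV. ginv (G x) $ b $ a *
        ip (G x) (\<lambda>i. Md (bar (d b)) (\<Psi> i) x) (\<lambda>i. Md (bar (d a)) (\<Psi> i) x)) = D2\<^sup>2"
  shows "Re (wd \<tau> S x - lap S x) \<le> 1008 * b ^ 14 * (1 + s ^ 3)"
proof -
  let ?P = "\<lambda>i. \<Psi> i x"
  have ipb: "cmod (ip (G x) X Y) \<le> b ^ 3 * (p * q)"
    if "(\<Sum>i\<in>UNIV. N1 (X i)) \<le> p" "(\<Sum>i\<in>UNIV. N1 (Y i)) \<le> q" for X Y p q
  proof -
    have nn: "0 \<le> (\<Sum>i\<in>UNIV. N1 (X i))" "0 \<le> (\<Sum>i\<in>UNIV. N1 (Y i))" by (auto intro!: sum_nonneg)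
    have "cmod (ip (G x) X Y) \<le> b * (b * b * (p * q))"
      unfolding ip_form3
      by (rule order.trans[OF norm_le_form3])
        (use k b that nn in \<open>intro mult_mono mult_nonneg_nonneg\<close>, auto)
    then show ?thesis by (simp add: power3_eq_cube mult.assoc)
  qed
  have 1: "cmod (ip (G x) (\<lambda>i. Z i x) ?P) \<le> b ^ 3 * (6 * b ^ 3 * (D1 + D2 + 1 + s + s\<^sup>2) * (b * s))"
    by (rule ipb[OF Z Psi])
  have 2: "cmod (ip (G x) ?P (\<lambda>i. Z i x)) \<le> b ^ 3 * (b * s * (6 * b ^ 3 * (D1 + D2 + 1 + s + s\<^sup>2)))"
    by (rule ipb[OF Psi Z])
  have "(\<Sum>i\<in>UNIV. N1 (act (E x ** ginv (G x)) ?P i)) \<le> 3 * (b * (1 + s) * b * (b * s))"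
    using b s Psi N1_mult_le[OF E k(1)]
    by (intro order.trans[OF sum_act_le] mult_left_mono mult_mono) (auto intro!: sum_nonneg)
  from ipb[OF this Psi]
  have 3: "cmod (ip (G x) (act (E x ** ginv (G x)) ?P) ?P) \<le> b ^ 3 * (3 * (b * (1 + s) * b * (b * s)) * (b * s))" .
  have "Re (wd \<tau> S x - lap S x) = Re (ip (G x) (\<lambda>i. Z i x) ?P) + Re (ip (G x) ?P (\<lambda>i. Z i x))
      + Re (ip (G x) (act (E x ** ginv (G x)) ?P) ?P) - D1\<^sup>2 - D2\<^sup>2"
    unfolding S_evolution[OF x] minus_complex.sel plus_complex.sel D1 D2 ..
  also have "\<dots> \<le> 12 * b ^ 7 * s * (D1 + D2 + 1 + s + s\<^sup>2) + 3 * b ^ 7 * (1 + s) * s\<^sup>2 - D1\<^sup>2 - D2\<^sup>2"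
  proof -
    have "b ^ 3 * (6 * b ^ 3 * (D1 + D2 + 1 + s + s\<^sup>2) * (b * s)) + b ^ 3 * (b * s * (6 * b ^ 3 * (D1 + D2 + 1 + s + s\<^sup>2)))
       = 12 * b ^ 7 * s * (D1 + D2 + 1 + s + s\<^sup>2)"
      by (simp add: eval_nat_numeral algebra_simps)
    moreover have "b ^ 3 * (3 * (b * (1 + s) * b * (b * s)) * (b * s)) = 3 * b ^ 7 * (1 + s) * s\<^sup>2"
      by (simp add: eval_nat_numeral algebra_simps)
    ultimately show ?thesis
      using 1 2 3 complex_Re_le_cmod[of "ip (G x) (\<lambda>i. Z i x) ?P"]
        complex_Re_le_cmod[of "ip (G x) ?P (\<lambda>i. Z i x)"]
        complex_Re_le_cmod[of "ip (G x) (act (E x ** ginv (G x)) ?P) ?P"] by linarith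
  qed
  also have "\<dots> \<le> 7 * (12 * b ^ 7)\<^sup>2 * (1 + s ^ 3)"
  proof (rule cubic_estimate)
    show "1 \<le> 12 * b ^ 7" using one_le_power[OF b, of 7] by linarith
    show "3 * b ^ 7 * (1 + s) * s\<^sup>2 \<le> 12 * b ^ 7 * (1 + s) * s\<^sup>2"
      using b s by (intro mult_right_mono) auto
  qed (use s in auto)
  also have "\<dots> = 1008 * b ^ 14 * (1 + s ^ 3)"
    by (simp add: power_mult_distrib flip: power_mult)
  finally show ?thesis .
qed

text \<open>Splitting the connection into Psi plus the fixed connection turns the quadratic term
  into the mixed form of Psi, at least s^2 / b by \<open>low\<close>, plus terms at most linear in
  s. The gradient bound is prepared for the first order terms of the product with S.\<close>

lemma u_estimate:
  assumes x: "x \<in> W" and b: "1 \<le> b" and s: "0 \<le> s"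
    and k: "N1 (ginv (G x)) \<le> b" "N1 (G x) \<le> b" "N1 (ginv (Gh x)) \<le> b"
    and hat: "(\<Sum>a\<in>UNIV. N1 (conn Gh a x)) \<le> b"
      "(\<Sum>a\<in>UNIV. N1 (Md (d a) (\<lambda>y. ginv (Gh y)) x)) \<le> b"
      "(\<Sum>a\<in>UNIV. N1 (Md (bar (d a)) (\<lambda>y. ginv (Gh y)) x)) \<le> b"
      "(\<Sum>a\<in>UNIV. \<Sum>c\<in>UNIV. N1 (Md (bar (d c)) (Md (d a) (\<lambda>y. ginv (Gh y))) x)) \<le> b"
    and Psi: "(\<Sum>a\<in>UNIV. N1 (\<Psi> a x)) \<le> b * s"
    and conn: "(\<Sum>a\<in>UNIV. N1 (conn G a x)) \<le> b * (1 + s)"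
    and E: "N1 (E x) \<le> b * (1 + s)"
    and low: "s\<^sup>2 / b \<le> Re (form3 (ginv (G x)) (ginv (Gh x)) (G x) (\<lambda>i. \<Psi> i x) (\<lambda>i. \<Psi> i x))"
  shows "Re (wd \<tau> u x - lap u x) \<le> 6 * b ^ 5 * (1 + s) - s\<^sup>2 / b"
    and "(\<Sum>a\<in>UNIV. cmod (wd (d a) u x)) \<le> 2 * b ^ 3 * (1 + s)"
proof -
  define L where "L = (\<lambda>y. ginv (Gh y))"
  have kL: "N1 (L x) \<le> b" using k(3) by (simp add: L_def)
  note hat' = hat[folded L_def]
  have uL: "u = (\<lambda>y. trace (G y ** L y))" by (simp add: fun_eq_iff u_def L_def)
  have sL: "msmooth W L" unfolding L_def by (rule hat.smooth_ginv)
  let ?f = "form3 (ginv (G x)) (L x) (G x)" and ?P = "\<lambda>i. \<Psi> i x" and ?h = "\<lambda>i. conn Gh i x"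
  have f: "cmod (?f X Y) \<le> b ^ 3 * (p * q)"
    if "(\<Sum>i\<in>UNIV. N1 (X i)) \<le> p" "(\<Sum>i\<in>UNIV. N1 (Y i)) \<le> q" for X Y p q
  proof -
    have nn: "0 \<le> (\<Sum>i\<in>UNIV. N1 (X i))" "0 \<le> (\<Sum>i\<in>UNIV. N1 (Y i))" by (auto intro!: sum_nonneg)
    have "cmod (?f X Y) \<le> b * (b * b * (p * q))"
      by (rule order.trans[OF norm_le_form3])
        (use k kL b that nn in \<open>intro mult_mono mult_nonneg_nonneg\<close>, auto)
    then show ?thesis by (simp add: power3_eq_cube mult.assoc)
  qed
  have "conn G a x = \<Psi> a x + conn Gh a x" for a by (simp add: \<Psi>_def)
  then have f1: "?f (\<lambda>a. conn G a x) (\<lambda>a. conn G a x) = ?f ?P ?P + ?f ?P ?h + ?f ?h ?P + ?f ?h ?h"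
    unfolding form3_def
    by (simp add: matrix_algebra adj_add trace_add sum.distrib distrib_left)
  have tr3: "cmod (trace (A ** B ** C)) \<le> N1 A * N1 B * N1 C" for A B C :: "complex^'n^'n"
    by (intro order.trans[OF trace_le_N1] N1_mult_le order.refl)
  have t2: "(\<Sum>a\<in>UNIV. \<Sum>c\<in>UNIV. cmod (trace (conn G a x ** G x ** Md (bar (d c)) L x))) \<le> b * (1 + s) * b * b"
  proof -
    have "(\<Sum>a\<in>UNIV. \<Sum>c\<in>UNIV. cmod (trace (conn G a x ** G x ** Md (bar (d c)) L x)))
      \<le> (\<Sum>a\<in>UNIV. \<Sum>c\<in>UNIV. N1 (conn G a x) * N1 (G x) * N1 (Md (bar (d c)) L x))"
      by (intro sum_mono tr3)
    also have "\<dots> = (\<Sum>a\<in>UNIV. N1 (conn G a x)) * N1 (G x) * (\<Sum>c\<in>UNIV. N1 (Md (bar (d c)) L x))"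
      unfolding sum_distrib_right[of "\<lambda>a. N1 (conn G a x)"] sum_product ..
    also have "\<dots> \<le> b * (1 + s) * b * b"
      using conn k(2) hat'(3) b s by (intro mult_mono mult_nonneg_nonneg) (auto intro!: sum_nonneg)
    finally show ?thesis .
  qed
  have t3: "(\<Sum>a\<in>UNIV. \<Sum>c\<in>UNIV. cmod (trace (G x ** adj (conn G c x) ** Md (d a) L x))) \<le> b * (b * (1 + s)) * b"
  proof -
    have "(\<Sum>a\<in>UNIV. \<Sum>c\<in>UNIV. cmod (trace (G x ** adj (conn G c x) ** Md (d a) L x)))
      \<le> (\<Sum>a\<in>UNIV. \<Sum>c\<in>UNIV. N1 (G x) * N1 (conn G c x) * N1 (Md (d a) L x))"
      using tr3[of "G x" "adj (conn G _ x)"] by (intro sum_mono) (simp add: N1_adj)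
    also have "\<dots> = N1 (G x) * (\<Sum>c\<in>UNIV. N1 (conn G c x)) * (\<Sum>a\<in>UNIV. N1 (Md (d a) L x))"
      unfolding sum_distrib_left[of _ "\<lambda>c. N1 (conn G c x)"] sum_product by (rule sum.swap)
    also have "\<dots> \<le> b * (b * (1 + s)) * b"
      using conn k(2) hat'(2) b s by (intro mult_mono mult_nonneg_nonneg) (auto intro!: sum_nonneg)
    finally show ?thesis .
  qed
  have t4: "(\<Sum>a\<in>UNIV. \<Sum>c\<in>UNIV. cmod (trace (G x ** Md (bar (d c)) (Md (d a) L) x))) \<le> b * b"
  proof -
    have "(\<Sum>a\<in>UNIV. \<Sum>c\<in>UNIV. cmod (trace (G x ** Md (bar (d c)) (Md (d a) L) x)))
      \<le> (\<Sum>a\<in>UNIV. \<Sum>c\<in>UNIV. N1 (G x) * N1 (Md (bar (d c)) (Md (d a) L) x))"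
      by (intro sum_mono order.trans[OF trace_le_N1] N1_mult)
    also have "\<dots> = N1 (G x) * (\<Sum>a\<in>UNIV. \<Sum>c\<in>UNIV. N1 (Md (bar (d c)) (Md (d a) L) x))"
      by (simp add: sum_distrib_left)
    also have "\<dots> \<le> b * b"
      using k(2) hat'(4) b by (intro mult_mono) (auto intro!: sum_nonneg)
    finally show ?thesis .
  qed
  let ?t = "\<lambda>a c. trace (conn G a x ** G x ** Md (bar (d c)) L x)
         + trace (G x ** adj (conn G c x) ** Md (d a) L x) + trace (G x ** Md (bar (d c)) (Md (d a) L) x)"
  have "(\<Sum>a\<in>UNIV. \<Sum>c\<in>UNIV. cmod (?t a c)) \<le> b * (1 + s) * b * b + b * (b * (1 + s)) * b + b * b"
  proof -
    have "(\<Sum>a\<in>UNIV. \<Sum>c\<in>UNIV. cmod (?t a c)) \<le>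
       (\<Sum>a\<in>UNIV. \<Sum>c\<in>UNIV. cmod (trace (conn G a x ** G x ** Md (bar (d c)) L x))
         + cmod (trace (G x ** adj (conn G c x) ** Md (d a) L x)) + cmod (trace (G x ** Md (bar (d c)) (Md (d a) L) x)))"
      by (intro sum_mono order.trans[OF norm_triangle_ineq] add_mono norm_triangle_ineq order.refl)
    then show ?thesis using t2 t3 t4 unfolding sum.distrib by linarith
  qed
  then have t: "cmod (\<Sum>a\<in>UNIV. \<Sum>c\<in>UNIV. ginv (G x) $ c $ a * ?t a c)
      \<le> b * (b * (1 + s) * b * b + b * (b * (1 + s)) * b + b * b)"
    using k(1) b by (intro order.trans[OF cmod_trace_sum_le] mult_mono) (auto intro!: sum_nonneg)
  have "wd \<tau> u x - lap u x = trace (E x ** L x) - ?f (\<lambda>a. conn G a x) (\<lambda>a. conn G a x)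
     - (\<Sum>a\<in>UNIV. \<Sum>c\<in>UNIV. ginv (G x) $ c $ a * ?t a c)"
    unfolding u_evolution[OF x] form3_def L_def
    by (simp add: distrib_left sum.distrib)
  then have "Re (wd \<tau> u x - lap u x) = Re (trace (E x ** L x)) - Re (?f ?P ?P) - Re (?f ?P ?h) - Re (?f ?h ?P)
     - Re (?f ?h ?h) - Re (\<Sum>a\<in>UNIV. \<Sum>c\<in>UNIV. ginv (G x) $ c $ a * ?t a c)"
    unfolding f1 by (simp only: minus_complex.sel plus_complex.sel diff_diff_eq add.assoc)
  also have "\<dots> \<le> b * (1 + s) * b - s\<^sup>2 / b + b ^ 3 * (b * s * b) + b ^ 3 * (b * (b * s)) + b ^ 3 * (b * b)
      + b * (b * (1 + s) * b * b + b * (b * (1 + s)) * b + b * b)"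
  proof -
    have "Re (trace (E x ** L x)) \<le> b * (1 + s) * b"
      using complex_Re_le_cmod trace_le_N1 N1_mult_le[OF E kL] order.trans by meson
    moreover have "\<bar>Re (?f ?P ?h)\<bar> \<le> b ^ 3 * (b * s * b)" "\<bar>Re (?f ?h ?P)\<bar> \<le> b ^ 3 * (b * (b * s))"
      "\<bar>Re (?f ?h ?h)\<bar> \<le> b ^ 3 * (b * b)"
      using f[OF Psi hat(1)] f[OF hat(1) Psi] f[OF hat(1) hat(1)] abs_Re_le_cmod order.trans by blast+
    moreover have "\<bar>Re (\<Sum>a\<in>UNIV. \<Sum>c\<in>UNIV. ginv (G x) $ c $ a * ?t a c)\<bar>
       \<le> b * (b * (1 + s) * b * b + b * (b * (1 + s)) * b + b * b)"
      using t abs_Re_le_cmod order.trans by blast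
    ultimately show ?thesis using low unfolding L_def by linarith
  qed
  also have "\<dots> = b\<^sup>2 * (1 + s) + 2 * b ^ 5 * s + b ^ 5 + 2 * b ^ 4 * (1 + s) + b ^ 3 - s\<^sup>2 / b"
    by (simp add: eval_nat_numeral algebra_simps)
  also have "\<dots> \<le> b ^ 5 * (1 + s) + 2 * b ^ 5 * s + b ^ 5 + 2 * b ^ 5 * (1 + s) + b ^ 5 - s\<^sup>2 / b"
    using s power_increasing[of 2 5 b] power_increasing[of 4 5 b] power_increasing[of 3 5 b] b
    by (intro diff_right_mono add_mono mult_right_mono mult_left_mono) auto
  also have "\<dots> \<le> 6 * b ^ 5 * (1 + s) - s\<^sup>2 / b"
    using b s by (simp add: algebra_simps)
  finally show "Re (wd \<tau> u x - lap u x) \<le> 6 * b ^ 5 * (1 + s) - s\<^sup>2 / b" .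
  have du: "cmod (wd (d a) u x) \<le> N1 (conn G a x) * (b * b) + b * N1 (Md (d a) L x)" for a
  proof -
    have "wd (d a) u x = trace (conn G a x ** (G x ** L x) + G x ** Md (d a) L x)"
      unfolding uL using x by (simp add: wd_trace Md_mult msmooth_mult smooth_G sL Md_G matrix_mul_assoc)
    also have "cmod \<dots> \<le> N1 (conn G a x ** (G x ** L x)) + N1 (G x ** Md (d a) L x)"
      by (rule order.trans[OF trace_le_N1 N1_add])
    also have "\<dots> \<le> N1 (conn G a x) * (b * b) + b * N1 (Md (d a) L x)"
      by (intro add_mono N1_mult_le k kL order.refl)
    finally show ?thesis .
  qed
  have "(\<Sum>a\<in>UNIV. cmod (wd (d a) u x)) \<le> (\<Sum>a\<in>UNIV. N1 (conn G a x) * (b * b) + b * N1 (Md (d a) L x))"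
    by (intro sum_mono du)
  also have "\<dots> = (\<Sum>a\<in>UNIV. N1 (conn G a x)) * (b * b) + b * (\<Sum>a\<in>UNIV. N1 (Md (d a) L x))"
    by (simp add: sum.distrib sum_distrib_left sum_distrib_right)
  also have "\<dots> \<le> b * (1 + s) * (b * b) + b * b"
    using conn hat'(2) b by (intro add_mono mult_right_mono mult_left_mono) auto
  also have "\<dots> \<le> 2 * b ^ 3 * (1 + s)"
  proof -
    have "b * b \<le> b ^ 3 * (1 + s)"
      using mult_mono[of "b\<^sup>2" "b ^ 3" 1 "1 + s"] power_increasing[of 2 3 b] b s by (simp add: power2_eq_square)
    then show ?thesis by (simp add: power3_eq_cube algebra_simps)
  qed
  finally show "(\<Sum>a\<in>UNIV. cmod (wd (d a) u x)) \<le> 2 * b ^ 3 * (1 + s)" .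
qed

lemma lap_mult:
  assumes f: "smooth_on W f" "smooth_on W h" and x: "x \<in> W"
  shows "lap (\<lambda>y. f y * h y) x = lap f x * h x + f x * lap h x
    + (\<Sum>a\<in>UNIV. \<Sum>b\<in>UNIV. ginv (G x) $ b $ a *
        (wd (d a) f x * wd (bar (d b)) h x + wd (bar (d b)) f x * wd (d a) h x))"
proof -
  have 1: "wd (d a) (\<lambda>y. f y * h y) y = wd (d a) f y * h y + f y * wd (d a) h y" if "y \<in> W" for a y
    by (rule wd_mult[OF f that])
  have "wd (bar (d b)) (wd (d a) (\<lambda>y. f y * h y)) x =
     wd (bar (d b)) (\<lambda>y. wd (d a) f y * h y + f y * wd (d a) h y) x" for a b
    by (rule wd_cong[OF 1 x])
  then have 2: "wd (bar (d b)) (wd (d a) (\<lambda>y. f y * h y)) x =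
     wd (bar (d b)) (wd (d a) f) x * h x + f x * wd (bar (d b)) (wd (d a) h) x
     + (wd (d a) f x * wd (bar (d b)) h x + wd (bar (d b)) f x * wd (d a) h x)" for a b
    by (simp add: wd_add wd_mult smooth_on_mult smooth_on_wd f x)
  show ?thesis unfolding lap_def 2
    by (simp add: sum.distrib sum_distrib_left sum_distrib_right algebra_simps)
qed

text \<open>At a critical point of \<open>(\<Lambda> + u) S\<close> the gradient of \<open>S\<close> is a multiple of the gradient of
  \<open>u\<close>, so the mixed first order terms are quadratic in the latter and small for large \<open>\<Lambda>\<close>.\<close>

lemma maximum_point_estimate:
  fixes \<Lambda> :: real
  defines "q \<equiv> \<lambda>y. (of_real \<Lambda> + u y) * S y"
  assumes x: "x \<in> W" and \<Lambda>: "0 < \<Lambda>" and u0: "0 \<le> Re (u x)" and S0: "0 \<le> Re (S x)"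
    and grad: "\<And>a. wd (d a) q x = 0" and time: "0 \<le> Re (wd \<tau> q x)" and hess: "Re (lap q x) \<le> 0"
  shows "0 \<le> (\<Lambda> + Re (u x)) * Re (wd \<tau> S x - lap S x) + Re (S x) * Re (wd \<tau> u x - lap u x)
    + 2 * Re (S x) / \<Lambda> * (N1 (ginv (G x)) * (\<Sum>a\<in>UNIV. cmod (wd (d a) u x))\<^sup>2)"
proof -
  define v where "v = (\<lambda>y. of_real \<Lambda> + u y)"
  have sv: "smooth_on W v" unfolding v_def by (intro smooth_on_add smooth_on_const smooth_u)
  have q: "q = (\<lambda>y. v y * S y)" by (simp add: q_def v_def)
  have wv: "wd \<xi> v y = wd \<xi> u y" if "y \<in> W" for \<xi> y
    unfolding v_def using that by (simp add: wd_add smooth_u)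
  have lv: "lap v x = lap u x"
    unfolding lap_def using wd_cong[OF wv x] by simp
  define \<sigma> where "\<sigma> = Re (S x)"
  have ux: "u x = of_real (Re (u x))" and Sx: "S x = of_real \<sigma>"
    using u_real[OF x] S_real[OF x] unfolding \<sigma>_def by (metis Reals_cnj_iff of_real_Re)+
  have vx: "v x = of_real (\<Lambda> + Re (u x))" unfolding of_real_add ux[symmetric] by (simp add: v_def)
  define r where "r = \<Lambda> + Re (u x)"
  have r: "0 < r" "\<Lambda> \<le> r" using \<Lambda> u0 by (auto simp: r_def)
  let ?U = "\<Sum>a\<in>UNIV. \<Sum>b\<in>UNIV. ginv (G x) $ b $ a * (wd (d a) u x * wd (bar (d b)) u x)"
  have gS: "wd (d a) S x = - (of_real (Re (S x) / r) * wd (d a) u x)" for a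
  proof -
    have "0 = wd (d a) u x * S x + v x * wd (d a) S x"
      using grad[of a] unfolding q wd_mult[OF sv smooth_S x] wv[OF x] by simp
    then have "of_real r * wd (d a) S x = - (wd (d a) u x * of_real \<sigma>)"
      unfolding vx r_def[symmetric] by (simp add: Sx eq_neg_iff_add_eq_0 add.commute)
    then show ?thesis using r by (simp add: Sx field_simps)
  qed
  have gS': "wd (bar (d b)) S x = - (of_real (Re (S x) / r) * wd (bar (d b)) u x)" for b
    using gS[of b] wd_bar_real[OF smooth_S S_real x, of "d b"] wd_bar_real[OF smooth_u u_real x, of "d b"] by simp
  have "(\<Sum>a\<in>UNIV. \<Sum>b\<in>UNIV. ginv (G x) $ b $ a *
        (wd (d a) v x * wd (bar (d b)) S x + wd (bar (d b)) v x * wd (d a) S x))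
      = of_real (- 2 * (Re (S x) / r)) * ?U"
    unfolding wv[OF x] gS gS' sum_distrib_left by (intro sum.cong refl) (simp add: algebra_simps)
  then have "lap q x = lap u x * S x + v x * lap S x + of_real (- 2 * (Re (S x) / r)) * ?U"
    unfolding q lap_mult[OF sv smooth_S x] lv by simp
  moreover have "wd \<tau> q x = wd \<tau> u x * S x + v x * wd \<tau> S x"
    unfolding q wd_mult[OF sv smooth_S x] wv[OF x] ..
  ultimately have eq: "wd \<tau> q x - lap q x = of_real r * (wd \<tau> S x - lap S x)
      + of_real (Re (S x)) * (wd \<tau> u x - lap u x) + of_real (2 * (Re (S x) / r)) * ?U"
    unfolding vx r_def[symmetric] by (simp add: Sx algebra_simps)
  have "Re (wd \<tau> q x - lap q x) = r * Re (wd \<tau> S x - lap S x)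
      + Re (S x) * Re (wd \<tau> u x - lap u x) + 2 * (Re (S x) / r) * Re ?U"
    unfolding eq
    by (simp only: plus_complex.sel times_complex.sel Re_complex_of_real Im_complex_of_real
        mult_zero_left diff_zero)
  moreover have "0 \<le> Re (wd \<tau> q x - lap q x)" using time hess by simp
  moreover have "2 * (Re (S x) / r) * Re ?U \<le>
      2 * Re (S x) / \<Lambda> * (N1 (ginv (G x)) * (\<Sum>a\<in>UNIV. cmod (wd (d a) u x))\<^sup>2)"
  proof -
    have "Re ?U \<le> N1 (ginv (G x)) * (\<Sum>a\<in>UNIV. \<Sum>b\<in>UNIV. cmod (wd (d a) u x * wd (bar (d b)) u x))"
      by (rule order.trans[OF complex_Re_le_cmod cmod_trace_sum_le])
    also have "(\<Sum>a\<in>UNIV. \<Sum>b\<in>UNIV. cmod (wd (d a) u x * wd (bar (d b)) u x)) = (\<Sum>a\<in>UNIV. cmod (wd (d a) u x))\<^sup>2"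
      by (simp add: wd_bar_real[OF smooth_u u_real x] norm_mult power2_eq_square sum_product)
    finally have U: "Re ?U \<le> N1 (ginv (G x)) * (\<Sum>a\<in>UNIV. cmod (wd (d a) u x))\<^sup>2" .
    have "2 * (Re (S x) / r) \<le> 2 * Re (S x) / \<Lambda>"
      using r \<Lambda> S0 by (simp add: frac_le)
    then have "2 * (Re (S x) / r) * (N1 (ginv (G x)) * (\<Sum>a\<in>UNIV. cmod (wd (d a) u x))\<^sup>2)
       \<le> 2 * Re (S x) / \<Lambda> * (N1 (ginv (G x)) * (\<Sum>a\<in>UNIV. cmod (wd (d a) u x))\<^sup>2)"
      by (intro mult_right_mono) auto
    moreover have "2 * (Re (S x) / r) * Re ?U \<le> 2 * (Re (S x) / r) * (N1 (ginv (G x)) * (\<Sum>a\<in>UNIV. cmod (wd (d a) u x))\<^sup>2)"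
      using r S0 U by (intro mult_left_mono) auto
    ultimately show ?thesis by linarith
  qed
  ultimately show ?thesis unfolding r_def by linarith
qed

end

text \<open>Chosen so that the gradient term of \<open>maximum_point_estimate\<close> is absorbed by half of the
  good term \<open>- s\<^sup>4 / b\<close>.\<close>

definition lambda_const :: "real \<Rightarrow> real" where
  "lambda_const b = 32 * b ^ 8"

text \<open>Here r stands for Lambda + u and V for the size of the gradient of u. Half of s^4 / b
  remains after the gradient term is absorbed, and it dominates powers up to s^3; hence
  \<open>quartic_bound\<close> with 1 / (2 b) as leading coefficient.\<close>

lemma maximum_point_bound:
  fixes b s r :: real
  assumes b: "1 \<le> b" and s: "0 \<le> s" and r: "0 \<le> r" "r \<le> R"
    and S: "P \<le> 1008 * b ^ 14 * (1 + s ^ 3)" and u: "Q \<le> 6 * b ^ 5 * (1 + s) - s\<^sup>2 / b"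
    and V: "0 \<le> V" "V \<le> 2 * b ^ 3 * (1 + s)" and k: "0 \<le> k" "k \<le> b"
    and le: "0 \<le> r * P + s\<^sup>2 * Q + 2 * s\<^sup>2 / lambda_const b * (k * V\<^sup>2)"
  shows "s \<le> 1 + 4 * (R * (1008 * b ^ 14) + 6 * b ^ 5 + 1) / (1 / (2 * b))"
proof -
  let ?A = "R * (1008 * b ^ 14) + 6 * b ^ 5 + 1"
  have 1: "r * P \<le> R * (1008 * b ^ 14) * (1 + s + s\<^sup>2 + s ^ 3)"
  proof -
    have "r * P \<le> r * (1008 * b ^ 14 * (1 + s ^ 3))" using r S by (intro mult_left_mono) auto
    also have "\<dots> \<le> R * (1008 * b ^ 14 * (1 + s + s\<^sup>2 + s ^ 3))"
      using r b s by (intro mult_mono mult_left_mono) auto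
    finally show ?thesis by (simp add: mult.assoc)
  qed
  have 2: "s\<^sup>2 * Q \<le> 6 * b ^ 5 * (1 + s + s\<^sup>2 + s ^ 3) - s ^ 4 / b"
  proof -
    have "s\<^sup>2 * Q \<le> s\<^sup>2 * (6 * b ^ 5 * (1 + s) - s\<^sup>2 / b)" using u by (intro mult_left_mono) auto
    also have "\<dots> = 6 * b ^ 5 * (s\<^sup>2 + s ^ 3) - s ^ 4 / b"
      by (simp add: eval_nat_numeral algebra_simps)
    also have "6 * b ^ 5 * (s\<^sup>2 + s ^ 3) \<le> 6 * b ^ 5 * (1 + s + s\<^sup>2 + s ^ 3)"
      using s b by (intro mult_left_mono) auto
    finally show ?thesis by simp
  qed
  have 3: "2 * s\<^sup>2 / lambda_const b * (k * V\<^sup>2) \<le> s\<^sup>2 + s ^ 4 / (2 * b)"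
  proof -
    have "k * V\<^sup>2 \<le> b * (2 * b ^ 3 * (1 + s))\<^sup>2"
      using k V b by (intro mult_mono power_mono) auto
    also have "\<dots> = 4 * b ^ 7 * (1 + s)\<^sup>2"
      by (simp add: power_mult_distrib eval_nat_numeral)
    also have "\<dots> \<le> 4 * b ^ 7 * (2 * (1 + s\<^sup>2))"
    proof -
      have "0 \<le> (1 - s)\<^sup>2" by simp
      then have "(1 + s)\<^sup>2 \<le> 2 * (1 + s\<^sup>2)" by (simp add: power2_eq_square algebra_simps)
      then show ?thesis using b by (intro mult_left_mono) auto
    qed
    finally have "2 * s\<^sup>2 / lambda_const b * (k * V\<^sup>2) \<le> 2 * s\<^sup>2 / lambda_const b * (4 * b ^ 7 * (2 * (1 + s\<^sup>2)))"
      using b by (intro mult_left_mono) (auto simp: lambda_const_def)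
    \<comment> \<open>This is the origin of 32 b^8: the numbers combine to 2 * 4 * 2 / 32 = 1/2 and
      the powers to b^7 / b^8.\<close>
    also have "\<dots> = s\<^sup>2 / (2 * b) + s ^ 4 / (2 * b)"
      using b by (simp add: lambda_const_def field_simps eval_nat_numeral)
    also have "s\<^sup>2 / (2 * b) \<le> s\<^sup>2"
      using b mult_left_mono[of 1 "2 * b" "s\<^sup>2"] by (simp add: divide_le_eq)
    finally show ?thesis by simp
  qed
  have "s ^ 4 / b = s ^ 4 / (2 * b) + s ^ 4 / (2 * b)" by (simp flip: add_divide_distrib)
  moreover have "s\<^sup>2 \<le> 1 + s + s\<^sup>2 + s ^ 3" using s by simp
  moreover have "1 / (2 * b) * s ^ 4 = s ^ 4 / (2 * b)" by simp
  ultimately have "1 / (2 * b) * s ^ 4 \<le> ?A * (1 + s + s\<^sup>2 + s ^ 3)"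
    using le 1 2 3 unfolding distrib_right[of _ _ "1 + s + s\<^sup>2 + s ^ 3"] mult_1_left by linarith
  moreover have "0 \<le> ?A" using r b by simp
  ultimately show ?thesis
    using s b by (intro quartic_bound) auto
qed
section \<open>The flow in a chart\<close>

definition dz0 :: "'n::finite \<Rightarrow> (complex^'n) \<times> (complex^'n)" where
  "dz0 a = (axis a 1, axis a \<i>)"

definition dz :: "'n::finite \<Rightarrow> (real \<times> (complex^'n)) \<times> (real \<times> (complex^'n))" where
  "dz a = ((0, axis a 1), (0, axis a \<i>))"

definition dt :: "(real \<times> (complex^'n::finite)) \<times> (real \<times> (complex^'n))" where
  "dt = ((2, 0), (0, 0))"

lemma d_hol_wd: "d_hol i f = wd (dz0 i) f"
  by (simp add: fun_eq_iff d_hol_def wd_def dz0_def)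

text \<open>\<open>bar\<close> reverses the imaginary direction, whereas \<open>d_bar\<close>
  changes the sign outside the derivative. The two agree by linearity of the derivative.\<close>

lemma d_bar_wd:
  assumes "f differentiable (at z)"
  shows "d_bar i f z = wd (bar (dz0 i)) f z"
  using linear_neg[OF linear_frechet_derivative[OF assms]]
  by (simp add: d_bar_def wd_def dz0_def bar_def)

lemma cnj_d_bar:
  assumes "f differentiable (at z)"
  shows "cnj (d_bar i f z) = d_hol i (\<lambda>w. cnj (f w)) z"
  using frechet_derivative_bounded_linear[OF bounded_linear_cnj assms]
  by (simp add: d_bar_def d_hol_def)

lemma posdef_invertible:
  fixes H :: "complex^'n^'n::finite"
  assumes "\<And>r s. H $ s $ r = cnj (H $ r $ s)" "\<And>v. v \<noteq> 0 \<Longrightarrow> herm_form H v > 0"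
  shows "invertible H"
proof -
  obtain P Q :: "complex^'n^'n" where PQ: "P ** Q = mat 1" "Q ** P = mat 1" and H: "H = P ** adj P"
    using cholesky[OF assms] by blast
  have 1: "adj P ** adj Q = mat 1" "adj Q ** adj P = mat 1"
    using PQ by (metis adj_mat1 adj_mult)+
  have "P ** adj P ** (adj Q ** Q) = P ** (adj P ** adj Q) ** Q"
    "adj Q ** Q ** (P ** adj P) = adj Q ** (Q ** P) ** adj P" by (simp_all add: matrix_mul_assoc)
  then show ?thesis
    unfolding invertible_def H using 1 PQ by (intro exI[of _ "adj Q ** Q"]) simp
qed

lemma wd_snd:
  fixes F :: "'b::real_normed_vector \<Rightarrow> complex"
  assumes "F differentiable (at (snd x))"
  shows "wd \<xi> (\<lambda>x :: 'a::real_normed_vector \<times> 'b. F (snd x)) x = wd (snd (fst \<xi>), snd (snd \<xi>)) F (snd x)"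
proof -
  have "((\<lambda>x :: 'a \<times> 'b. F (snd x)) has_derivative (\<lambda>v. frechet_derivative F (at (snd x)) (snd v))) (at x)"
    using assms unfolding frechet_derivative_works
    by (rule has_derivative_compose[OF bounded_linear_imp_has_derivative[OF bounded_linear_snd]])
  from frechet_derivative_at[OF this] show ?thesis by (metis (no_types) wd_def fst_conv snd_conv)
qed

lemma Md_snd:
  fixes F :: "'b::real_normed_vector \<Rightarrow> complex^'n::finite^'m::finite"
  assumes "open \<Omega>" "msmooth \<Omega> F" "snd x \<in> \<Omega>"
  shows "Md \<xi> (\<lambda>x :: 'a::real_normed_vector \<times> 'b. F (snd x)) x = Md (snd (fst \<xi>), snd (snd \<xi>)) F (snd x)"
proof -
  have "(\<lambda>y. F y $ r $ s) differentiable (at (snd x))" for r s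
    using smooth_on_differentiable[OF assms(1) msmoothD[OF assms(2)] assms(3)] .
  from wd_snd[OF this] show ?thesis by (simp add: vec_eq_iff)
qed

lemma dz_snd: "(snd (fst (dz a)), snd (snd (dz a))) = dz0 a"
  "(snd (fst (bar (dz a))), snd (snd (bar (dz a)))) = bar (dz0 a)"
  by (simp_all add: dz_def dz0_def bar_def)

text \<open>The time interval is half open, so the continuity of $S$ up to \<open>t = 0\<close> needs derivatives
  within \<open>I \<times> \<Omega>\<close>.\<close>

lemma d_hol_slice_within:
  fixes F :: "real \<times> (complex^'n::finite) \<Rightarrow> complex"
  assumes "open \<Omega>" "z \<in> \<Omega>" "t \<in> I" "(F has_derivative f') (at (t, z) within I \<times> \<Omega>)"
  shows "d_hol i (\<lambda>w. F (t, w)) z = (f' (0, axis i 1) - \<i> * f' (0, axis i \<i>)) / 2"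
proof -
  have "((\<lambda>w. (t, w)) has_derivative (\<lambda>v. (0, v))) (at z within \<Omega>)"
    by (auto intro!: derivative_eq_intros)
  moreover have "(F has_derivative f') (at (t, z) within (\<lambda>w. (t, w)) ` \<Omega>)"
    using assms(4) by (rule has_derivative_subset) (use assms(3) in auto)
  ultimately have "((\<lambda>w. F (t, w)) has_derivative (\<lambda>v. f' (0, v))) (at z within \<Omega>)"
    using has_derivative_in_compose[of "\<lambda>w. (t, w)" "\<lambda>v. (0, v)" z \<Omega> F f'] by simp
  then have "((\<lambda>w. F (t, w)) has_derivative (\<lambda>v. f' (0, v))) (at z)"
    unfolding at_within_open[OF assms(2,1)] .
  from frechet_derivative_at[OF this, symmetric] show ?thesis
    by (simp add: d_hol_def)
qed

text \<open>Time runs through an open set, so all derivatives in (t, z) are two-sided; the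
  application takes positive times.\<close>

locale chart_flow =
  fixes J :: "real set" and \<Omega> :: "(complex^'n::finite) set"
    and g :: "real \<Rightarrow> 'n local_metric" and gh :: "'n local_metric"
  assumes open_J: "open J" and open_\<Omega>: "open \<Omega>"
    and smooth_g: "smooth_on (J \<times> \<Omega>) (\<lambda>(t, z). g t z)"
    and herm_g: "t \<in> J \<Longrightarrow> z \<in> \<Omega> \<Longrightarrow> g t z $ s $ r = cnj (g t z $ r $ s)"
    and pos_g: "t \<in> J \<Longrightarrow> z \<in> \<Omega> \<Longrightarrow> v \<noteq> 0 \<Longrightarrow> herm_form (g t z) v > 0"
    and smooth_gh: "smooth_on \<Omega> gh"
    and herm_gh: "z \<in> \<Omega> \<Longrightarrow> gh z $ s $ r = cnj (gh z $ r $ s)"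
    and pos_gh: "z \<in> \<Omega> \<Longrightarrow> v \<noteq> 0 \<Longrightarrow> herm_form (gh z) v > 0"
begin

definition G :: "real \<times> (complex^'n) \<Rightarrow> complex^'n^'n" where
  "G x = g (fst x) (snd x)"

definition Gh :: "real \<times> (complex^'n) \<Rightarrow> complex^'n^'n" where
  "Gh x = gh (snd x)"

lemma msmooth_gh: "msmooth \<Omega> gh"
  by (rule smooth_on_imp_msmooth[OF smooth_gh])

sublocale evolving_metric "J \<times> \<Omega>" G Gh dz dt
proof
  show "open (J \<times> \<Omega>)" using open_J open_\<Omega> by (rule open_Times)
  have "G = (\<lambda>(t, z). g t z)" by (auto simp: fun_eq_iff G_def)
  then show "msmooth (J \<times> \<Omega>) G" using smooth_on_imp_msmooth[OF smooth_g] by simp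
  show "invertible (G y)" if "y \<in> J \<times> \<Omega>" for y
    unfolding G_def using that by (intro posdef_invertible herm_g pos_g) auto
  show "adj (G y) = G y" if "y \<in> J \<times> \<Omega>" for y
    using herm_g[of "fst y" "snd y", symmetric] that by (simp add: G_def vec_eq_iff mem_Times_iff)
  show "msmooth (J \<times> \<Omega>) Gh"
    unfolding Gh_def msmooth_def
    using smooth_on_compose_linear[OF bounded_linear_snd _ msmoothD[OF msmooth_gh], of "J \<times> \<Omega>"]
    by force
  show "invertible (Gh y)" if "y \<in> J \<times> \<Omega>" for y
    unfolding Gh_def using that by (intro posdef_invertible herm_gh pos_gh) auto
  show "adj (Gh y) = Gh y" if "y \<in> J \<times> \<Omega>" for y
    using herm_gh[of "snd y", symmetric] that by (simp add: Gh_def vec_eq_iff mem_Times_iff)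
  show "bar dt = (dt :: (real \<times> (complex^'n)) \<times> (real \<times> (complex^'n)))" by (simp add: bar_def dt_def zero_prod_def)
  show "Md dt Gh y = 0" if "y \<in> J \<times> \<Omega>" for y
  proof -
    have "frechet_derivative (\<lambda>y. gh y $ r $ s) (at (snd y)) 0 = 0" for r s
      using smooth_on_differentiable[OF open_\<Omega> msmoothD[OF msmooth_gh], of "snd y" r s] that
      by (auto intro!: linear_0 linear_frechet_derivative)
    then have "Md (0, 0) gh (snd y) = 0"
      by (simp add: vec_eq_iff wd_def)
    then show ?thesis
      unfolding Gh_def using Md_snd[OF open_\<Omega> msmooth_gh, of y dt] that by (auto simp: dt_def)
  qed
qed

lemma d_hol_slice:
  assumes "smooth_on (J \<times> \<Omega>) F" "t \<in> J" "z \<in> \<Omega>" "\<And>w. w \<in> \<Omega> \<Longrightarrow> f w = F (t, w)"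
  shows "d_hol i f z = wd (dz i) F (t, z)"
proof -
  have "(F has_derivative frechet_derivative F (at (t, z))) (at (t, z) within J \<times> \<Omega>)"
    using has_derivativeD[OF assms(1)] assms(2,3) by (simp add: has_derivative_at_withinI)
  from d_hol_slice_within[OF open_\<Omega> assms(3,2) this]
  have "d_hol i (\<lambda>w. F (t, w)) z = wd (dz i) F (t, z)" by (simp add: wd_def dz_def)
  moreover have "d_hol i f z = d_hol i (\<lambda>w. F (t, w)) z"
    using frechet_derivative_cong_open[OF open_\<Omega> assms(3,4)] by (simp add: d_hol_def)
  ultimately show ?thesis by simp
qed

text \<open>Conjugation exchanges the two Wirtinger operators and reduces this to
  \<open>d_hol_slice\<close>; differentiability of the slice is what permits it.\<close>

lemma d_bar_slice:
  assumes "smooth_on (J \<times> \<Omega>) F" "t \<in> J" "z \<in> \<Omega>" "\<And>w. w \<in> \<Omega> \<Longrightarrow> f w = F (t, w)"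
  shows "d_bar i f z = wd (bar (dz i)) F (t, z)"
proof -
  have dF: "F differentiable (at (t, z))"
    using smooth_on_differentiable[OF open_W assms(1)] assms(2,3) by simp
  have "((\<lambda>w. (t, w)) has_derivative (\<lambda>v. (0, v))) (at z)"
    by (auto intro!: derivative_eq_intros)
  then have "(\<lambda>w. F (t, w)) differentiable (at z)"
    using dF differentiable_chain_at[of "\<lambda>w. (t, w)" z F] by (auto simp: differentiable_def o_def)
  then obtain D where "((\<lambda>w. F (t, w)) has_derivative D) (at z)" by (auto simp: differentiable_def)
  then have "(f has_derivative D) (at z)"
    by (rule has_derivative_transform_within_open[OF _ open_\<Omega> assms(3)]) (simp add: assms(4))
  then have df: "f differentiable (at z)" by (auto simp: differentiable_def)
  have "cnj (d_bar i f z) = d_hol i (\<lambda>w. cnj (f w)) z" by (rule cnj_d_bar[OF df])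
  also have "\<dots> = wd (dz i) (\<lambda>x. cnj (F x)) (t, z)"
    by (rule d_hol_slice[OF smooth_on_cnj[OF assms(1)] assms(2,3)]) (simp add: assms(4))
  also have "\<dots> = cnj (wd (bar (dz i)) F (t, z))"
    using wd_cnj[OF assms(1)] assms(2,3) by simp
  finally show ?thesis by simp
qed

section \<open>The chart quantities of the statement as matrices in space and time\<close>

context
  fixes t :: real and z :: "complex^'n"
  assumes t: "t \<in> J" and z: "z \<in> \<Omega>"
begin

lemma tz: "(t, z) \<in> J \<times> \<Omega>"
  using t z by simp

lemma christoffel_eq: "christoffel (g t) i j k z = conn G i (t, z) $ j $ k"
proof -
  have "d_hol i (\<lambda>w. g t w $ j $ r) z = wd (dz i) (\<lambda>x. G x $ j $ r) (t, z)" for r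
    by (rule d_hol_slice[OF msmoothD[OF smooth_G] t z]) (simp add: G_def)
  then show ?thesis
    by (simp add: christoffel_def conn_def matrix_mult_nth G_def mult.commute)
qed

lemma christoffel_hat_eq: "christoffel gh i j k z = conn Gh i (t, z) $ j $ k"
proof -
  have "d_hol i (\<lambda>w. gh w $ j $ r) z = wd (dz i) (\<lambda>x. Gh x $ j $ r) (t, z)" for r
    by (rule d_hol_slice[OF msmoothD[OF hat.smooth_G] t z]) (simp add: Gh_def)
  then show ?thesis
    by (simp add: christoffel_def conn_def matrix_mult_nth Gh_def mult.commute)
qed

lemma Psi_eq: "Psi (g t) gh i j k z = \<Psi> i (t, z) $ j $ k"
  by (simp add: Psi_def \<Psi>_def christoffel_eq christoffel_hat_eq)

lemma torsion_eq: "torsion (g t) i j k z = torsion_coeff i j k (t, z)"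
  by (simp add: torsion_def torsion_coeff_def christoffel_eq)

lemma second_chern_ricci_eq: "second_chern_ricci (g t) r s z = Ric (t, z) $ r $ s"
proof -
  have 1: "d_hol k (\<lambda>w. g t w $ r $ s) w = wd (dz k) (\<lambda>x. G x $ r $ s) (t, w)" if "w \<in> \<Omega>" for k r s w
    by (rule d_hol_slice[OF msmoothD[OF smooth_G] t that]) (simp add: G_def)
  have 2: "d_bar l (\<lambda>w. g t w $ r $ s) z = wd (bar (dz l)) (\<lambda>x. G x $ r $ s) (t, z)" for l r s
    by (rule d_bar_slice[OF msmoothD[OF smooth_G] t z]) (simp add: G_def)
  have 3: "d_bar l (d_hol k (\<lambda>w. g t w $ r $ s)) z = wd (bar (dz l)) (wd (dz k) (\<lambda>x. G x $ r $ s)) (t, z)" for k l r s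
    by (rule d_bar_slice[OF smooth_on_wd[OF msmoothD[OF smooth_G]] t z 1])
  have "curvature (g t) k l r s z = (Md (dz k) G (t, z) ** ginv (G (t, z)) ** Md (bar (dz l)) G (t, z)
     - Md (bar (dz l)) (Md (dz k) G) (t, z)) $ r $ s" for k l
  proof -
    have "(Md (dz k) G (t, z) ** ginv (G (t, z)) ** Md (bar (dz l)) G (t, z)) $ r $ s =
      (\<Sum>a\<in>UNIV. \<Sum>b\<in>UNIV. ginv (G (t, z)) $ b $ a * wd (bar (dz l)) (\<lambda>x. G x $ a $ s) (t, z)
         * wd (dz k) (\<lambda>x. G x $ r $ b) (t, z))"
      by (simp add: matrix_mult_nth sum_distrib_left sum_distrib_right mult_ac)
    then show ?thesis by (simp add: curvature_def 1[OF z] 2 3 G_def)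
  qed
  then show ?thesis
    by (simp add: second_chern_ricci_def Ric_def tr_g_def G_def)
qed

text \<open>The premise is \<open>Psi_eq\<close> at all points of the slice: z is fixed in this
  context, but a derivative needs the neighbouring points.\<close>

lemma nabla_21_eq: "nabla_21 (g t) (Psi (g t) gh) a i j k z = nab a \<Psi> i (t, z) $ j $ k"
  if P: "\<And>w i j k. w \<in> \<Omega> \<Longrightarrow> Psi (g t) gh i j k w = \<Psi> i (t, w) $ j $ k"
proof -
  have "d_hol a (Psi (g t) gh i j k) z = wd (dz a) (\<lambda>x. \<Psi> i x $ j $ k) (t, z)"
    by (rule d_hol_slice[OF msmoothD[OF smooth_\<Psi>] t z P])
  then show ?thesis
    by (simp add: nabla_21_def nab_def act_def matrix_mult_nth christoffel_eq Psi_eq mult.commute)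
qed

lemma nabla_bar_21_eq: "nabla_bar_21 (Psi (g t) gh) a i j k z = Md (bar (dz a)) (\<Psi> i) (t, z) $ j $ k"
  if P: "\<And>w i j k. w \<in> \<Omega> \<Longrightarrow> Psi (g t) gh i j k w = \<Psi> i (t, w) $ j $ k"
proof -
  have "d_bar a (Psi (g t) gh i j k) z = wd (bar (dz a)) (\<lambda>x. \<Psi> i x $ j $ k) (t, z)"
    by (rule d_bar_slice[OF msmoothD[OF smooth_\<Psi>] t z P])
  then show ?thesis by (simp add: nabla_bar_21_def)
qed

lemma time_derivative_eq:
  assumes "J \<subseteq> I"
  shows "vector_derivative (\<lambda>u. g u z $ r $ s) (at t within I) = Md dt G (t, z) $ r $ s"
proof -
  let ?F = "\<lambda>x. G x $ r $ s"
  have dF: "(?F has_derivative frechet_derivative ?F (at (t, z))) (at (t, z))"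
    using has_derivativeD[OF msmoothD[OF smooth_G] tz] .
  have "((\<lambda>u. (u, z)) has_derivative (\<lambda>h. (h, 0))) (at t)"
    by (auto intro!: derivative_eq_intros)
  from diff_chain_at[OF this dF]
  have "((\<lambda>u. g u z $ r $ s) has_derivative (\<lambda>h. frechet_derivative ?F (at (t, z)) (h, 0))) (at t)"
    by (simp add: o_def G_def)
  moreover have lin: "linear (frechet_derivative ?F (at (t, z)))"
    using dF has_derivative_linear by blast
  have sc: "frechet_derivative ?F (at (t, z)) (h, 0) = h *\<^sub>R frechet_derivative ?F (at (t, z)) (1, 0)" for h
    using linear_scale[OF lin, of h "(1, 0)"] by simp
  ultimately have "((\<lambda>u. g u z $ r $ s) has_vector_derivative frechet_derivative ?F (at (t, z)) (1, 0)) (at t)"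
    unfolding has_vector_derivative_def ext[of _ _, OF sc, symmetric] by blast
  moreover have "at t within I = at t"
    by (rule at_within_open_subset[OF t open_J assms])
  ultimately have "vector_derivative (\<lambda>u. g u z $ r $ s) (at t within I) = frechet_derivative ?F (at (t, z)) (1, 0)"
    by (simp add: vector_derivative_at)
  moreover have "wd dt ?F (t, z) = frechet_derivative ?F (at (t, z)) (1, 0)"
    using sc[of 2] linear_0[OF lin] by (simp add: wd_def dt_def zero_prod_def scaleR_conv_of_real)
  ultimately show ?thesis by simp
qed

end

lemma S_eq:
  assumes "t \<in> J" "z \<in> \<Omega>"
  shows "Re (S (t, z)) = Re (inner_21 (g t z) (\<lambda>i j k. Psi (g t) gh i j k z) (\<lambda>i j k. Psi (g t) gh i j k z))"
  unfolding Psi_eq[OF assms] ip_inner_21 S_def G_def by simp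

lemma u_eq: "u (t, z) = trace (g t z ** ginv (gh z))"
  by (simp add: u_def G_def Gh_def)

end
section \<open>The estimate at a maximum point in a chart\<close>

text \<open>Counterpart of \<open>conn\<close> on space alone, for the fixed metric, the initial
  metric and changes of chart, where no time variable is present.\<close>

definition conn0 :: "'n::finite local_metric \<Rightarrow> 'n \<Rightarrow> 'n local_metric" where
  "conn0 h a z = Md (dz0 a) h z ** ginv (h z)"

text \<open>Everything the estimates require of the fixed metric, in one continuous function, hence
  bounded on compact coordinate sets. Being a coordinate expression, it is only ever bounded on the
  chosen pieces.\<close>

definition hat_size :: "'n::finite local_metric \<Rightarrow> complex^'n \<Rightarrow> real" where
  "hat_size h z = N1 (h z) + N1 (ginv (h z)) + (\<Sum>a\<in>UNIV. N1 (conn0 h a z))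
    + (\<Sum>a\<in>UNIV. \<Sum>c\<in>UNIV. N1 (Md (bar (dz0 c)) (conn0 h a) z))
    + (\<Sum>i\<in>UNIV. \<Sum>a\<in>UNIV. \<Sum>c\<in>UNIV. N1 (Md (dz0 a) (Md (bar (dz0 c)) (conn0 h i)) z))
    + (\<Sum>a\<in>UNIV. N1 (Md (dz0 a) (\<lambda>y. ginv (h y)) z))
    + (\<Sum>a\<in>UNIV. N1 (Md (bar (dz0 a)) (\<lambda>y. ginv (h y)) z))
    + (\<Sum>a\<in>UNIV. \<Sum>c\<in>UNIV. N1 (Md (bar (dz0 c)) (Md (dz0 a) (\<lambda>y. ginv (h y))) z))"

lemma continuous_on_N1: "msmooth S F \<Longrightarrow> continuous_on S (\<lambda>z. N1 (F z))"
  unfolding N1_def msmooth_def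
  by (intro continuous_intros smooth_on_imp_continuous_on) auto

lemma continuous_on_hat_size:
  fixes h :: "'n::finite local_metric"
  assumes "open \<Omega>" "msmooth \<Omega> h" "\<And>z. z \<in> \<Omega> \<Longrightarrow> invertible (h z)"
  shows "continuous_on \<Omega> (hat_size h)"
proof -
  interpret open_dom \<Omega> by unfold_locales (rule assms(1))
  have 1: "msmooth \<Omega> (\<lambda>y. ginv (h y))" by (rule msmooth_ginv[OF assms(2,3)])
  have 2: "msmooth \<Omega> (conn0 h a)" for a
    unfolding conn0_def by (intro msmooth_mult msmooth_Md assms(2) 1)
  show ?thesis
    unfolding hat_size_def
    by (intro continuous_on_add continuous_on_sum continuous_on_N1 msmooth_Md assms(2) 1 2)
qed

text \<open>With both metrics factored, the trace is the squared Hilbert-Schmidt norm of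
  \<open>Qh ** P\<close>.\<close>

lemma trace_ginv_nonneg:
  fixes H Hh :: "complex^'n^'n::finite"
  assumes "\<And>r s. H $ s $ r = cnj (H $ r $ s)" "\<And>v. v \<noteq> 0 \<Longrightarrow> herm_form H v > 0"
    and "\<And>r s. Hh $ s $ r = cnj (Hh $ r $ s)" "\<And>v. v \<noteq> 0 \<Longrightarrow> herm_form Hh v > 0"
  shows "0 \<le> Re (trace (H ** ginv Hh))"
proof -
  obtain P Q :: "complex^'n^'n" where PQ: "P ** Q = mat 1" "Q ** P = mat 1" and H: "H = P ** adj P"
    using cholesky[OF assms(1,2)] by blast
  obtain Ph Qh :: "complex^'n^'n" where PQh: "Ph ** Qh = mat 1" "Qh ** Ph = mat 1" and Hh: "Hh = Ph ** adj Ph"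
    using cholesky[OF assms(3,4)] by blast
  let ?A = "Qh ** P"
  have "trace (H ** ginv Hh) = trace ((P ** adj P ** adj Qh) ** Qh)"
    unfolding Hh frame_ginv[OF PQh] H by (simp add: matrix_mul_assoc)
  also have "\<dots> = trace (Qh ** (P ** adj P ** adj Qh))" by (rule trace_mul_sym)
  also have "\<dots> = trace (?A ** adj ?A)" by (simp add: adj_mult matrix_mul_assoc)
  also have "\<dots> = of_real (\<Sum>r\<in>UNIV. \<Sum>s\<in>UNIV. (cmod (?A $ r $ s))\<^sup>2)"
    unfolding trace_def matrix_mult_nth[of ?A] adj_nth of_real_sum complex_norm_square ..
  finally show ?thesis by (simp only: Re_complex_of_real) (intro sum_nonneg zero_le_power2)
qed

section \<open>Constants depending only on the dimension, K and B\<close>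

definition frame_size :: "'n::finite itself \<Rightarrow> real \<Rightarrow> real \<Rightarrow> real" where
  "frame_size _ K B = real CARD('n) * (1 + K) * B"

text \<open>Dominates all bounds at once: B for the fixed metric, \<open>\<beta>\<close> for the
  entries of the moving metric and its inverse, f for passing from norms to entries, f K for the
  hypotheses, and the last product for comparing |Psi|^2 with its mixed form.\<close>

definition total_const :: "'n::finite itself \<Rightarrow> real \<Rightarrow> real \<Rightarrow> real" where
  "total_const n K B = (let c = frame_size n K B; \<beta> = (real CARD('n) ^ 2 * c)\<^sup>2; f = frame_const n c in
     1 + B + \<beta> + f + f * K + \<beta> * (\<beta> * \<beta> * (f * f)))"

text \<open>The conclusion of \<open>maximum_point_bound\<close> with R = Lambda + b^2, as u is at
  most b^2.\<close>

definition psi_bound :: "real \<Rightarrow> real" where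
  "psi_bound b = 1 + 4 * ((lambda_const b + b * b) * (1008 * b ^ 14) + 6 * b ^ 5 + 1) / (1 / (2 * b))"

lemma total_const_ge:
  fixes n :: "'n::finite itself"
  assumes "0 < K" "1 \<le> B"
  defines "c \<equiv> frame_size n K B"
  shows "1 \<le> c" "1 \<le> total_const n K B" "B \<le> total_const n K B"
    "(real CARD('n) ^ 2 * c)\<^sup>2 \<le> total_const n K B"
    "frame_const n c \<le> total_const n K B" "frame_const n c * K \<le> total_const n K B"
    "(real CARD('n) ^ 2 * c)\<^sup>2 * ((real CARD('n) ^ 2 * c)\<^sup>2 * (real CARD('n) ^ 2 * c)\<^sup>2
       * (frame_const n c * frame_const n c)) \<le> total_const n K B"
proof -
  have "1 \<le> real CARD('n)" by (simp add: Suc_leI)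
  then have "1 * 1 * 1 \<le> real CARD('n) * (1 + K) * B"
    using assms by (intro mult_mono) auto
  then show c: "1 \<le> c" by (simp add: c_def frame_size_def)
  then have f: "0 \<le> frame_const n c" "0 \<le> frame_const n c * K" by (auto simp: frame_const_def \<open>0 < K\<close> less_imp_le)
  have p: "0 \<le> (real CARD('n) ^ 2 * c)\<^sup>2" "0 \<le> (real CARD('n) ^ 2 * c)\<^sup>2 * ((real CARD('n) ^ 2 * c)\<^sup>2 * (real CARD('n) ^ 2 * c)\<^sup>2
       * (frame_const n c * frame_const n c))"
    using f by (intro mult_nonneg_nonneg zero_le_power2; simp)+
  have t: "total_const n K B = 1 + B + (real CARD('n) ^ 2 * c)\<^sup>2 + frame_const n c + frame_const n c * K
     + (real CARD('n) ^ 2 * c)\<^sup>2 * ((real CARD('n) ^ 2 * c)\<^sup>2 * (real CARD('n) ^ 2 * c)\<^sup>2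
       * (frame_const n c * frame_const n c))"
    unfolding total_const_def Let_def c_def ..
  show "1 \<le> total_const n K B" "B \<le> total_const n K B"
    "(real CARD('n) ^ 2 * c)\<^sup>2 \<le> total_const n K B"
    "frame_const n c \<le> total_const n K B" "frame_const n c * K \<le> total_const n K B"
    "(real CARD('n) ^ 2 * c)\<^sup>2 * ((real CARD('n) ^ 2 * c)\<^sup>2 * (real CARD('n) ^ 2 * c)\<^sup>2
       * (frame_const n c * frame_const n c)) \<le> total_const n K B"
    using f p assms(2) unfolding t by linarith+
qed

lemma cmod_u_le:
  fixes H Hh :: "complex^'n^'n::finite"
  assumes H: "\<And>r s. H $ s $ r = cnj (H $ r $ s)" "\<And>v. v \<noteq> 0 \<Longrightarrow> herm_form H v > 0"
    and Hh: "\<And>r s. Hh $ s $ r = cnj (Hh $ r $ s)" "\<And>v. v \<noteq> 0 \<Longrightarrow> herm_form Hh v > 0"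
    and b: "1 \<le> B" "N1 Hh \<le> B" "N1 (ginv Hh) \<le> B" and K: "0 < K"
    and le: "\<And>v. herm_form Hh v / K \<le> herm_form H v" "\<And>v. herm_form H v \<le> K * herm_form Hh v"
  shows "cmod (trace (H ** ginv Hh)) \<le> total_const TYPE('n) K B * total_const TYPE('n) K B"
proof -
  note fr = frame_bound_comparable[OF H Hh b K le, folded frame_size_def[of "TYPE('n)"]]
  have "N1 H \<le> total_const TYPE('n) K B" "N1 (ginv Hh) \<le> total_const TYPE('n) K B"
    using frame_bound_N1(1)[OF fr(1)] total_const_ge(3,4)[OF K b(1), of "TYPE('n)"] b(3) by linarith+
  then show ?thesis by (intro order.trans[OF trace_le_N1 N1_mult_le])
qed

context chart_flow
begin

lemma hat_terms:
  assumes t: "t \<in> J" and z: "z \<in> \<Omega>"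
  shows "(\<Sum>a\<in>UNIV. N1 (conn Gh a (t, z))) \<le> hat_size gh z"
    "(\<Sum>a\<in>UNIV. \<Sum>c\<in>UNIV. N1 (curv Gh c a (t, z))) \<le> hat_size gh z"
    "(\<Sum>i\<in>UNIV. \<Sum>a\<in>UNIV. \<Sum>c\<in>UNIV. N1 (Md (dz a) (curv Gh c i) (t, z))) \<le> hat_size gh z"
    "(\<Sum>a\<in>UNIV. N1 (Md (dz a) (\<lambda>y. ginv (Gh y)) (t, z))) \<le> hat_size gh z"
    "(\<Sum>a\<in>UNIV. N1 (Md (bar (dz a)) (\<lambda>y. ginv (Gh y)) (t, z))) \<le> hat_size gh z"
    "(\<Sum>a\<in>UNIV. \<Sum>c\<in>UNIV. N1 (Md (bar (dz c)) (Md (dz a) (\<lambda>y. ginv (Gh y))) (t, z))) \<le> hat_size gh z"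
    "N1 (Gh (t, z)) \<le> hat_size gh z" "N1 (ginv (Gh (t, z))) \<le> hat_size gh z"
proof -
  interpret \<Omega>: open_dom \<Omega> by unfold_locales (rule open_\<Omega>)
  have inv: "invertible (gh z)" if "z \<in> \<Omega>" for z
    using that by (intro posdef_invertible herm_gh pos_gh)
  have sL: "msmooth \<Omega> (\<lambda>y. ginv (gh y))" by (rule msmooth_ginv[OF msmooth_gh inv])
  have sc: "msmooth \<Omega> (conn0 gh a)" for a
    unfolding conn0_def by (intro msmooth_mult \<Omega>.msmooth_Md msmooth_gh sL)
  have snd: "snd y \<in> \<Omega>" if "y \<in> J \<times> \<Omega>" for y using that by auto
  have c: "conn Gh a y = conn0 gh a (snd y)" if "y \<in> J \<times> \<Omega>" for a y
    unfolding conn_def conn0_def Gh_def using Md_snd[OF open_\<Omega> msmooth_gh snd[OF that], of "dz a"]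
    by (simp only: dz_snd)
  have f: "curv Gh b a y = Md (bar (dz0 b)) (conn0 gh a) (snd y)" if "y \<in> J \<times> \<Omega>" for a b y
  proof -
    have "curv Gh b a y = Md (bar (dz b)) (\<lambda>y. conn0 gh a (snd y)) y"
      unfolding curv_def by (rule Md_cong[OF c that])
    then show ?thesis using Md_snd[OF open_\<Omega> sc snd[OF that], of "bar (dz b)"] by (simp only: dz_snd)
  qed
  have df: "Md (dz c) (curv Gh b a) y = Md (dz0 c) (Md (bar (dz0 b)) (conn0 gh a)) (snd y)" if "y \<in> J \<times> \<Omega>" for a b c y
  proof -
    have "Md (dz c) (curv Gh b a) y = Md (dz c) (\<lambda>y. Md (bar (dz0 b)) (conn0 gh a) (snd y)) y"
      by (rule Md_cong[OF f that])
    then show ?thesis using Md_snd[OF open_\<Omega> \<Omega>.msmooth_Md[OF sc] snd[OF that], of "dz c"] by (simp only: dz_snd)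
  qed
  have L: "Md (dz a) (\<lambda>y. ginv (Gh y)) y = Md (dz0 a) (\<lambda>y. ginv (gh y)) (snd y)"
    "Md (bar (dz a)) (\<lambda>y. ginv (Gh y)) y = Md (bar (dz0 a)) (\<lambda>y. ginv (gh y)) (snd y)" if "y \<in> J \<times> \<Omega>" for a y
    unfolding Gh_def using Md_snd[OF open_\<Omega> sL snd[OF that], of "dz a"] Md_snd[OF open_\<Omega> sL snd[OF that], of "bar (dz a)"]
    by (simp_all only: dz_snd)
  have LL: "Md (bar (dz c)) (Md (dz a) (\<lambda>y. ginv (Gh y))) y = Md (bar (dz0 c)) (Md (dz0 a) (\<lambda>y. ginv (gh y))) (snd y)"
    if "y \<in> J \<times> \<Omega>" for a c y
  proof -
    have "Md (bar (dz c)) (Md (dz a) (\<lambda>y. ginv (Gh y))) y = Md (bar (dz c)) (\<lambda>y. Md (dz0 a) (\<lambda>y. ginv (gh y)) (snd y)) y"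
      by (rule Md_cong[OF L(1) that])
    then show ?thesis using Md_snd[OF open_\<Omega> \<Omega>.msmooth_Md[OF sL] snd[OF that], of "bar (dz c)"] by (simp only: dz_snd)
  qed
  note e = c[OF tz[OF t z]] f[OF tz[OF t z]] df[OF tz[OF t z]] L[OF tz[OF t z]] LL[OF tz[OF t z]]
  have nn: "0 \<le> N1 (gh z)" "0 \<le> N1 (ginv (gh z))" "0 \<le> (\<Sum>a\<in>UNIV. N1 (conn0 gh a z))"
    "0 \<le> (\<Sum>a\<in>UNIV. \<Sum>c\<in>UNIV. N1 (Md (bar (dz0 c)) (conn0 gh a) z))"
    "0 \<le> (\<Sum>i\<in>UNIV. \<Sum>a\<in>UNIV. \<Sum>c\<in>UNIV. N1 (Md (dz0 a) (Md (bar (dz0 c)) (conn0 gh i)) z))"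
    "0 \<le> (\<Sum>a\<in>UNIV. N1 (Md (dz0 a) (\<lambda>y. ginv (gh y)) z))"
    "0 \<le> (\<Sum>a\<in>UNIV. N1 (Md (bar (dz0 a)) (\<lambda>y. ginv (gh y)) z))"
    "0 \<le> (\<Sum>a\<in>UNIV. \<Sum>c\<in>UNIV. N1 (Md (bar (dz0 c)) (Md (dz0 a) (\<lambda>y. ginv (gh y))) z))"
    by (intro sum_nonneg N1_nonneg)+
  show "(\<Sum>a\<in>UNIV. N1 (conn Gh a (t, z))) \<le> hat_size gh z"
    "(\<Sum>a\<in>UNIV. \<Sum>c\<in>UNIV. N1 (curv Gh c a (t, z))) \<le> hat_size gh z"
    "(\<Sum>i\<in>UNIV. \<Sum>a\<in>UNIV. \<Sum>c\<in>UNIV. N1 (Md (dz a) (curv Gh c i) (t, z))) \<le> hat_size gh z"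
    "(\<Sum>a\<in>UNIV. N1 (Md (dz a) (\<lambda>y. ginv (Gh y)) (t, z))) \<le> hat_size gh z"
    "(\<Sum>a\<in>UNIV. N1 (Md (bar (dz a)) (\<lambda>y. ginv (Gh y)) (t, z))) \<le> hat_size gh z"
    "(\<Sum>a\<in>UNIV. \<Sum>c\<in>UNIV. N1 (Md (bar (dz c)) (Md (dz a) (\<lambda>y. ginv (Gh y))) (t, z))) \<le> hat_size gh z"
    using nn unfolding e hat_size_def snd_conv by linarith+
  show "N1 (Gh (t, z)) \<le> hat_size gh z" "N1 (ginv (Gh (t, z))) \<le> hat_size gh z"
    using nn unfolding Gh_def hat_size_def snd_conv by linarith+
qed

text \<open>Frames convert the intrinsic norms of the hypotheses into entry bounds with the single
  constant b; after that the entrywise estimates and the maximum conditions on the product give a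
  bound without reference to the chart.\<close>

lemma chart_maximum:
  fixes t z K B
  defines "b \<equiv> total_const TYPE('n) K B" and "s \<equiv> sqrt (S_quantity (g t) gh z)"
  assumes t: "t \<in> J" and z: "z \<in> \<Omega>" and B: "1 \<le> B" "hat_size gh z \<le> B" and K: "0 < K"
    and le: "\<And>v. herm_form (gh z) v / K \<le> herm_form (g t z) v" "\<And>v. herm_form (g t z) v \<le> K * herm_form (gh z) v"
    and hE: "norm_11 (g t z) (\<lambda>r s. E (t, z) $ r $ s) \<le> K * (1 + s)"
    and hdE: "norm_d_11 (g t z) (\<lambda>a r s. (Md (dz a) E (t, z) - conn G a (t, z) ** E (t, z)) $ r $ s)
      \<le> K * (nabla_Psi_norm (g t) gh z + nabla_bar_Psi_norm (g t) gh z + 1 + S_quantity (g t) gh z)"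
    and hT: "torsion_norm (g t) z \<le> K"
    and grad: "\<And>a. wd (dz a) (\<lambda>y. (of_real (lambda_const b) + u y) * S y) (t, z) = 0"
    and time: "0 \<le> Re (wd dt (\<lambda>y. (of_real (lambda_const b) + u y) * S y) (t, z))"
    and hess: "Re (lap (\<lambda>y. (of_real (lambda_const b) + u y) * S y) (t, z)) \<le> 0"
  shows "s \<le> psi_bound b"
proof -
  let ?x = "(t, z)" and ?H = "g t z" and ?Hh = "gh z"
  define c where "c = frame_size TYPE('n) K B"
  define f where "f = frame_const TYPE('n) c"
  define \<beta> where "\<beta> = (real CARD('n) ^ 2 * c)\<^sup>2"
  note tc = total_const_ge[OF K B(1), of "TYPE('n)", folded c_def, folded b_def f_def \<beta>_def]
  note hat = hat_terms[OF t z]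
  have hatB: "N1 ?Hh \<le> B" "N1 (ginv ?Hh) \<le> B" using hat(7,8) B(2) by (auto simp: Gh_def)
  note fr = frame_bound_comparable[OF herm_g[OF t z] pos_g[OF t z] herm_gh[OF z] pos_gh[OF z] B(1) hatB K le,
      folded frame_size_def[of "TYPE('n)"], folded c_def]
  note N = frame_bound_N1[OF fr(1), folded \<beta>_def]
  have b: "1 \<le> b" by (rule tc(2))
  have f0: "0 \<le> f" using tc(1) by (simp add: f_def frame_const_def)
  have s2: "s\<^sup>2 = S_quantity (g t) gh z" "0 \<le> s" by (simp_all add: s_def S_quantity_def)
  have Sip: "inner_21 ?H (\<lambda>i j k. Psi (g t) gh i j k z) (\<lambda>i j k. Psi (g t) gh i j k z) = S ?x"
    unfolding Psi_eq[OF t z] ip_inner_21 S_def G_def by simp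
  have Snn: "0 \<le> Re (S ?x)" using inner_21_nonneg[OF fr(1)] unfolding Sip[symmetric] .
  have sS: "s = sqrt (Re (S ?x))"
    using Snn by (simp add: s_def S_quantity_def norm_21_def Sip)
  have S: "Re (S ?x) = s\<^sup>2" using Snn by (simp add: sS)
  define D1 where "D1 = nabla_Psi_norm (g t) gh z"
  define D2 where "D2 = nabla_bar_Psi_norm (g t) gh z"
  have D0: "0 \<le> D1" "0 \<le> D2"
    unfolding D1_def D2_def nabla_Psi_norm_def nabla_bar_Psi_norm_def
    using norm_d_21_nonneg[OF fr(1)] norm_dbar_21_nonneg[OF fr(1)] by auto
  have k: "N1 (ginv (G ?x)) \<le> b" "N1 (G ?x) \<le> b" "N1 (ginv (Gh ?x)) \<le> b"
    using N tc(3,4) hatB by (auto simp: G_def Gh_def)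
  have hatb: "hat_size gh z \<le> b" using B(2) tc(3) by linarith
  have Psi: "(\<Sum>a\<in>UNIV. N1 (\<Psi> a ?x)) \<le> f * s"
    using sum_le_form3[OF tc(1) fr(1) fr(1), of "\<lambda>a. \<Psi> a ?x", folded f_def]
    unfolding sS S_form3 G_def by simp
  have le_b: "x \<le> b * y" if "x \<le> f * y" "0 \<le> y" for x y
    using that tc(5) by (meson mult_right_mono order.trans)
  have le_b': "x \<le> b * y" if "x \<le> f * w" "w \<le> K * y" "0 \<le> y" for x w y
  proof -
    have "x \<le> f * (K * y)" using that(1) mult_left_mono[OF that(2) f0] by linarith
    also have "\<dots> \<le> b * y" using mult_right_mono[OF tc(6) that(3)] by (simp add: mult.assoc)
    finally show ?thesis .
  qed
  have E: "N1 (E ?x) \<le> b * (1 + s)"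
  proof -
    have "0 \<le> 1 + s" using s2(2) by linarith
    from le_b'[OF sum_le_norm_11[OF tc(1) fr(1), folded f_def] hE this] show ?thesis
      unfolding N1_def .
  qed
  have dE: "(\<Sum>i\<in>UNIV. N1 (Md (dz i) E ?x - conn G i ?x ** E ?x)) \<le> b * (D1 + D2 + 1 + s\<^sup>2)"
  proof -
    have "0 \<le> D1 + D2 + 1 + s\<^sup>2" using D0 by simp
    from le_b'[OF sum_le_norm_d_11[OF tc(1) fr(1), folded f_def] hdE[folded D1_def D2_def s2(1)] this]
    show ?thesis unfolding N1_def .
  qed
  have T: "(\<Sum>a\<in>UNIV. \<Sum>i\<in>UNIV. \<Sum>p\<in>UNIV. cmod (torsion_coeff a i p ?x)) \<le> b"
  proof -
    have "torsion_norm (g t) z \<le> K * 1" using hT by simp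
    from le_b'[OF sum_le_norm_21[OF fr(1) tc(1), folded f_def] this[unfolded torsion_norm_def]]
    show ?thesis unfolding torsion_eq[OF t z] by simp
  qed
  have nPsi: "Psi (g t) gh i j k w = \<Psi> i (t, w) $ j $ k" if "w \<in> \<Omega>" for w i j k
    by (rule Psi_eq[OF t that])
  have nab_eq: "nabla_21 (g t) (Psi (g t) gh) a i j k z = nab a \<Psi> i ?x $ j $ k"
    "nabla_bar_21 (Psi (g t) gh) a i j k z = Md (bar (dz a)) (\<Psi> i) ?x $ j $ k" for a i j k
    by (rule nabla_21_eq[OF t z] nabla_bar_21_eq[OF t z]; rule nPsi; assumption)+
  have dPsi: "(\<Sum>c\<in>UNIV. \<Sum>i\<in>UNIV. N1 (Md (bar (dz c)) (\<Psi> i) ?x)) \<le> b * D2"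
    unfolding N1_def
    using le_b[OF sum_le_norm_dbar_21[OF fr(1) tc(1), folded f_def], of "\<lambda>a i j k. nabla_bar_21 (Psi (g t) gh) a i j k z"] D0(2)
    unfolding D2_def nabla_bar_Psi_norm_def nab_eq by simp
  have Gx: "G ?x = ?H" by (simp add: G_def)
  have D1sq: "Re (\<Sum>a\<in>UNIV. \<Sum>c\<in>UNIV. ginv (G ?x) $ c $ a *
        ip (G ?x) (\<lambda>i. nab a \<Psi> i ?x) (\<lambda>i. nab c \<Psi> i ?x)) = D1\<^sup>2"
    using norm_d_21_sq[OF fr(1), of "\<lambda>a i j k. nab a \<Psi> i ?x $ j $ k"]
    unfolding D1_def nabla_Psi_norm_def nab_eq ip_inner_21 Gx ..
  have D2sq: "Re (\<Sum>a\<in>UNIV. \<Sum>c\<in>UNIV. ginv (G ?x) $ c $ a *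
        ip (G ?x) (\<lambda>i. Md (bar (dz c)) (\<Psi> i) ?x) (\<lambda>i. Md (bar (dz a)) (\<Psi> i) ?x)) = D2\<^sup>2"
    using norm_dbar_21_sq[OF fr(1), of "\<lambda>a i j k. Md (bar (dz a)) (\<Psi> i) ?x $ j $ k"]
    unfolding D2_def nabla_bar_Psi_norm_def nab_eq ip_inner_21 Gx by (subst sum.swap) (rule sym)
  \<comment> \<open>Both forms of Psi are compared with the sum p of its entries: p is bounded by
    the root of the mixed form q, and s^2 by p^2.\<close>
  have low: "s\<^sup>2 / b \<le> Re (form3 (ginv (G ?x)) (ginv (Gh ?x)) (G ?x) (\<lambda>i. \<Psi> i ?x) (\<lambda>i. \<Psi> i ?x))"
  proof -
    define q where "q = Re (form3 (ginv ?H) (ginv ?Hh) ?H (\<lambda>i. \<Psi> i ?x) (\<lambda>i. \<Psi> i ?x))"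
    define p where "p = (\<Sum>a\<in>UNIV. N1 (\<Psi> a ?x))"
    have q0: "0 \<le> q" unfolding q_def by (rule form3_nonneg[OF fr])
    have p0: "0 \<le> p" unfolding p_def by (intro sum_nonneg N1_nonneg)
    have "p \<le> f * sqrt q"
      unfolding p_def q_def f_def by (rule sum_le_form3[OF tc(1) fr])
    then have "p * p \<le> (f * sqrt q) * (f * sqrt q)" using p0 f0 q0 by (intro mult_mono) auto
    also have "\<dots> = f * f * q" using q0 by (simp add: algebra_simps flip: real_sqrt_mult)
    finally have pp: "p * p \<le> f * f * q" .
    have "s\<^sup>2 \<le> cmod (form3 (ginv ?H) (ginv ?H) ?H (\<lambda>i. \<Psi> i ?x) (\<lambda>i. \<Psi> i ?x))"
      unfolding S[symmetric] S_form3 by (simp add: G_def complex_Re_le_cmod)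
    also have "\<dots> \<le> N1 (ginv ?H) * (N1 ?H * N1 (ginv ?H) * (p * p))"
      unfolding p_def by (rule norm_le_form3)
    also have "\<dots> \<le> \<beta> * (\<beta> * \<beta> * (f * f * q))"
      using p0 order.trans[OF N1_nonneg N(1)]
      by (intro mult_mono[OF N(2) mult_mono[OF mult_mono[OF N(1) N(2)] pp]] mult_nonneg_nonneg) auto
    also have "\<dots> \<le> b * q"
      using mult_right_mono[OF tc(7) q0] by (simp add: mult.assoc)
    finally show ?thesis using b unfolding q_def G_def Gh_def by (simp add: divide_le_eq mult.commute)
  qed
  have Zc: "(\<Sum>i\<in>UNIV. N1 (Z i ?x)) \<le> 6 * b ^ 3 * (D1 + D2 + 1 + s + s\<^sup>2)"
      "(\<Sum>a\<in>UNIV. N1 (conn G a ?x)) \<le> b * (1 + s)"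
    using Z_estimate[OF tz[OF t z] b s2(2) D0 k(1) order.trans[OF hat(1) hatb] order.trans[OF hat(2) hatb]
        order.trans[OF hat(3) hatb] le_b[OF Psi s2(2)] dE T dPsi] by blast+
  have S_est: "Re (wd dt S ?x - lap S ?x) \<le> 1008 * b ^ 14 * (1 + s ^ 3)"
    by (rule S_estimate[OF tz[OF t z] b s2(2) D0 k(1,2) le_b[OF Psi s2(2)] E Zc(1) D1sq D2sq])
  note u_est = u_estimate[OF tz[OF t z] b s2(2) k order.trans[OF hat(1) hatb] order.trans[OF hat(4) hatb]
      order.trans[OF hat(5) hatb] order.trans[OF hat(6) hatb] le_b[OF Psi s2(2)] Zc(2) E low]
  have u0: "0 \<le> Re (u ?x)"
    unfolding u_eq by (rule trace_ginv_nonneg[OF herm_g[OF t z] pos_g[OF t z] herm_gh[OF z] pos_gh[OF z]])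
  have u1: "Re (u ?x) \<le> b * b"
    unfolding u_eq b_def
    by (rule order.trans[OF complex_Re_le_cmod cmod_u_le[OF herm_g[OF t z] pos_g[OF t z] herm_gh[OF z] pos_gh[OF z] B(1) hatB K le]])
  have \<Lambda>: "0 < lambda_const b" using b by (simp add: lambda_const_def)
  have max: "0 \<le> (lambda_const b + Re (u ?x)) * Re (wd dt S ?x - lap S ?x) + s\<^sup>2 * Re (wd dt u ?x - lap u ?x)
     + 2 * s\<^sup>2 / lambda_const b * (N1 (ginv (G ?x)) * (\<Sum>a\<in>UNIV. cmod (wd (dz a) u ?x))\<^sup>2)"
    using maximum_point_estimate[OF tz[OF t z] \<Lambda> u0 Snn grad time hess] unfolding S .
  show ?thesis
    unfolding psi_bound_def
  proof (rule maximum_point_bound[OF b s2(2) _ _ S_est u_est(1) _ u_est(2) N1_nonneg k(1) max])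
    show "0 \<le> lambda_const b + Re (u ?x)" "lambda_const b + Re (u ?x) \<le> lambda_const b + b * b"
      using \<Lambda> u0 u1 by auto
  qed (intro sum_nonneg norm_ge_zero)
qed

end
section \<open>Derivatives at a maximum\<close>

text \<open>If the second derivative were positive, the first derivative would be positive just to
  the right of 0, and by the mean value theorem f would exceed its maximum there.\<close>

lemma local_max_along_line:
  fixes f :: "'b::real_normed_vector \<Rightarrow> real"
  assumes S: "open S" "smooth_on S f" "x \<in> S" and e: "0 < e"
    and max: "\<And>s. \<bar>s\<bar> < e \<Longrightarrow> f (x + s *\<^sub>R v) \<le> f x"
  shows "frechet_derivative f (at x) v = 0"
    and "frechet_derivative (\<lambda>y. frechet_derivative f (at y) v) (at x) v \<le> 0"
proof -
  define fv where "fv = (\<lambda>y. frechet_derivative f (at y) v)"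
  have sm: "smooth_on S fv" unfolding fv_def by (rule smooth_on_derivative[OF S(1,2)])
  have "isCont (\<lambda>s. x + s *\<^sub>R v) 0" by (intro continuous_intros)
  then have "\<forall>\<^sub>F s in at 0. x + s *\<^sub>R v \<in> S"
    using S(1,3) by (intro topological_tendstoD) (auto simp: isCont_def)
  then obtain d where d: "0 < d" "\<And>s. \<bar>s\<bar> < d \<Longrightarrow> x + s *\<^sub>R v \<in> S"
    using S(3) unfolding eventually_at by (metis dist_0_norm dist_commute real_norm_def scaleR_zero_left add_0_right UNIV_I)
  have D: "((\<lambda>s. f (x + s *\<^sub>R v)) has_real_derivative fv (x + s *\<^sub>R v)) (at s)" if "\<bar>s\<bar> < d" for s
    unfolding fv_def
    by (rule has_real_derivative_along_line[OF smooth_on_differentiable[OF S(1,2) d(2)[OF that]]])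
  have D0: "((\<lambda>s. f (x + s *\<^sub>R v)) has_real_derivative fv x) (at 0)" using D[of 0] d(1) by simp
  have z: "fv x = 0"
    by (rule DERIV_local_max[OF D0 e]) (use max in auto)
  then show "frechet_derivative f (at x) v = 0" by (simp add: fv_def)
  show "frechet_derivative (\<lambda>y. frechet_derivative f (at y) v) (at x) v \<le> 0"
  proof (rule ccontr)
    assume neg: "\<not> ?thesis"
    have "((\<lambda>s. fv (x + s *\<^sub>R v)) has_real_derivative frechet_derivative fv (at x) v) (at 0)"
      using has_real_derivative_along_line[of fv x 0 v] smooth_on_differentiable[OF S(1) sm S(3)] by simp
    from DERIV_pos_inc_right[OF this] neg obtain d' where d': "0 < d'"
      "\<And>h. 0 < h \<Longrightarrow> h < d' \<Longrightarrow> 0 < fv (x + h *\<^sub>R v)"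
      using z by (auto simp: fv_def)
    define h where "h = min d (min d' e) / 2"
    have h: "0 < h" "h < d" "h < d'" "h < e" using d d' e by (auto simp: h_def)
    obtain \<xi> where "0 < \<xi>" "\<xi> < h"
      "f (x + h *\<^sub>R v) - f (x + 0 *\<^sub>R v) = (h - 0) * fv (x + \<xi> *\<^sub>R v)"
      using MVT2[of 0 h "\<lambda>s. f (x + s *\<^sub>R v)" "\<lambda>s. fv (x + s *\<^sub>R v)"] h D by auto
    moreover have "0 < h * fv (x + \<xi> *\<^sub>R v)" using d'(2)[of \<xi>] \<open>0 < \<xi>\<close> \<open>\<xi> < h\<close> h by simp
    ultimately show False using max[of h] h by simp
  qed
qed

lemma complex_basis_expansion:
  "(w :: complex^'n::finite) = (\<Sum>m\<in>UNIV. Re (w $ m) *\<^sub>R axis m 1 + Im (w $ m) *\<^sub>R axis m \<i>)"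
proof -
  have "(\<Sum>m\<in>UNIV. Re (w $ m) *\<^sub>R axis m 1 + Im (w $ m) *\<^sub>R axis m \<i>) $ j
     = (\<Sum>m\<in>UNIV. if m = j then w $ j else 0)" for j
    unfolding sum_component
    by (intro sum.cong refl) (auto simp: axis_def complex_eq_iff)
  then show ?thesis by (simp add: vec_eq_iff)
qed

text \<open>For a merely real linear D, the combination of its values on w and on i w is complex
  linear in w; it is therefore determined on the standard basis.\<close>

lemma complex_direction_expansion:
  fixes D :: "complex^'n::finite \<Rightarrow> complex"
  assumes "linear D"
  shows "D w - \<i> * D (\<chi> m. \<i> * w $ m) = (\<Sum>m\<in>UNIV. w $ m * (D (axis m 1) - \<i> * D (axis m \<i>)))"
proof -
  have e: "D w = (\<Sum>m\<in>UNIV. Re (w $ m) *\<^sub>R D (axis m 1) + Im (w $ m) *\<^sub>R D (axis m \<i>))" for w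
    by (subst complex_basis_expansion[of w])
      (simp only: linear_sum[OF assms] linear_add[OF assms] linear_scale[OF assms])
  have c: "w $ m = of_real (Re (w $ m)) + \<i> * of_real (Im (w $ m))" for m
    by (rule complex_eq)
  show ?thesis
    unfolding e[of w] e[of "\<chi> m. \<i> * w $ m"] sum_distrib_left sum_subtractf[symmetric]
  proof (intro sum.cong refl)
    fix m
    show "Re (w $ m) *\<^sub>R D (axis m 1) + Im (w $ m) *\<^sub>R D (axis m \<i>) -
        \<i> * (Re ((\<chi> m. \<i> * w $ m) $ m) *\<^sub>R D (axis m 1) + Im ((\<chi> m. \<i> * w $ m) $ m) *\<^sub>R D (axis m \<i>))
      = w $ m * (D (axis m 1) - \<i> * D (axis m \<i>))"
      by (subst (5) c) (simp add: scaleR_conv_of_real algebra_simps)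
  qed
qed

text \<open>The direction of the operator that combines the \<open>wd (dz m)\<close> with the
  coefficients of w; it allows the Laplacian to be written in an orthonormal frame.\<close>

definition dir :: "complex^'n::finite \<Rightarrow> (real \<times> (complex^'n)) \<times> (real \<times> (complex^'n))" where
  "dir w = ((0, w), (0, \<chi> m. \<i> * w $ m))"

lemma wd_dir:
  assumes "f differentiable (at x)"
  shows "wd (dir w) f x = (\<Sum>m\<in>UNIV. w $ m * wd (dz m) f x)"
proof -
  have lin: "linear (frechet_derivative f (at x))" by (rule linear_frechet_derivative[OF assms])
  have "linear (\<lambda>v. frechet_derivative f (at x) (0, v))"
  proof (rule linearI)
    show "frechet_derivative f (at x) (0, v + v') = frechet_derivative f (at x) (0, v) + frechet_derivative f (at x) (0, v')" for v v'
      using linear_add[OF lin, of "(0, v)" "(0, v')"] by simp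
    show "frechet_derivative f (at x) (0, r *\<^sub>R v) = r *\<^sub>R frechet_derivative f (at x) (0, v)" for r v
      using linear_scale[OF lin, of r "(0, v)"] by simp
  qed
  from complex_direction_expansion[OF this, of w] show ?thesis
    by (simp add: wd_def dir_def dz_def sum_divide_distrib)
qed

context chart_flow
begin

lemma wd_bar_dir:
  assumes "smooth_on (J \<times> \<Omega>) f" "x \<in> J \<times> \<Omega>"
  shows "wd (bar (dir w)) f x = (\<Sum>m\<in>UNIV. cnj (w $ m) * wd (bar (dz m)) f x)"
proof -
  have c: "smooth_on (J \<times> \<Omega>) (\<lambda>y. cnj (f y))" by (rule smooth_on_cnj[OF assms(1)])
  have "wd (bar \<xi>) f x = cnj (wd \<xi> (\<lambda>y. cnj (f y)) x)" for \<xi>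
    using wd_cnj[OF c assms(2), of "bar \<xi>"] by simp
  then show ?thesis
    using wd_dir[OF smooth_on_differentiable[OF open_W c assms(2)], of w] by simp
qed

text \<open>Only earlier times are compared, so the time derivative is merely nonnegative. For the
  Laplacian, the inverse metric is diagonalised by an orthonormal frame, where it becomes a sum of
  real second derivatives.\<close>

lemma maximum_derivatives:
  assumes f: "smooth_on (J \<times> \<Omega>) f" "\<And>y. y \<in> J \<times> \<Omega> \<Longrightarrow> cnj (f y) = f y"
    and t: "t \<in> J" and z: "z \<in> \<Omega>"
    and max: "\<And>t' z'. t' \<in> J \<Longrightarrow> t' \<le> t \<Longrightarrow> z' \<in> \<Omega> \<Longrightarrow> Re (f (t', z')) \<le> Re (f (t, z))"
  shows "wd (dz a) f (t, z) = 0" "0 \<le> Re (wd dt f (t, z))" "Re (lap f (t, z)) \<le> 0"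
proof -
  let ?x = "(t, z)"
  note tz = tz[OF t z]
  have sRe: "smooth_on (J \<times> \<Omega>) (\<lambda>y. Re (f y))" by (rule smooth_on_bounded_linear[OF bounded_linear_Re f(1)])
  have fd: "frechet_derivative (\<lambda>y. Re (f y)) (at y) v = Re (frechet_derivative f (at y) v)" if "y \<in> J \<times> \<Omega>" for y v
    by (rule frechet_derivative_bounded_linear[OF bounded_linear_Re smooth_on_differentiable[OF open_W f(1) that]])
  \<comment> \<open>A real-valued f has real derivatives, so it is enough to test real
    parts.\<close>
  have real: "frechet_derivative f (at ?x) v = of_real (Re (frechet_derivative f (at ?x) v))" for v
  proof -
    have "frechet_derivative f (at ?x) = frechet_derivative (\<lambda>y. cnj (f y)) (at ?x)"
      by (rule frechet_derivative_cong_open[OF open_W tz]) (simp add: f(2))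
    then have "frechet_derivative f (at ?x) v = cnj (frechet_derivative f (at ?x) v)"
      using frechet_derivative_bounded_linear[OF bounded_linear_cnj smooth_on_differentiable[OF open_W f(1) tz]] by metis
    then show ?thesis by (metis Reals_cnj_iff of_real_Re)
  qed
  have dd: "frechet_derivative (\<lambda>y. frechet_derivative (\<lambda>y. Re (f y)) (at y) v) (at ?x) v
      = Re (frechet_derivative (\<lambda>y. frechet_derivative f (at y) v) (at ?x) v)" for v
  proof -
    have "frechet_derivative (\<lambda>y. frechet_derivative (\<lambda>y. Re (f y)) (at y) v) (at ?x)
       = frechet_derivative (\<lambda>y. Re (frechet_derivative f (at y) v)) (at ?x)"
      by (rule frechet_derivative_cong_open[OF open_W tz fd])
    then show ?thesis
      using frechet_derivative_bounded_linear[OF bounded_linear_Re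
          smooth_on_differentiable[OF open_W smooth_on_derivative[OF open_W f(1)] tz]] by simp
  qed
  have spatial: "frechet_derivative f (at ?x) (0, w) = 0"
    "Re (frechet_derivative (\<lambda>y. frechet_derivative f (at y) (0, w)) (at ?x) (0, w)) \<le> 0" for w
  proof -
    have "isCont (\<lambda>s. z + s *\<^sub>R w) 0" by (intro continuous_intros)
    then have "\<forall>\<^sub>F s in at 0. z + s *\<^sub>R w \<in> \<Omega>"
      using open_\<Omega> z by (intro topological_tendstoD) (auto simp: isCont_def)
    then obtain e where e: "0 < e" "\<And>s. \<bar>s\<bar> < e \<Longrightarrow> z + s *\<^sub>R w \<in> \<Omega>"
      using z unfolding eventually_at by (metis dist_0_norm dist_commute real_norm_def scaleR_zero_left add_0_right UNIV_I)
    have m: "Re (f (?x + s *\<^sub>R (0, w))) \<le> Re (f ?x)" if "\<bar>s\<bar> < e" for s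
      using max[OF t order.refl e(2)[OF that]] by simp
    note l = local_max_along_line[OF open_W sRe tz e(1) m]
    show "frechet_derivative f (at ?x) (0, w) = 0"
      using l(1) real[of "(0, w)"] unfolding fd[OF tz] by simp
    show "Re (frechet_derivative (\<lambda>y. frechet_derivative f (at y) (0, w)) (at ?x) (0, w)) \<le> 0"
      using l(2) unfolding dd .
  qed
  show "wd (dz a) f ?x = 0" by (simp add: wd_def dz_def spatial(1))
  show "0 \<le> Re (wd dt f ?x)"
  proof (rule ccontr)
    assume n: "\<not> 0 \<le> Re (wd dt f ?x)"
    have lin: "linear (frechet_derivative f (at ?x))"
      by (rule linear_frechet_derivative[OF smooth_on_differentiable[OF open_W f(1) tz]])
    have 2: "frechet_derivative f (at ?x) (2, 0) = 2 *\<^sub>R frechet_derivative f (at ?x) (1, 0)"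
      using linear_scale[OF lin, of 2 "(1, 0)"] by simp
    have neg: "Re (frechet_derivative f (at ?x) (1, 0)) < 0"
      using n spatial(1)[of 0] by (simp add: wd_def dt_def 2)
    have "((\<lambda>s. Re (f (?x + s *\<^sub>R (1, 0)))) has_real_derivative Re (frechet_derivative f (at ?x) (1, 0))) (at 0)"
      using has_real_derivative_along_line[of "\<lambda>y. Re (f y)" ?x 0 "(1, 0)"]
        smooth_on_differentiable[OF open_W sRe tz] fd[OF tz] by simp
    from DERIV_neg_dec_left[OF this neg] obtain d where d: "0 < d"
      "\<And>h. 0 < h \<Longrightarrow> h < d \<Longrightarrow> Re (f ?x) < Re (f (t - h, z))" by auto
    obtain e where e: "0 < e" "ball t e \<subseteq> J" using open_J t open_contains_ball by blast
    define h where "h = min d e / 2"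
    have h: "0 < h" "h < d" "t - h \<in> ball t e" using d e by (auto simp: h_def dist_real_def)
    then show False using d(2)[of h] max[of "t - h" z] e z by force
  qed
  show "Re (lap f ?x) \<le> 0"
  proof -
    obtain P Q :: "complex^'n^'n" where PQ: "P ** Q = mat 1" "Q ** P = mat 1" and H: "g t z = P ** adj P"
      using cholesky[OF herm_g[OF t z] pos_g[OF t z]] by blast
    \<comment> \<open>Each row of \<open>Q\<close> contributes one complex direction to the
      Laplacian.\<close>
    have k: "ginv (G ?x) $ b $ a = (\<Sum>c\<in>UNIV. cnj (Q $ c $ b) * Q $ c $ a)" for a b
      unfolding G_def fst_conv snd_conv H frame_ginv[OF PQ] by (simp add: matrix_mult_nth)
    have dirs: "wd (bar (dir w)) (wd (dir w) f) ?x
      = (\<Sum>a\<in>UNIV. \<Sum>b\<in>UNIV. cnj (w $ b) * w $ a * wd (bar (dz b)) (wd (dz a) f) ?x)" for w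
    proof -
      have "wd (dir w) f y = (\<Sum>m\<in>UNIV. w $ m * wd (dz m) f y)" if "y \<in> J \<times> \<Omega>" for y
        by (rule wd_dir[OF smooth_on_differentiable[OF open_W f(1) that]])
      then have "wd (bar (dir w)) (wd (dir w) f) ?x = wd (bar (dir w)) (\<lambda>y. \<Sum>m\<in>UNIV. w $ m * wd (dz m) f y) ?x"
        by (rule wd_cong[OF _ tz])
      also have "\<dots> = (\<Sum>a\<in>UNIV. w $ a * wd (bar (dir w)) (wd (dz a) f) ?x)"
        by (subst wd_sum[OF smooth_on_mult[OF smooth_on_const smooth_on_wd[OF f(1)]] tz])
          (simp add: wd_mult[OF smooth_on_const smooth_on_wd[OF f(1)] tz])
      also have "\<dots> = (\<Sum>a\<in>UNIV. \<Sum>b\<in>UNIV. cnj (w $ b) * w $ a * wd (bar (dz b)) (wd (dz a) f) ?x)"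
        by (simp add: wd_bar_dir[OF smooth_on_wd[OF f(1)] tz] sum_distrib_left mult_ac)
      finally show ?thesis .
    qed
    \<comment> \<open>The operator in direction w is a quarter of the sum of the second derivatives
      along w and i w: the mixed ones cancel by symmetry.\<close>
    have neg: "Re (wd (bar (dir w)) (wd (dir w) f) ?x) \<le> 0" for w
    proof -
      define v where "v = ((0, w) :: real \<times> (complex^'n))"
      define v' where "v' = ((0, \<chi> m. \<i> * w $ m) :: real \<times> (complex^'n))"
      let ?D = "\<lambda>v y. frechet_derivative f (at y) v"
      have sD: "smooth_on (J \<times> \<Omega>) (?D v)" for v by (rule smooth_on_derivative[OF open_W f(1)])
      have "wd (dir w) f = (\<lambda>y. (1/2) * (?D v y - \<i> * ?D v' y))"
        by (simp add: fun_eq_iff wd_def dir_def v_def v'_def)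
      then have 1: "wd (bar (dir w)) (wd (dir w) f) ?x = (1/2) * (wd (bar (dir w)) (?D v) ?x - \<i> * wd (bar (dir w)) (?D v') ?x)"
        by (simp only: wd_mult[OF smooth_on_const smooth_on_diff[OF sD smooth_on_mult[OF smooth_on_const sD]] tz]
            wd_diff[OF sD smooth_on_mult[OF smooth_on_const sD] tz] wd_mult[OF smooth_on_const sD tz] wd_const)
          simp
      have 2: "wd (bar (dir w)) (?D a) ?x = (frechet_derivative (?D a) (at ?x) v + \<i> * frechet_derivative (?D a) (at ?x) v') / 2" for a
        using linear_neg[OF linear_frechet_derivative[OF smooth_on_differentiable[OF open_W sD tz]], of a v']
        by (simp add: wd_def bar_def dir_def v_def v'_def)
      have 3: "frechet_derivative (?D v') (at ?x) v = frechet_derivative (?D v) (at ?x) v'"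
        by (rule complex_derivatives_commute[OF open_W f(1) tz])
      have "(1/2) * ((p + \<i> * q) / 2 - \<i> * ((q + \<i> * r) / 2)) = (p + r) / 4" for p q r :: complex
        by (simp add: field_simps)
      then have 4: "wd (bar (dir w)) (wd (dir w) f) ?x
         = (frechet_derivative (?D v) (at ?x) v + frechet_derivative (?D v') (at ?x) v') / 4"
        unfolding 1 2 3 .
      show ?thesis unfolding 4 using spatial(2)[of w] spatial(2)[of "\<chi> m. \<i> * w $ m"] by (simp add: v_def v'_def)
    qed
    have "lap f ?x = (\<Sum>a\<in>UNIV. \<Sum>b\<in>UNIV. \<Sum>c\<in>UNIV. cnj (Q $ c $ b) * Q $ c $ a * wd (bar (dz b)) (wd (dz a) f) ?x)"
      unfolding lap_def k sum_distrib_right ..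
    also have "\<dots> = (\<Sum>a\<in>UNIV. \<Sum>c\<in>UNIV. \<Sum>b\<in>UNIV. cnj (Q $ c $ b) * Q $ c $ a * wd (bar (dz b)) (wd (dz a) f) ?x)"
      by (intro sum.cong refl sum.swap)
    also have "\<dots> = (\<Sum>c\<in>UNIV. wd (bar (dir (Q $ c))) (wd (dir (Q $ c)) f) ?x)"
      unfolding dirs by (rule sum.swap)
    finally have "Re (lap f ?x) = (\<Sum>c\<in>UNIV. Re (wd (bar (dir (Q $ c))) (wd (dir (Q $ c)) f) ?x))" by simp
    also have "\<dots> \<le> 0" by (intro sum_nonpos neg)
    finally show ?thesis .
  qed
qed

end


section \<open>Change of chart\<close>

lemma conn0_christoffel: "christoffel h i j k z = conn0 h i z $ j $ k"
  by (simp add: christoffel_def conn0_def d_hol_wd matrix_mult_nth mult.commute)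

lemma inner_21_Psi:
  "inner_21 H (\<lambda>i j k. Psi h hh i j k z) (\<lambda>i j k. Psi h hh i j k z)
    = ip H (\<lambda>i. conn0 h i z - conn0 hh i z) (\<lambda>i. conn0 h i z - conn0 hh i z)"
  by (simp add: Psi_def conn0_christoffel flip: ip_inner_21)

text \<open>The Cauchy-Riemann equations make the differential of F complex linear, so no conjugate
  derivative of f appears.\<close>

lemma holomorphic_chain_rule:
  fixes F :: "complex^'n::finite \<Rightarrow> complex^'n"
  assumes "open U" "holomorphic_map_on U F" "z \<in> U" "f differentiable (at (F z))"
  shows "wd (dz0 i) (\<lambda>w. f (F w)) z = (\<Sum>m\<in>UNIV. d_hol i (\<lambda>w. F w $ m) z * wd (dz0 m) f (F z))"
proof -
  have sF: "smooth_on U F" and hol: "\<And>p i. d_bar i (\<lambda>w. F w $ p) z = 0"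
    using assms(2,3) unfolding holomorphic_map_on_def by auto
  define D where "D = frechet_derivative F (at z)"
  have dF: "(F has_derivative D) (at z)"
    using smooth_on_differentiable[OF assms(1) sF assms(3)] by (simp add: D_def frechet_derivative_works)
  have comp: "frechet_derivative (\<lambda>w. F w $ p) (at z) v = D v $ p" for p v
    unfolding D_def
    by (rule frechet_derivative_bounded_linear[OF bounded_linear_vec_nth
        smooth_on_differentiable[OF assms(1) sF assms(3)]])
  have "D (axis i \<i>) $ p = \<i> * D (axis i 1) $ p" for p
  proof -
    have "D (axis i 1) $ p + \<i> * D (axis i \<i>) $ p = 0"
      using hol[of i p] by (simp add: d_bar_def comp)
    then have "\<i> * (D (axis i 1) $ p + \<i> * D (axis i \<i>) $ p) = 0" by simp
    then show ?thesis by (simp add: distrib_left flip: mult.assoc)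
  qed
  then have iD: "D (axis i \<i>) = (\<chi> p. \<i> * D (axis i 1) $ p)" by (simp add: vec_eq_iff)
  have J: "d_hol i (\<lambda>w. F w $ p) z = D (axis i 1) $ p" for p
    by (simp add: d_hol_def comp iD flip: mult.assoc)
  have "((\<lambda>w. f (F w)) has_derivative (\<lambda>v. frechet_derivative f (at (F z)) (D v))) (at z)"
    using has_derivative_compose[OF dF] assms(4) frechet_derivative_works by blast
  from frechet_derivative_at[OF this, symmetric]
  have "wd (dz0 i) (\<lambda>w. f (F w)) z = (frechet_derivative f (at (F z)) (D (axis i 1))
      - \<i> * frechet_derivative f (at (F z)) (\<chi> p. \<i> * D (axis i 1) $ p)) / 2"
    by (simp add: wd_def dz0_def iD)
  also have "\<dots> = (\<Sum>m\<in>UNIV. D (axis i 1) $ m * wd (dz0 m) f (F z))"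
    unfolding complex_direction_expansion[OF linear_frechet_derivative[OF assms(4)]]
    by (simp add: wd_def dz0_def sum_divide_distrib)
  finally show ?thesis by (simp add: J)
qed

definition jacobian :: "(complex^'n::finite \<Rightarrow> complex^'n) \<Rightarrow> 'n local_metric" where
  "jacobian F z = (\<chi> r p. d_hol r (\<lambda>w. F w $ p) z)"

text \<open>The inhomogeneous term contains only the Jacobian and its derivative, not the metric.
  Two metrics with the same transformation law thus have a tensorial difference of
  connections.\<close>

lemma conn0_transformation:
  fixes F :: "complex^'n::finite \<Rightarrow> complex^'n" and h h' :: "'n local_metric"
  assumes U: "open U" "holomorphic_map_on U F" "F ` U \<subseteq> V" "open V"
    and h': "msmooth V h'" "\<And>y. y \<in> V \<Longrightarrow> invertible (h' y)"
    and h: "msmooth U h" "\<And>w. w \<in> U \<Longrightarrow> invertible (h w)"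
    and eq: "\<And>w. w \<in> U \<Longrightarrow> h w = jacobian F w ** h' (F w) ** adj (jacobian F w)"
    and z: "z \<in> U"
  defines "K \<equiv> ginv (jacobian F z)"
  shows "jacobian F z ** K = mat 1" "K ** jacobian F z = mat 1"
    and "conn0 h i z = Md (dz0 i) (jacobian F) z ** K
      + jacobian F z ** (\<Sum>m\<in>UNIV. jacobian F z $ i $ m *\<^sub>m conn0 h' m (F z)) ** K"
    and "ginv (h z) = adj K ** ginv (h' (F z)) ** K"
proof -
  interpret U: open_dom U by unfold_locales (rule U(1))
  let ?J = "jacobian F" and ?H = "\<lambda>w. h' (F w)"
  have sF: "smooth_on U F" and hol: "\<And>p i w. w \<in> U \<Longrightarrow> d_bar i (\<lambda>w. F w $ p) w = 0"
    using U(2) unfolding holomorphic_map_on_def by auto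
  have sFp: "smooth_on U (\<lambda>w. F w $ p)" for p
    by (rule smooth_on_bounded_linear[OF bounded_linear_vec_nth sF])
  have sJ: "msmooth U ?J"
    unfolding msmooth_def jacobian_def by (simp add: d_hol_wd U.smooth_on_wd sFp)
  \<comment> \<open>Since h = J h' adj J is invertible, J has a right inverse; for square matrices
    this is enough.\<close>
  have invJ: "invertible (?J w)" if "w \<in> U" for w
  proof -
    have "?J w ** (?H w ** adj (?J w) ** ginv (h w)) = h w ** ginv (h w)"
      by (simp add: eq[OF that] matrix_mul_assoc)
    then have "?J w ** (?H w ** adj (?J w) ** ginv (h w)) = mat 1"
      using matrix_inv_inverse(1)[OF h(2)[OF that]] by simp
    then show ?thesis unfolding invertible_def using matrix_left_right_inverse by blast
  qed
  show K: "?J z ** K = mat 1" "K ** ?J z = mat 1"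
    unfolding K_def using matrix_inv_inverse[OF invJ[OF z]] by auto
  have FV: "F w \<in> V" if "w \<in> U" for w using U(3) that by auto
  \<comment> \<open>Smoothness of the pulled-back metric is obtained by solving the transformation
    law for it, not by composing smooth maps.\<close>
  have sH: "msmooth U ?H"
  proof -
    have "?H w = ginv (?J w) ** h w ** adj (ginv (?J w))" if "w \<in> U" for w
    proof -
      note i = matrix_inv_inverse[OF invJ[OF that]]
      have "adj (?J w) ** adj (ginv (?J w)) = mat 1"
        using i(2) by (metis adj_mat1 adj_mult)
      moreover have "ginv (?J w) ** h w ** adj (ginv (?J w))
          = (ginv (?J w) ** ?J w) ** ?H w ** (adj (?J w) ** adj (ginv (?J w)))"
        unfolding eq[OF that] by (simp add: matrix_mul_assoc)
      ultimately show ?thesis using i(2) by simp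
    qed
    moreover have "msmooth U (\<lambda>w. ginv (?J w) ** h w ** adj (ginv (?J w)))"
      by (intro msmooth_mult msmooth_adj msmooth_ginv sJ invJ h(1))
    ultimately show ?thesis
      unfolding msmooth_def using smooth_on_cong[of U "\<lambda>w. ?H w $ _ $ _"] by simp
  qed
  have wbar: "wd (bar (dz0 i)) (\<lambda>w. F w $ p) w = 0" if "w \<in> U" for i p w
    using hol[OF that] d_bar_wd[OF smooth_on_differentiable[OF U(1) sFp that]] by metis
  \<comment> \<open>J is holomorphic, so a holomorphic derivative does not act on the factor
    \<open>adj J\<close>.\<close>
  have dJ: "Md (bar (dz0 i)) ?J z = 0" for i
  proof -
    have "wd (bar (dz0 i)) (wd (dz0 r) (\<lambda>w. F w $ p)) z = 0" for r p
    proof -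
      have "wd (bar (dz0 i)) (wd (dz0 r) (\<lambda>w. F w $ p)) z = wd (dz0 r) (wd (bar (dz0 i)) (\<lambda>w. F w $ p)) z"
        by (rule U.wd_commute[OF sFp z])
      also have "\<dots> = wd (dz0 r) (\<lambda>w. 0) z"
        by (rule U.wd_cong[OF wbar z])
      finally show ?thesis by simp
    qed
    then show ?thesis by (simp add: vec_eq_iff jacobian_def d_hol_wd)
  qed
  have df: "(\<lambda>y. h' y $ r $ s) differentiable (at y)" if "y \<in> V" for r s y
    by (rule smooth_on_differentiable[OF U(4) msmoothD[OF h'(1)] that])
  have dH: "Md (dz0 i) ?H z = (\<Sum>m\<in>UNIV. ?J z $ i $ m *\<^sub>m Md (dz0 m) h' (F z))" for i
    using holomorphic_chain_rule[OF U(1,2) z df[OF FV[OF z]]] by (simp add: vec_eq_iff sum_component jacobian_def)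
  have 1: "adj (?J z) ** adj K = mat 1" "adj K ** adj (?J z) = mat 1"
    using K by (metis adj_mat1 adj_mult)+
  note 2 = matrix_inv_inverse[OF h'(2)[OF FV[OF z]]]
  show gi: "ginv (h z) = adj K ** ginv (?H z) ** K"
  proof (rule matrix_inv_eqI)
    have "h z ** (adj K ** ginv (?H z) ** K) = ?J z ** (?H z ** ((adj (?J z) ** adj K) ** ginv (?H z))) ** K"
      by (simp add: eq[OF z] matrix_mul_assoc)
    then show "h z ** (adj K ** ginv (?H z) ** K) = mat 1" by (simp add: 1 2 K)
    have "adj K ** ginv (?H z) ** K ** h z = adj K ** (ginv (?H z) ** ((K ** ?J z) ** ?H z)) ** adj (?J z)"
      by (simp add: eq[OF z] matrix_mul_assoc)
    then show "adj K ** ginv (?H z) ** K ** h z = mat 1" by (simp add: 1 2 K)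
  qed
  have "Md (dz0 i) h z = Md (dz0 i) (\<lambda>w. ?J w ** ?H w ** adj (?J w)) z"
    by (rule U.Md_cong[OF eq z])
  also have "\<dots> = Md (dz0 i) ?J z ** ?H z ** adj (?J z) + ?J z ** Md (dz0 i) ?H z ** adj (?J z)"
    by (simp add: U.Md_mult U.Md_adj msmooth_mult msmooth_adj sJ sH z dJ matrix_add_rdistrib')
      (simp add: vec_eq_iff matrix_mult_nth)
  finally have "conn0 h i z = Md (dz0 i) ?J z ** (?H z ** ((adj (?J z) ** adj K) ** ginv (?H z))) ** K
     + ?J z ** (Md (dz0 i) ?H z ** ((adj (?J z) ** adj K) ** ginv (?H z))) ** K"
    unfolding conn0_def gi by (simp add: matrix_mul_assoc matrix_add_rdistrib')
  also have "\<dots> = Md (dz0 i) ?J z ** K + ?J z ** (Md (dz0 i) ?H z ** ginv (?H z)) ** K"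
    by (simp add: 1 2)
  also have "Md (dz0 i) ?H z ** ginv (?H z) = (\<Sum>m\<in>UNIV. ?J z $ i $ m *\<^sub>m conn0 h' m (F z))"
    unfolding dH conn0_def by (simp add: matrix_sum_left cscale_mult_left)
  finally show "conn0 h i z = Md (dz0 i) ?J z ** K
    + ?J z ** (\<Sum>m\<in>UNIV. ?J z $ i $ m *\<^sub>m conn0 h' m (F z)) ** K" .
qed

text \<open>Inside the trace the factors J and K cancel; the two remaining Jacobian factors, on the
  first indices, convert the inverse of \<open>H\<close> into that of \<open>H'\<close>.\<close>

lemma ip_transformation:
  fixes J K H H' :: "complex^'n^'n::finite"
  assumes K: "J ** K = mat 1" "K ** J = mat 1"
    and H: "H = J ** H' ** adj J" "ginv H = adj K ** ginv H' ** K"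
    and X: "\<And>i. X i = J ** (\<Sum>a\<in>UNIV. J $ i $ a *\<^sub>m Y a) ** K"
  shows "ip H X X = ip H' Y Y"
proof -
  have 1: "adj J ** adj K = mat 1" "adj K ** adj J = mat 1"
    using K by (metis adj_mat1 adj_mult)+
  let ?A = "\<lambda>i. \<Sum>a\<in>UNIV. J $ i $ a *\<^sub>m Y a"
  let ?t = "\<lambda>a b. trace (Y a ** H' ** adj (Y b) ** ginv H')"
  have t: "trace (X i ** H ** adj (X m) ** ginv H) = (\<Sum>a\<in>UNIV. \<Sum>b\<in>UNIV. J $ i $ a * cnj (J $ m $ b) * ?t a b)" for i m
  proof -
    have "X i ** H ** adj (X m) ** ginv H = J ** ?A i ** (K ** J) ** H' ** (adj J ** adj K) ** adj (?A m) ** (adj J ** adj K) ** ginv H' ** K"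
      unfolding H(2) unfolding X H(1) adj_mult by (simp only: matrix_mul_assoc)
    also have "\<dots> = J ** (?A i ** H' ** adj (?A m) ** ginv H' ** K)"
      by (simp add: 1 K matrix_mul_assoc)
    finally have "trace (X i ** H ** adj (X m) ** ginv H) = trace (J ** (?A i ** H' ** adj (?A m) ** ginv H' ** K))"
      by (rule arg_cong)
    also have "\<dots> = trace ((?A i ** H' ** adj (?A m) ** ginv H' ** K) ** J)"
      by (rule trace_mul_sym)
    also have "(?A i ** H' ** adj (?A m) ** ginv H' ** K) ** J = ?A i ** H' ** adj (?A m) ** ginv H'"
      by (simp add: K flip: matrix_mul_assoc)
    also have "trace \<dots> = (\<Sum>a\<in>UNIV. \<Sum>b\<in>UNIV. J $ i $ a * cnj (J $ m $ b) * ?t a b)"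
      unfolding adj_sum adj_cscale
      by (simp add: matrix_algebra trace_sum trace_cscale) (subst sum.swap, simp add: mult_ac)
    finally show ?thesis .
  qed
  have g: "(\<Sum>i\<in>UNIV. \<Sum>m\<in>UNIV. ginv H $ m $ i * (J $ i $ a * cnj (J $ m $ b))) = ginv H' $ b $ a" for a b
  proof -
    have "adj J ** ginv H ** J = (adj J ** adj K) ** ginv H' ** (K ** J)"
      unfolding H(2) by (simp only: matrix_mul_assoc)
    then have "ginv H' $ b $ a = (adj J ** ginv H ** J) $ b $ a" by (simp add: 1 K)
    also have "\<dots> = (\<Sum>i\<in>UNIV. \<Sum>m\<in>UNIV. ginv H $ m $ i * (J $ i $ a * cnj (J $ m $ b)))"
      by (simp add: matrix_mult_nth sum_distrib_left sum_distrib_right mult_ac)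
    finally show ?thesis by simp
  qed
  have "ip H X X = (\<Sum>i\<in>UNIV. \<Sum>m\<in>UNIV. \<Sum>a\<in>UNIV. \<Sum>b\<in>UNIV. ginv H $ m $ i * (J $ i $ a * cnj (J $ m $ b)) * ?t a b)"
    unfolding ip_def t by (simp add: sum_distrib_left mult.assoc)
  also have "\<dots> = (\<Sum>i\<in>UNIV. \<Sum>a\<in>UNIV. \<Sum>m\<in>UNIV. \<Sum>b\<in>UNIV. ginv H $ m $ i * (J $ i $ a * cnj (J $ m $ b)) * ?t a b)"
    by (intro sum.cong refl sum.swap)
  also have "\<dots> = (\<Sum>a\<in>UNIV. \<Sum>i\<in>UNIV. \<Sum>m\<in>UNIV. \<Sum>b\<in>UNIV. ginv H $ m $ i * (J $ i $ a * cnj (J $ m $ b)) * ?t a b)"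
    by (rule sum.swap)
  also have "\<dots> = (\<Sum>a\<in>UNIV. \<Sum>i\<in>UNIV. \<Sum>b\<in>UNIV. \<Sum>m\<in>UNIV. ginv H $ m $ i * (J $ i $ a * cnj (J $ m $ b)) * ?t a b)"
    by (intro sum.cong refl sum.swap)
  also have "\<dots> = (\<Sum>a\<in>UNIV. \<Sum>b\<in>UNIV. \<Sum>i\<in>UNIV. \<Sum>m\<in>UNIV. ginv H $ m $ i * (J $ i $ a * cnj (J $ m $ b)) * ?t a b)"
    by (intro sum.cong refl sum.swap)
  also have "\<dots> = ip H' Y Y"
    unfolding ip_def sum_distrib_right[symmetric] g ..
  finally show ?thesis .
qed
section \<open>Charts of the atlas\<close>

lemma posdef_frame_bound:
  fixes H :: "complex^'n^'n::finite"
  assumes "\<And>r s. H $ s $ r = cnj (H $ r $ s)" "\<And>v. v \<noteq> 0 \<Longrightarrow> herm_form H v > 0"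
  obtains b where "frame_bound b H"
proof -
  obtain P Q :: "complex^'n^'n" where PQ: "P ** Q = mat 1" "Q ** P = mat 1" "H = P ** adj P"
    using cholesky[OF assms] by blast
  have "cmod (P $ i $ j) \<le> N1 P + N1 Q" "cmod (Q $ i $ j) \<le> N1 P + N1 Q" for i j
    using entry_le_N1[of P i j] entry_le_N1[of Q i j] N1_nonneg[of P] N1_nonneg[of Q] by linarith+
  then have "frame_bound (N1 P + N1 Q) H" unfolding frame_bound_def using PQ by blast
  then show thesis by (rule that)
qed

lemma inner_11_trace:
  "inner_11 H (\<lambda>r s. A $ r $ s) (\<lambda>r s. B $ r $ s) = trace (A ** ginv H ** adj B ** ginv H)"
proof -
  have "inner_11 H (\<lambda>r s. A $ r $ s) (\<lambda>r s. B $ r $ s)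
    = (\<Sum>r\<in>UNIV. \<Sum>p\<in>UNIV. \<Sum>s\<in>UNIV. \<Sum>q\<in>UNIV. ginv H $ p $ r * (ginv H $ s $ q * A $ r $ s * cnj (B $ p $ q)))"
    unfolding inner_11_def by (subst sum.swap[of _ UNIV]) (simp add: mult_ac)
  also have "\<dots> = (\<Sum>r\<in>UNIV. \<Sum>p\<in>UNIV. \<Sum>q\<in>UNIV. \<Sum>s\<in>UNIV. ginv H $ p $ r * (ginv H $ s $ q * A $ r $ s * cnj (B $ p $ q)))"
    by (intro sum.cong refl sum.swap)
  also have "\<dots> = trace (A ** ginv H ** adj B ** ginv H)"
    unfolding trace_def matrix_mult_nth adj_nth
    by (simp add: sum_distrib_left sum_distrib_right mult_ac)
  finally show ?thesis .
qed

text \<open>The proof is the identity $\hat\nabla_i g_{j\bar l}=\Psi_{ij}^kg_{k\bar l}$.\<close>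

lemma nabla_hat_g_norm_eq:
  fixes h hh :: "'n::finite local_metric"
  assumes h: "\<And>r s. h z $ s $ r = cnj (h z $ r $ s)" "\<And>v. v \<noteq> 0 \<Longrightarrow> herm_form (h z) v > 0"
  shows "(nabla_hat_g_norm h hh z)\<^sup>2 = Re (inner_21 (h z) (\<lambda>i j k. Psi h hh i j k z) (\<lambda>i j k. Psi h hh i j k z))"
    and "S_quantity h hh z = Re (inner_21 (h z) (\<lambda>i j k. Psi h hh i j k z) (\<lambda>i j k. Psi h hh i j k z))"
proof -
  let ?P = "\<lambda>i. conn0 h i z - conn0 hh i z"
  have inv: "h z ** ginv (h z) = mat 1" "ginv (h z) ** h z = mat 1"
    using matrix_inv_inverse[OF posdef_invertible[OF h]] by auto
  have adj: "adj (h z) = h z" using h(1)[symmetric] by (simp add: vec_eq_iff)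
  obtain b where b: "frame_bound b (h z)" using posdef_frame_bound[OF h] by blast
  note nn = inner_21_nonneg[OF b, of "\<lambda>i j k. Psi h hh i j k z"]
  then show "S_quantity h hh z = Re (inner_21 (h z) (\<lambda>i j k. Psi h hh i j k z) (\<lambda>i j k. Psi h hh i j k z))"
    by (simp add: S_quantity_def norm_21_def)
  have "nabla_11 hh (\<lambda>r s w. h w $ r $ s) a r s z = (?P a ** h z) $ r $ s" for a r s
  proof -
    have "conn0 h a z ** h z = Md (dz0 a) h z"
      by (simp add: conn0_def inv flip: matrix_mul_assoc)
    then have "(?P a ** h z) $ r $ s = Md (dz0 a) h z $ r $ s - (conn0 hh a z ** h z) $ r $ s"
      by (simp add: matrix_diff_rdistrib)
    then show ?thesis by (simp add: nabla_11_def conn0_christoffel d_hol_wd matrix_mult_nth)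
  qed
  then have 1: "nabla_hat_g_norm h hh z = sqrt (Re (\<Sum>a\<in>UNIV. \<Sum>c\<in>UNIV. ginv (h z) $ c $ a *
      trace ((?P a ** h z) ** ginv (h z) ** adj (?P c ** h z) ** ginv (h z))))"
    unfolding nabla_hat_g_norm_def norm_d_11_def by (simp only: inner_11_trace)
  have "(?P a ** h z) ** ginv (h z) ** adj (?P c ** h z) ** ginv (h z) = ?P a ** h z ** adj (?P c) ** ginv (h z)" for a c
  proof -
    have "(?P a ** h z) ** ginv (h z) ** adj (?P c ** h z) ** ginv (h z)
       = ?P a ** (h z ** ginv (h z)) ** h z ** adj (?P c) ** ginv (h z)"
      by (simp only: adj_mult adj matrix_mul_assoc)
    then show ?thesis by (simp add: inv)
  qed
  with 1 have "nabla_hat_g_norm h hh z = sqrt (Re (ip (h z) ?P ?P))" by (simp only: ip_def)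
  then show "(nabla_hat_g_norm h hh z)\<^sup>2 = Re (inner_21 (h z) (\<lambda>i j k. Psi h hh i j k z) (\<lambda>i j k. Psi h hh i j k z))"
    using nn by (simp add: inner_21_Psi)
qed

context
  fixes M :: "'a::t2_space set" and \<A> :: "('a, 'n::finite) chart set"
  assumes atlas: "holomorphic_atlas M \<A>"
begin

lemma chartD:
  assumes "c \<in> \<A>"
  shows "openin (top_of_set M) (fst c)" "open (chart_img c)"
    "homeomorphism (fst c) (chart_img c) (snd c) (chart_inv c)" "fst c \<subseteq> M"
  using atlas assms unfolding holomorphic_atlas_def is_chart_def by auto

lemma chart_inv_snd: "c \<in> \<A> \<Longrightarrow> p \<in> fst c \<Longrightarrow> chart_inv c (snd c p) = p"
  using chartD(3) homeomorphism_apply1 by blast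

lemma snd_chart_inv: "c \<in> \<A> \<Longrightarrow> z \<in> chart_img c \<Longrightarrow> snd c (chart_inv c z) = z \<and> chart_inv c z \<in> fst c"
  using chartD(3) homeomorphism_apply2 homeomorphism_image2 by blast

lemma transition_snd: "c \<in> \<A> \<Longrightarrow> p \<in> fst c \<Longrightarrow> transition c d (snd c p) = snd d p"
  by (simp add: transition_def chart_inv_snd)

lemma open_overlap:
  assumes "c \<in> \<A>" "d \<in> \<A>"
  shows "open (snd c ` (fst c \<inter> fst d))"
proof -
  have "openin (top_of_set M) (fst c \<inter> fst d)"
    using chartD(1)[OF assms(1)] chartD(1)[OF assms(2)] by blast
  then have "openin (top_of_set (fst c)) (fst c \<inter> fst d)"
    using chartD(4)[OF assms(1)] by (meson inf_le1 openin_subset_trans)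
  then have "openin (top_of_set (chart_img c)) (snd c ` (fst c \<inter> fst d))"
    using chartD(3)[OF assms(1)] homeomorphism_imp_open_map by blast
  then show ?thesis using chartD(2)[OF assms(1)] openin_open_trans by blast
qed

lemma metric_posdef:
  assumes "hermitian_metric \<A> g" "c \<in> \<A>" "z \<in> chart_img c"
  shows "g c z $ s $ r = cnj (g c z $ r $ s)" "v \<noteq> 0 \<Longrightarrow> herm_form (g c z) v > 0" "invertible (g c z)"
proof -
  show 1: "g c z $ s $ r = cnj (g c z $ r $ s)" for r s
    using assms unfolding hermitian_metric_def by blast
  show 2: "v \<noteq> 0 \<Longrightarrow> herm_form (g c z) v > 0" for v
    using assms unfolding hermitian_metric_def by blast
  show "invertible (g c z)" by (rule posdef_invertible[OF 1 2])
qed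

lemma metric_smooth: "hermitian_metric \<A> g \<Longrightarrow> c \<in> \<A> \<Longrightarrow> smooth_on (chart_img c) (g c)"
  unfolding hermitian_metric_def by blast

lemma metric_transformation:
  assumes g: "hermitian_metric \<A> g" and c: "c \<in> \<A>" "d \<in> \<A>" and z: "z \<in> snd c ` (fst c \<inter> fst d)"
  shows "g c z = jacobian (transition c d) z ** g d (transition c d z) ** adj (jacobian (transition c d) z)"
proof -
  let ?J = "jacobian (transition c d) z"
  have "g c z $ r $ s = (?J ** g d (transition c d z) ** adj ?J) $ r $ s" for r s
  proof -
    have "g c z $ r $ s = (\<Sum>p\<in>UNIV. \<Sum>q\<in>UNIV. g d (transition c d z) $ p $ q *
             d_hol r (\<lambda>w. transition c d w $ p) z * cnj (d_hol s (\<lambda>w. transition c d w $ q) z))"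
      using g c z unfolding hermitian_metric_def by blast
    also have "\<dots> = (\<Sum>q\<in>UNIV. \<Sum>p\<in>UNIV. ?J $ r $ p * g d (transition c d z) $ p $ q * cnj (?J $ s $ q))"
      by (subst sum.swap) (simp add: jacobian_def mult_ac)
    also have "\<dots> = (?J ** g d (transition c d z) ** adj ?J) $ r $ s"
      by (simp add: matrix_mult_nth sum_distrib_right)
    finally show ?thesis .
  qed
  then show ?thesis by (simp add: vec_eq_iff)
qed

text \<open>Both metrics share the inhomogeneous term of the connection, which drops out of Psi. The
  trace u is invariant because its matrix changes by conjugation with J.\<close>

lemma chart_invariance:
  assumes g: "hermitian_metric \<A> g" and gh: "hermitian_metric \<A> gh"
    and c: "c \<in> \<A>" "d \<in> \<A>" and p: "p \<in> fst c" "p \<in> fst d"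
  defines "z \<equiv> snd c p" and "z' \<equiv> snd d p"
  shows "inner_21 (g c z) (\<lambda>i j k. Psi (g c) (gh c) i j k z) (\<lambda>i j k. Psi (g c) (gh c) i j k z)
      = inner_21 (g d z') (\<lambda>i j k. Psi (g d) (gh d) i j k z') (\<lambda>i j k. Psi (g d) (gh d) i j k z')"
    and "trace (g c z ** ginv (gh c z)) = trace (g d z' ** ginv (gh d z'))"
proof -
  let ?U = "snd c ` (fst c \<inter> fst d)" and ?F = "transition c d"
  define J where "J = jacobian ?F z"
  define K where "K = ginv J"
  have zU: "z \<in> ?U" using p by (auto simp: z_def)
  have Fz: "?F z = z'" using transition_snd[OF c(1) p(1)] by (simp add: z_def z'_def)
  have U: "open ?U" by (rule open_overlap[OF c])
  have hol: "holomorphic_map_on ?U ?F" using atlas c unfolding holomorphic_atlas_def by blast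
  have FU: "?F ` ?U \<subseteq> chart_img d"
  proof (rule image_subsetI)
    fix w assume "w \<in> ?U"
    then obtain q where "q \<in> fst c" "q \<in> fst d" "w = snd c q" by blast
    then show "?F w \<in> chart_img d" using transition_snd[OF c(1), of q d] by (simp add: chart_img_def)
  qed
  have Uc: "?U \<subseteq> chart_img c" by (auto simp: chart_img_def)
  have tr: "J ** K = mat 1" "K ** J = mat 1"
      "conn0 (m c) i z = Md (dz0 i) (jacobian ?F) z ** K + J ** (\<Sum>a\<in>UNIV. J $ i $ a *\<^sub>m conn0 (m d) a z') ** K"
      "ginv (m c z) = adj K ** ginv (m d z') ** K"
      "m c z = J ** m d z' ** adj J" if m: "hermitian_metric \<A> m" for m i
  proof -
    have 1: "msmooth (chart_img d) (m d)" by (rule smooth_on_imp_msmooth[OF metric_smooth[OF m c(2)]])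
    have 2: "msmooth ?U (m c)"
      by (rule smooth_on_imp_msmooth[OF smooth_on_subset[OF metric_smooth[OF m c(1)] Uc]])
    have 3: "invertible (m c w)" if "w \<in> ?U" for w
      by (rule metric_posdef(3)[OF m c(1)]) (use that Uc in blast)
    note t = conn0_transformation[OF U hol FU chartD(2)[OF c(2)] 1 metric_posdef(3)[OF m c(2)] 2 3
        metric_transformation[OF m c] zU, folded J_def, folded K_def, unfolded Fz]
    show "J ** K = mat 1" "K ** J = mat 1"
      "conn0 (m c) i z = Md (dz0 i) (jacobian ?F) z ** K + J ** (\<Sum>a\<in>UNIV. J $ i $ a *\<^sub>m conn0 (m d) a z') ** K"
      "ginv (m c z) = adj K ** ginv (m d z') ** K"
      by (rule t; assumption)+
    show "m c z = J ** m d z' ** adj J"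
      using metric_transformation[OF m c zU] unfolding Fz J_def .
  qed
  note K = tr(1,2)[OF g]
  have "conn0 (g c) i z - conn0 (gh c) i z
      = J ** (\<Sum>a\<in>UNIV. J $ i $ a *\<^sub>m (conn0 (g d) a z' - conn0 (gh d) a z')) ** K" for i
    unfolding tr(3)[OF g] tr(3)[OF gh]
    by (simp add: cscale_diff_right sum_subtractf matrix_diff_ldistrib matrix_diff_rdistrib)
  from ip_transformation[OF K tr(5,4)[OF g] this]
  show "inner_21 (g c z) (\<lambda>i j k. Psi (g c) (gh c) i j k z) (\<lambda>i j k. Psi (g c) (gh c) i j k z)
      = inner_21 (g d z') (\<lambda>i j k. Psi (g d) (gh d) i j k z') (\<lambda>i j k. Psi (g d) (gh d) i j k z')"
    unfolding inner_21_Psi .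
  have "adj J ** adj K = mat 1" using K by (metis adj_mat1 adj_mult)
  moreover have "g c z ** ginv (gh c z) = J ** (g d z' ** (adj J ** adj K) ** ginv (gh d z')) ** K"
    unfolding tr(4)[OF gh] tr(5)[OF g] by (simp only: matrix_mul_assoc)
  ultimately have "trace (g c z ** ginv (gh c z)) = trace (J ** (g d z' ** ginv (gh d z')) ** K)" by simp
  also have "\<dots> = trace (K ** (J ** (g d z' ** ginv (gh d z'))))" by (rule trace_mul_sym)
  also have "K ** (J ** (g d z' ** ginv (gh d z'))) = g d z' ** ginv (gh d z')"
    by (simp add: matrix_mul_assoc K)
  finally show "trace (g c z ** ginv (gh c z)) = trace (g d z' ** ginv (gh d z'))" .
qed

text \<open>Open coordinate balls whose closed balls still lie in the chart image cover M. Finitely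
  many suffice, and their closed balls are the compact sets on which continuous coordinate
  quantities are bounded.\<close>

lemma finite_chart_cover:
  assumes "compact M"
  obtains D :: "(('a, 'n) chart \<times> (complex^'n) set) set" where "finite D"
    "\<And>c C. (c, C) \<in> D \<Longrightarrow> c \<in> \<A> \<and> compact C \<and> C \<subseteq> chart_img c"
    "\<And>p. p \<in> M \<Longrightarrow> \<exists>(c, C)\<in>D. p \<in> fst c \<and> snd c p \<in> C"
proof -
  define good :: "(('a, 'n) chart \<times> (complex^'n) set) set" where "good = {(c, C). c \<in> \<A> \<and> compact C \<and> C \<subseteq> chart_img c}"
  define V :: "('a, 'n) chart \<times> (complex^'n) set \<Rightarrow> 'a set"
    where "V = (\<lambda>(c, C). chart_inv c ` interior C)"
  have V: "openin (top_of_set M) (V q)" if q: "q \<in> good" for q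
  proof -
    obtain c C where cC: "q = (c, C)" "c \<in> \<A>" "C \<subseteq> chart_img c" using q by (auto simp: good_def)
    have "interior C \<subseteq> chart_img c" using cC(3) interior_subset by blast
    then have "openin (top_of_set (chart_img c)) (interior C)"
      by (intro open_subset open_interior)
    then have "openin (top_of_set (fst c)) (chart_inv c ` interior C)"
      using chartD(3)[OF cC(2)] homeomorphism_imp_open_map homeomorphism_sym by blast
    then show ?thesis using openin_trans chartD(1)[OF cC(2)] by (auto simp: V_def cC(1))
  qed
  have "M \<subseteq> \<Union> (V ` good)"
  proof
    fix p assume "p \<in> M"
    then obtain c where c: "c \<in> \<A>" "p \<in> fst c" using atlas unfolding holomorphic_atlas_def by blast
    then have "snd c p \<in> chart_img c" by (simp add: chart_img_def)
    then obtain r where r: "0 < r" "cball (snd c p) r \<subseteq> chart_img c"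
      using chartD(2)[OF c(1)] open_contains_cball by blast
    then have "(c, cball (snd c p) r) \<in> good" using c by (simp add: good_def)
    moreover have "p \<in> V (c, cball (snd c p) r)"
      using r(1) chart_inv_snd[OF c] by (auto simp: V_def interior_cball intro!: image_eqI[of _ _ "snd c p"])
    ultimately show "p \<in> \<Union> (V ` good)" by blast
  qed
  then obtain T where T: "T \<subseteq> V ` good" "finite T" "M \<subseteq> \<Union> T"
    using assms[unfolded compact_eq_openin_cover, rule_format, of "V ` good"] V by auto
  then obtain D where D: "D \<subseteq> good" "finite D" "T = V ` D" by (meson finite_subset_image)
  show thesis
  proof (rule that[OF D(2)])
    show "c \<in> \<A> \<and> compact C \<and> C \<subseteq> chart_img c" if "(c, C) \<in> D" for c C
      using that D(1) by (auto simp: good_def)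
    fix p assume "p \<in> M"
    then obtain c C where cC: "(c, C) \<in> D" "p \<in> chart_inv c ` interior C"
      using T(3) D(3) by (auto simp: V_def)
    then obtain z where z: "z \<in> interior C" "p = chart_inv c z" by blast
    have "c \<in> \<A>" "C \<subseteq> chart_img c" using cC(1) D(1) by (auto simp: good_def)
    then have "snd c p = z \<and> p \<in> fst c" using snd_chart_inv[of c z] z interior_subset by blast
    then show "\<exists>(c, C)\<in>D. p \<in> fst c \<and> snd c p \<in> C"
      using cC(1) z(1) interior_subset by blast
  qed
qed

end

section \<open>Bounds and maxima over finitely many compact sets\<close>

lemma finite_family_bounded:
  fixes f :: "'i \<Rightarrow> 'b::topological_space \<Rightarrow> real"
  assumes "finite D" "\<And>i. i \<in> D \<Longrightarrow> compact (C i)" "\<And>i. i \<in> D \<Longrightarrow> continuous_on (C i) (f i)"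
  obtains B where "1 \<le> B" "\<And>i x. i \<in> D \<Longrightarrow> x \<in> C i \<Longrightarrow> f i x \<le> B"
proof -
  have "compact (\<Union>i\<in>D. f i ` C i)"
    using assms by (intro compact_UN compact_continuous_image)
  then obtain B where B: "\<And>y. y \<in> (\<Union>i\<in>D. f i ` C i) \<Longrightarrow> \<bar>y\<bar> \<le> B"
    using compact_imp_bounded[of "\<Union>i\<in>D. f i ` C i"] unfolding bounded_iff real_norm_def by blast
  show thesis
  proof (rule that[of "max 1 B"])
    show "f i x \<le> max 1 B" if "i \<in> D" "x \<in> C i" for i x
      using B[of "f i x"] that by fastforce
  qed simp
qed

lemma finite_family_maximum:
  fixes f :: "'i \<Rightarrow> 'b::topological_space \<Rightarrow> real"
  assumes "finite D" "\<And>i. i \<in> D \<Longrightarrow> compact (C i)" "\<And>i. i \<in> D \<Longrightarrow> continuous_on (C i) (f i)"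
    and "i0 \<in> D" "x0 \<in> C i0"
  obtains i x where "i \<in> D" "x \<in> C i" "\<And>j y. j \<in> D \<Longrightarrow> y \<in> C j \<Longrightarrow> f j y \<le> f i x"
proof -
  have "compact (\<Union>i\<in>D. f i ` C i)" "(\<Union>i\<in>D. f i ` C i) \<noteq> {}"
    using assms by (auto intro!: compact_UN compact_continuous_image)
  then obtain s where s: "s \<in> (\<Union>i\<in>D. f i ` C i)" "\<And>t. t \<in> (\<Union>i\<in>D. f i ` C i) \<Longrightarrow> t \<le> s"
    using compact_attains_sup by meson
  then obtain i x where "i \<in> D" "x \<in> C i" "s = f i x" by blast
  then show thesis using s(2) by (intro that[of i x]) auto
qed
section \<open>The maximum principle\<close>

context chart_flow
begin

lemma gdot_plus_ric_eq:
  assumes "t \<in> J" "z \<in> \<Omega>" "J \<subseteq> I"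
  shows "vector_derivative (\<lambda>u. g u z $ r $ s) (at t within I) + second_chern_ricci (g t) r s z = E (t, z) $ r $ s"
  by (simp add: E_def time_derivative_eq[OF assms] second_chern_ricci_eq[OF assms(1,2)])

lemma nabla_11_eq:
  assumes t: "t \<in> J" and z: "z \<in> \<Omega>" and A: "\<And>r s w. w \<in> \<Omega> \<Longrightarrow> A r s w = E (t, w) $ r $ s"
  shows "nabla_11 (g t) A a r s z = (Md (dz a) E (t, z) - conn G a (t, z) ** E (t, z)) $ r $ s"
proof -
  have "d_hol a (A r s) z = wd (dz a) (\<lambda>x. E x $ r $ s) (t, z)"
    by (rule d_hol_slice[OF msmoothD[OF smooth_E] t z A])
  then show ?thesis
    by (simp add: nabla_11_def A[OF z] christoffel_eq[OF t z] matrix_mult_nth)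
qed

end

text \<open>Free of square roots; by \<open>nabla_hat_g_norm_eq\<close> it equals
  \<open>S_quantity\<close> and the square of \<open>nabla_hat_g_norm\<close> for positive definite
  metrics.\<close>

definition S_fun :: "'n::finite local_metric \<Rightarrow> 'n local_metric \<Rightarrow> complex^'n \<Rightarrow> real" where
  "S_fun h hh z = Re (inner_21 (h z) (\<lambda>i j k. Psi h hh i j k z) (\<lambda>i j k. Psi h hh i j k z))"

definition Q_fun :: "real \<Rightarrow> 'n::finite local_metric \<Rightarrow> 'n local_metric \<Rightarrow> complex^'n \<Rightarrow> real" where
  "Q_fun \<Lambda> h hh z = (\<Lambda> + Re (trace (h z ** ginv (hh z)))) * S_fun h hh z"

lemma continuous_on_S_fun:
  assumes "open \<Omega>" "msmooth \<Omega> h" "\<And>z. z \<in> \<Omega> \<Longrightarrow> invertible (h z)"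
    "msmooth \<Omega> hh" "\<And>z. z \<in> \<Omega> \<Longrightarrow> invertible (hh z)"
  shows "continuous_on \<Omega> (S_fun h hh)"
proof -
  interpret open_dom \<Omega> by unfold_locales (rule assms(1))
  have i: "msmooth \<Omega> (\<lambda>y. ginv (h y))" "msmooth \<Omega> (\<lambda>y. ginv (hh y))"
    by (rule msmooth_ginv[OF assms(2,3)], assumption) (rule msmooth_ginv[OF assms(4,5)])
  have c: "msmooth \<Omega> (\<lambda>z. conn0 h a z - conn0 hh a z)" for a
    unfolding conn0_def by (intro msmooth_diff msmooth_mult msmooth_Md assms i)
  have "smooth_on \<Omega> (\<lambda>z. ip (h z) (\<lambda>a. conn0 h a z - conn0 hh a z) (\<lambda>a. conn0 h a z - conn0 hh a z))"
    unfolding ip_def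
    by (intro smooth_on_sum smooth_on_mult smooth_on_trace msmooth_mult msmooth_adj msmoothD[OF i(1)] c i assms(2))
  then show ?thesis
    unfolding S_fun_def inner_21_Psi
    by (intro continuous_on_Re smooth_on_imp_continuous_on)
qed

text \<open>The interval may contain its end point 0. Spatial derivatives of a time slice are read
  off from derivatives within the product set, which are jointly continuous up to that end
  point.\<close>

lemma continuous_on_Q_fun:
  fixes g :: "real \<Rightarrow> 'n::finite local_metric"
  assumes \<Omega>: "open \<Omega>" and g: "smooth_on (I \<times> \<Omega>) (\<lambda>(t, z). g t z)"
    and inv: "\<And>t z. t \<in> I \<Longrightarrow> z \<in> \<Omega> \<Longrightarrow> invertible (g t z)"
    and gh: "msmooth \<Omega> gh" "\<And>z. z \<in> \<Omega> \<Longrightarrow> invertible (gh z)"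
  shows "continuous_on (I \<times> \<Omega>) (\<lambda>(t, z). Q_fun \<Lambda> (g t) gh z)"
proof -
  interpret open_dom \<Omega> by unfold_locales (rule \<Omega>)
  define G where "G = (\<lambda>x. g (fst x) (snd x))"
  have "G = (\<lambda>(t, z). g t z)" by (auto simp: G_def fun_eq_iff)
  then have sG: "msmooth (I \<times> \<Omega>) G" using smooth_on_imp_msmooth[OF g] by simp
  have sI: "msmooth (I \<times> \<Omega>) (\<lambda>x. ginv (G x))"
    by (rule msmooth_ginv[OF sG]) (auto simp: G_def inv)
  have cont: "continuous_on (I \<times> \<Omega>) (\<lambda>x. F x $ r $ s)" if "msmooth (I \<times> \<Omega>) F" for F :: "real \<times> (complex^'n) \<Rightarrow> complex^'n^'n" and r s
    by (rule smooth_on_imp_continuous_on[OF msmoothD[OF that]])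
  have cont0: "continuous_on (I \<times> \<Omega>) (\<lambda>x. F (snd x) $ r $ s)" if "msmooth \<Omega> F" for F :: "complex^'n \<Rightarrow> complex^'n^'n" and r s
    by (rule continuous_on_compose2[OF smooth_on_imp_continuous_on[OF msmoothD[OF that]]])
      (auto intro: continuous_intros)
  have sL: "msmooth \<Omega> (\<lambda>z. ginv (gh z))" by (rule msmooth_ginv[OF gh])
  have sh: "msmooth \<Omega> (conn0 gh i)" for i
    unfolding conn0_def by (intro msmooth_mult msmooth_Md gh(1) sL)
  have dG: "continuous_on (I \<times> \<Omega>) (\<lambda>x. d_hol i (\<lambda>w. g (fst x) w $ j $ r) (snd x))" for i j r
  proof -
    obtain f' where f': "\<And>x. x \<in> I \<times> \<Omega> \<Longrightarrow> ((\<lambda>x. G x $ j $ r) has_derivative f' x) (at x within I \<times> \<Omega>)"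
      "\<And>v. continuous_on (I \<times> \<Omega>) (\<lambda>x. f' x v)"
      using smooth_on_obtain_derivative[OF msmoothD[OF sG]] by metis
    have eq: "d_hol i (\<lambda>w. g (fst x) w $ j $ r) (snd x) = (f' x (0, axis i 1) - \<i> * f' x (0, axis i \<i>)) / 2"
      if "x \<in> I \<times> \<Omega>" for x
      using d_hol_slice_within[OF \<Omega>, of "snd x" "fst x" I "\<lambda>x. G x $ j $ r" "f' x" i] f'(1)[OF that] that
      by (auto simp: G_def)
    have "continuous_on (I \<times> \<Omega>) (\<lambda>x. (f' x (0, axis i 1) - \<i> * f' x (0, axis i \<i>)) / 2)"
      by (intro continuous_intros f'(2)) auto
    then show ?thesis by (rule continuous_on_eq) (rule eq[symmetric])
  qed
  have "continuous_on (I \<times> \<Omega>) (\<lambda>x. Psi (g (fst x)) gh i j k (snd x))" for i j k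
    unfolding Psi_def conn0_christoffel[of gh] unfolding christoffel_def
    by (intro continuous_on_diff continuous_on_sum continuous_on_mult cont[OF sI, unfolded G_def] cont0[OF sh] dG)
  then have "continuous_on (I \<times> \<Omega>) (\<lambda>x. S_fun (g (fst x)) gh (snd x))"
    unfolding S_fun_def inner_21_def
    by (intro continuous_on_Re continuous_on_cnj continuous_on_sum continuous_on_mult
        cont[OF sI, unfolded G_def] cont[OF sG, unfolded G_def])
  moreover have "continuous_on (I \<times> \<Omega>) (\<lambda>x. trace (g (fst x) (snd x) ** ginv (gh (snd x))))"
    unfolding trace_def matrix_mult_nth
    by (intro continuous_on_sum continuous_on_mult cont[OF sG, unfolded G_def] cont0[OF sL])
  ultimately have "continuous_on (I \<times> \<Omega>) (\<lambda>x. Q_fun \<Lambda> (g (fst x)) gh (snd x))"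
    unfolding Q_fun_def by (intro continuous_intros)
  then show ?thesis by (simp add: case_prod_unfold)
qed

text \<open>The size of \<open>gh\<close> and its derivatives is measured in finitely many compact coordinate sets
  that cover \<open>M\<close>. Only $S$ and $u$ have to be compared between charts, to identify a maximum over
  these sets as a local maximum in a chart.\<close>

theorem theorem1p1:
  fixes M :: "'a::t2_space set"
    and \<A> :: "('a, 'n::finite) chart set"
    and gh g0 :: "('a, 'n) metric_field"
    and K :: real
  assumes "compact_complex_manifold M \<A>"
    and "hermitian_metric \<A> gh"
    and "hermitian_metric \<A> g0"
    and "K > 0"
  shows "\<exists>C::real. \<forall>(\<tau>::ereal) (g :: real \<Rightarrow> ('a, 'n) metric_field).
    0 < \<tau> \<longrightarrow>
    smooth_curve_of_metrics \<A> \<tau> g \<longrightarrow>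
    (\<forall>c\<in>\<A>. \<forall>z\<in>chart_img c. g 0 c z = g0 c z) \<longrightarrow>
    (\<forall>t\<in>time_interval \<tau>. \<forall>c\<in>\<A>. \<forall>z\<in>chart_img c.
       (\<forall>v. herm_form (gh c z) v / K \<le> herm_form (g t c z) v \<and>
            herm_form (g t c z) v \<le> K * herm_form (gh c z) v) \<and>
       norm_11 (g t c z) (\<lambda>r s. gdot_plus_ric \<tau> g t c r s z)
         \<le> K * (1 + sqrt (S_quantity (g t c) (gh c) z)) \<and>
       norm_d_11 (g t c z) (\<lambda>a r s. nabla_11 (g t c) (gdot_plus_ric \<tau> g t c) a r s z)
         \<le> K * (nabla_Psi_norm (g t c) (gh c) z + nabla_bar_Psi_norm (g t c) (gh c) z
                 + 1 + S_quantity (g t c) (gh c) z) \<and>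
       torsion_norm (g t c) z \<le> K) \<longrightarrow>
    (\<forall>t\<in>time_interval \<tau>. \<forall>c\<in>\<A>. \<forall>z\<in>chart_img c.
       (nabla_hat_g_norm (g t c) (gh c) z)\<^sup>2 \<le> C)"
proof -
  have atlas: "holomorphic_atlas M \<A>" and M: "compact M"
    using assms(1) unfolding compact_complex_manifold_def by auto
  note gh = assms(2) and g0 = assms(3)
  obtain D :: "(('a, 'n) chart \<times> (complex^'n) set) set" where D: "finite D"
    "\<And>c C. (c, C) \<in> D \<Longrightarrow> c \<in> \<A> \<and> compact C \<and> C \<subseteq> chart_img c"
    "\<And>p. p \<in> M \<Longrightarrow> \<exists>(c, C)\<in>D. p \<in> fst c \<and> snd c p \<in> C"
    by (rule finite_chart_cover[OF atlas M]) (rule that)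
  have D': "fst q \<in> \<A>" "compact (snd q)" "snd q \<subseteq> chart_img (fst q)" if "q \<in> D" for q
    using D(2)[of "fst q" "snd q"] that by auto
  note posdef = metric_posdef[OF atlas] and ms = smooth_on_imp_msmooth[OF metric_smooth[OF atlas]]
  have open_img: "open (chart_img c)" if "c \<in> \<A>" for c using chartD(2)[OF atlas that] .
  \<comment> \<open>B and S0 below depend on the cover, \<open>gh\<close> and \<open>g0\<close> only
    and are fixed before \<open>\<tau>\<close> and the curve, which gives the required dependence of
    the final constant.\<close>
  obtain B where B: "1 \<le> B" "\<And>q z. q \<in> D \<Longrightarrow> z \<in> snd q \<Longrightarrow> hat_size (gh (fst q)) z \<le> B"
  proof (rule finite_family_bounded[OF D(1), of snd "\<lambda>q. hat_size (gh (fst q))"])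
    show "continuous_on (snd q) (hat_size (gh (fst q)))" if "q \<in> D" for q
      by (rule continuous_on_subset[OF continuous_on_hat_size[OF open_img ms[OF gh] posdef(3)[OF gh]]])
        (use D'[OF that] in auto)
  qed (use D' in auto)
  obtain S0 where S0: "1 \<le> S0" "\<And>q z. q \<in> D \<Longrightarrow> z \<in> snd q \<Longrightarrow> S_fun (g0 (fst q)) (gh (fst q)) z \<le> S0"
  proof (rule finite_family_bounded[OF D(1), of snd "\<lambda>q. S_fun (g0 (fst q)) (gh (fst q))"])
    show "continuous_on (snd q) (S_fun (g0 (fst q)) (gh (fst q)))" if "q \<in> D" for q
      by (rule continuous_on_subset[OF continuous_on_S_fun[OF open_img ms[OF g0] posdef(3)[OF g0] ms[OF gh] posdef(3)[OF gh]]])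
        (use D'[OF that] in auto)
  qed (use D' in auto)
  define b where "b = total_const TYPE('n) K B"
  define \<Lambda> where "\<Lambda> = lambda_const b"
  define S1 where "S1 = max S0 ((psi_bound b)\<^sup>2)"
  have b: "1 \<le> b" unfolding b_def by (rule total_const_ge(2)[OF assms(4) B(1)])
  have \<Lambda>: "0 < \<Lambda>" using b by (simp add: \<Lambda>_def lambda_const_def)
  show ?thesis
  \<comment> \<open>As u lies between 0 and b^2 at a maximum of the product, the product is at most
    (Lambda + b^2) S1 there; anywhere else it is at least Lambda S.\<close>
  proof (rule exI[of _ "(\<Lambda> + b * b) * S1 / \<Lambda>"], intro allI impI ballI)
    fix \<tau> :: ereal and g :: "real \<Rightarrow> ('a, 'n) metric_field" and t1 c1 z1
    assume curve: "smooth_curve_of_metrics \<A> \<tau> g"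
      and init: "\<forall>c\<in>\<A>. \<forall>z\<in>chart_img c. g 0 c z = g0 c z"
      and hyp: "\<forall>t\<in>time_interval \<tau>. \<forall>c\<in>\<A>. \<forall>z\<in>chart_img c.
       (\<forall>v. herm_form (gh c z) v / K \<le> herm_form (g t c z) v \<and>
            herm_form (g t c z) v \<le> K * herm_form (gh c z) v) \<and>
       norm_11 (g t c z) (\<lambda>r s. gdot_plus_ric \<tau> g t c r s z)
         \<le> K * (1 + sqrt (S_quantity (g t c) (gh c) z)) \<and>
       norm_d_11 (g t c z) (\<lambda>a r s. nabla_11 (g t c) (gdot_plus_ric \<tau> g t c) a r s z)
         \<le> K * (nabla_Psi_norm (g t c) (gh c) z + nabla_bar_Psi_norm (g t c) (gh c) z
                 + 1 + S_quantity (g t c) (gh c) z) \<and>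
       torsion_norm (g t c) z \<le> K"
      and t1: "t1 \<in> time_interval \<tau>" and c1: "c1 \<in> \<A>" and z1: "z1 \<in> chart_img c1"
    let ?I = "time_interval \<tau>"
    let ?Q = "\<lambda>t c. Q_fun \<Lambda> (g t c) (gh c)"
    have g: "hermitian_metric \<A> (g t)" if "t \<in> ?I" for t
      using curve that unfolding smooth_curve_of_metrics_def by blast
    have smooth: "smooth_on (?I \<times> chart_img c) (\<lambda>(t, z). g t c z)" if "c \<in> \<A>" for c
      using curve that unfolding smooth_curve_of_metrics_def by blast
    have sub: "{0..t1} \<subseteq> ?I"
      using t1 by (auto simp: time_interval_def intro: order.strict_trans1[of _ "ereal t1"])
    have Sq: "S_quantity (g t c) (gh c) z = S_fun (g t c) (gh c) z"
      "(nabla_hat_g_norm (g t c) (gh c) z)\<^sup>2 = S_fun (g t c) (gh c) z"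
      if "t \<in> ?I" "c \<in> \<A>" "z \<in> chart_img c" for t c z
      using nabla_hat_g_norm_eq[of "g t c" z "gh c"] posdef(1,2)[OF g[OF that(1)] that(2,3)]
      unfolding S_fun_def by blast+
    have S_nonneg: "0 \<le> S_fun (g t c) (gh c) z" if "t \<in> ?I" "c \<in> \<A>" "z \<in> chart_img c" for t c z
      unfolding Sq(2)[OF that, symmetric] by simp
    have u_nonneg: "0 \<le> Re (trace (g t c z ** ginv (gh c z)))" if "t \<in> ?I" "c \<in> \<A>" "z \<in> chart_img c" for t c z
      using posdef(1,2)[OF g[OF that(1)] that(2,3)] posdef(1,2)[OF gh that(2,3)]
      by (rule trace_ginv_nonneg)
    have invariant: "?Q t c (snd c p) = ?Q t d (snd d p)"
      if "t \<in> ?I" "c \<in> \<A>" "d \<in> \<A>" "p \<in> fst c" "p \<in> fst d" for t c d p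
      unfolding Q_fun_def S_fun_def using chart_invariance[OF atlas g[OF that(1)] gh that(2-5)] by simp
    \<comment> \<open>One compact piece serves a given point at all times, because the transition
      maps do not involve time.\<close>
    have piece: "\<exists>q\<in>D. \<exists>w\<in>snd q. \<forall>t\<in>?I. ?Q t c z = ?Q t (fst q) w"
      if c: "c \<in> \<A>" and z: "z \<in> chart_img c" for c z
    proof -
      define p where "p = chart_inv c z"
      have p: "snd c p = z" "p \<in> fst c" using snd_chart_inv[OF atlas c z] by (auto simp: p_def)
      then have "p \<in> M" using chartD(4)[OF atlas c] by blast
      then obtain d C where d: "(d, C) \<in> D" "p \<in> fst d" "snd d p \<in> C" using D(3) by blast
      then have "\<forall>t\<in>?I. ?Q t c z = ?Q t d (snd d p)"
        using invariant[OF _ c _ p(2) d(2)] D(2) p(1) by blast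
      then show ?thesis using d by force
    qed
    obtain q1 w1 where q1: "q1 \<in> D" "w1 \<in> snd q1" "?Q t1 c1 z1 = ?Q t1 (fst q1) w1"
      using piece[OF c1 z1] t1 by blast
    have t1_mem: "(t1, w1) \<in> {0..t1} \<times> snd q1" using t1 q1 by (simp add: time_interval_def)
    \<comment> \<open>The maximum is taken over the compact interval from 0 to t1, as the whole time
      interval need not be compact.\<close>
    obtain q x where q: "q \<in> D" "x \<in> {0..t1} \<times> snd q"
      "\<And>q' y. q' \<in> D \<Longrightarrow> y \<in> {0..t1} \<times> snd q' \<Longrightarrow>
        (\<lambda>(t, z). ?Q t (fst q') z) y \<le> (\<lambda>(t, z). ?Q t (fst q) z) x"
    proof (rule finite_family_maximum[OF D(1) _ _ q1(1), of "\<lambda>q. {0..t1} \<times> snd q" "\<lambda>q (t, z). ?Q t (fst q) z"])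
      fix q assume q: "q \<in> D"
      show "compact ({0..t1} \<times> snd q)" using D'(2)[OF q] by (intro compact_Times) auto
      have "continuous_on (?I \<times> chart_img (fst q)) (\<lambda>(t, z). ?Q t (fst q) z)"
        by (rule continuous_on_Q_fun[OF open_img smooth posdef(3)[OF g] ms[OF gh] posdef(3)[OF gh]])
          (use D'(1)[OF q] in auto)
      then show "continuous_on ({0..t1} \<times> snd q) (\<lambda>(t, z). ?Q t (fst q) z)"
        by (rule continuous_on_subset) (use sub D'(3)[OF q] in auto)
    qed (use t1_mem in auto)
    obtain t z where x: "x = (t, z)" "0 \<le> t" "t \<le> t1" "z \<in> snd q" using q(2) by (cases x) auto
    define c where "c = fst q"
    have c: "c \<in> \<A>" "z \<in> chart_img c" "hat_size (gh c) z \<le> B"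
      using D'[OF q(1)] B(2)[OF q(1)] x(4) by (auto simp: c_def)
    have t: "t \<in> ?I" using x sub by auto
    \<comment> \<open>Invariance upgrades the maximum over the pieces to a maximum over all charts.
      This makes it a local spatial maximum even when z lies on the boundary of its compact
      piece.\<close>
    have max: "?Q t' c' z' \<le> ?Q t c z" if m: "c' \<in> \<A>" "z' \<in> chart_img c'" "0 \<le> t'" "t' \<le> t1" for t' c' z'
    proof -
      have t': "t' \<in> ?I" using that sub by auto
      obtain q' w where "q' \<in> D" "w \<in> snd q'" "?Q t' c' z' = ?Q t' (fst q') w"
        using piece[OF m(1,2)] t' by blast
      then show ?thesis using q(3)[of q' "(t', w)"] that by (simp add: x(1) c_def)
    qed
    have comparable: "herm_form (gh c z) v / K \<le> herm_form (g t c z) v"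
        "herm_form (g t c z) v \<le> K * herm_form (gh c z) v" for v
      using hyp t c by blast+
    have hat: "N1 (gh c z) \<le> B" "N1 (ginv (gh c z)) \<le> B"
    proof -
      have "N1 (gh c z) + N1 (ginv (gh c z)) \<le> hat_size (gh c) z"
        unfolding hat_size_def add.assoc by (intro add_left_mono) (auto intro!: add_nonneg_nonneg sum_nonneg)
      then show "N1 (gh c z) \<le> B" "N1 (ginv (gh c z)) \<le> B"
        using c(3) N1_nonneg[of "gh c z"] N1_nonneg[of "ginv (gh c z)"] by linarith+
    qed
    have u_le: "Re (trace (g t c z ** ginv (gh c z))) \<le> b * b"
      unfolding b_def
      by (rule order.trans[OF complex_Re_le_cmod cmod_u_le[OF posdef(1,2)[OF g[OF t] c(1,2)] posdef(1,2)[OF gh c(1,2)]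
            B(1) hat assms(4) comparable]]; assumption)
    have "S_fun (g t c) (gh c) z \<le> S1"
    proof (cases "t = 0")
      case True
      have "conn0 (g t c) a z = conn0 (g0 c) a z" for a
      proof -
        \<comment> \<open>The two metrics agree on the whole open chart image, hence so do their
          first derivatives, and the bound S0 applies.\<close>
        have "frechet_derivative (\<lambda>w. g t c w $ r $ s) (at z) = frechet_derivative (\<lambda>w. g0 c w $ r $ s) (at z)" for r s
          by (rule frechet_derivative_cong_open[OF open_img[OF c(1)] c(2)]) (use init c(1) True in simp)
        then have "Md (dz0 a) (g t c) z = Md (dz0 a) (g0 c) z" by (simp add: vec_eq_iff wd_def)
        moreover have "g t c z = g0 c z" using init c True by simp
        ultimately show ?thesis by (simp add: conn0_def)
      qed
      then have "S_fun (g t c) (gh c) z = S_fun (g0 c) (gh c) z"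
        unfolding S_fun_def inner_21_Psi using init c True by simp
      then show ?thesis using S0(2)[OF q(1) x(4)] by (simp add: S1_def c_def)
    next
      case False
      \<comment> \<open>Open on both sides: even t = t1 is interior here, since t1 is strictly below
        \<open>\<tau>\<close>. Values after t do not enter the comparison.\<close>
      define J where "J = {t. 0 < t \<and> ereal t < \<tau>}"
      have J: "open J" "J \<subseteq> ?I" "t \<in> J"
      proof -
        have "J = {0<..} \<inter> ereal -` {..<\<tau>}" by (auto simp: J_def)
        then show "open J" using open_ereal_vimage[of "{..<\<tau>}"] by (simp add: open_Int)
        show "J \<subseteq> ?I" "t \<in> J" using t False x(2) by (auto simp: J_def time_interval_def)
      qed
      interpret F: chart_flow J "chart_img c" "\<lambda>t. g t c" "gh c"
      proof
        show "smooth_on (J \<times> chart_img c) (\<lambda>(t, z). g t c z)"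
          by (rule smooth_on_subset[OF smooth[OF c(1)]]) (use J(2) in auto)
        show "smooth_on (chart_img c) (gh c)" by (rule metric_smooth[OF atlas gh c(1)])
      qed (use J posdef(1,2)[OF g c(1)] posdef(1,2)[OF gh c(1)] open_img[OF c(1)] in blast)+
      define f where "f = (\<lambda>y. (of_real \<Lambda> + F.u y) * F.S y)"
      have sf: "smooth_on (J \<times> chart_img c) f"
        unfolding f_def by (intro smooth_on_mult smooth_on_add smooth_on_const F.smooth_u F.smooth_S)
      have rf: "cnj (f y) = f y" if "y \<in> J \<times> chart_img c" for y
        using F.u_real[OF that] F.S_real[OF that] by (simp add: f_def)
      have Qf: "Re (f (t', z')) = ?Q t' c z'" if "t' \<in> J" "z' \<in> chart_img c" for t' z'
      proof -
        have "Im (F.S (t', z')) = 0"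
          using F.S_real[of "(t', z')"] that by (simp add: complex_eq_iff)
        then show ?thesis
          using F.S_eq[OF that] by (simp add: f_def Q_fun_def S_fun_def F.u_eq)
      qed
      have max_f: "Re (f (t', z')) \<le> Re (f (t, z))" if "t' \<in> J" "t' \<le> t" "z' \<in> chart_img c" for t' z'
        unfolding Qf[OF that(1,3)] Qf[OF J(3) c(2)]
        using that x(3) by (intro max[OF c(1)]) (auto simp: J_def)
      note deriv = F.maximum_derivatives[OF sf rf J(3) c(2) max_f]
      have E: "gdot_plus_ric \<tau> g t c r s w = F.E (t, w) $ r $ s" if "w \<in> chart_img c" for r s w
        unfolding gdot_plus_ric_def by (rule F.gdot_plus_ric_eq[OF J(3) that J(2)])
      have dE: "nabla_11 (g t c) (gdot_plus_ric \<tau> g t c) a r s z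
          = (Md (dz a) F.E (t, z) - F.conn F.G a (t, z) ** F.E (t, z)) $ r $ s" for a r s
        by (rule F.nabla_11_eq[OF J(3) c(2) E])
      have "sqrt (S_quantity (g t c) (gh c) z) \<le> psi_bound b"
        unfolding b_def
      proof (rule F.chart_maximum[OF J(3) c(2) B(1) c(3) assms(4) comparable])
        show "norm_11 (g t c z) (\<lambda>r s. F.E (t, z) $ r $ s) \<le> K * (1 + sqrt (S_quantity (g t c) (gh c) z))"
          "norm_d_11 (g t c z) (\<lambda>a r s. (Md (dz a) F.E (t, z) - F.conn F.G a (t, z) ** F.E (t, z)) $ r $ s)
           \<le> K * (nabla_Psi_norm (g t c) (gh c) z + nabla_bar_Psi_norm (g t c) (gh c) z + 1 + S_quantity (g t c) (gh c) z)"
          "torsion_norm (g t c) z \<le> K"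
          using hyp[rule_format, OF t c(1,2)] unfolding E[OF c(2)] dE by blast+
      qed (use deriv in \<open>simp_all add: f_def \<Lambda>_def b_def\<close>)
      then have "S_quantity (g t c) (gh c) z \<le> (psi_bound b)\<^sup>2"
        by (rule sqrt_le_D)
      then show ?thesis unfolding Sq(1)[OF t c(1,2)] S1_def by simp
    qed
    then have "?Q t c z \<le> (\<Lambda> + b * b) * S1"
      unfolding Q_fun_def using u_le \<Lambda> b S_nonneg[OF t c(1,2)] by (intro mult_mono) auto
    moreover have "?Q t1 c1 z1 \<le> ?Q t c z"
      using t1 by (intro max c1 z1) (auto simp: time_interval_def)
    moreover have "\<Lambda> * S_fun (g t1 c1) (gh c1) z1 \<le> ?Q t1 c1 z1"
      unfolding Q_fun_def
      using u_nonneg[OF t1 c1 z1] S_nonneg[OF t1 c1 z1] by (intro mult_right_mono) auto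
    ultimately have "\<Lambda> * S_fun (g t1 c1) (gh c1) z1 \<le> (\<Lambda> + b * b) * S1" by linarith
    then show "(nabla_hat_g_norm (g t1 c1) (gh c1) z1)\<^sup>2 \<le> (\<Lambda> + b * b) * S1 / \<Lambda>"
      unfolding Sq(2)[OF t1 c1 z1] using \<Lambda> by (simp add: pos_le_divide_eq mult.commute)
  qed
qed

end
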